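(* Every algebraic model of $\mathrm{ZF}$ is a pointwise definable model of $\mathrm{ZFC}+V=\mathrm{HOD}$.
   Context: A structure $M$ (here a model $(M,\in^M)$ of set theory) is algebraic (pointwise algebraic) if every element $a\in M$ is algebraic in $M$, i.e. there is a first-order formula $\varphi(x)$ without parameters such that $\{b\in M\mid M\models\varphi[b]\}$ is a finite set containing $a$. It is pointwise definable if every element $a\in M$ is definable in $M$ without parameters, i.e. is the unique $b\in M$ with $M\models\varphi[b]$ for some formula $\varphi(x)$. $V=\mathrm{HOD}$ is the axiom stating that every set is hereditarily ordinal definable (a set is ordinal definable if it is definable in some $(V_\theta,\in)$ using ordinal parameters below $\theta$). *)

theory Defs
  imports Main
begin

section \<open>First-order formulas of the language of set theory\<close>

text \<open>Variables are de Bruijn indices: in \<^term>\<open>Forall p\<close>, index 0 of \<open>p\<close> is bound.\<close>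

datatype fm =
    Member nat nat  (infix "\<^bold>\<in>" 60)
  | Equal nat nat  (infix "\<^bold>=" 60)
  | Nand fm fm
  | Forall fm  ("\<^bold>\<forall>_" [48] 48)

definition Neg :: "fm \<Rightarrow> fm"  ("\<^bold>\<not>_" [55] 55)
  where "\<^bold>\<not>p = Nand p p"

definition And :: "fm \<Rightarrow> fm \<Rightarrow> fm"  (infixr "\<^bold>\<and>" 45)
  where "(p \<^bold>\<and> q) = \<^bold>\<not>(Nand p q)"

definition Or :: "fm \<Rightarrow> fm \<Rightarrow> fm"  (infixr "\<^bold>\<or>" 40)
  where "(p \<^bold>\<or> q) = Nand (\<^bold>\<not>p) (\<^bold>\<not>q)"

definition Implies :: "fm \<Rightarrow> fm \<Rightarrow> fm"  (infixr "\<^bold>\<longrightarrow>" 35)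
  where "(p \<^bold>\<longrightarrow> q) = Nand p (\<^bold>\<not>q)"

definition Iff :: "fm \<Rightarrow> fm \<Rightarrow> fm"  (infixr "\<^bold>\<longleftrightarrow>" 35)
  where "(p \<^bold>\<longleftrightarrow> q) = ((p \<^bold>\<longrightarrow> q) \<^bold>\<and> (q \<^bold>\<longrightarrow> p))"

definition Exists :: "fm \<Rightarrow> fm"  ("\<^bold>\<exists>_" [48] 48)
  where "(\<^bold>\<exists>p) = \<^bold>\<not>(\<^bold>\<forall>(\<^bold>\<not>p))"

primrec fv :: "fm \<Rightarrow> nat set" where
  "fv (x \<^bold>\<in> y) = {x, y}"
| "fv (x \<^bold>= y) = {x, y}"
| "fv (Nand p q) = fv p \<union> fv q"
| "fv (\<^bold>\<forall>p) = {n. Suc n \<in> fv p}"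

text \<open>Renaming of the free variables along \<open>f\<close>.\<close>

primrec ren :: "(nat \<Rightarrow> nat) \<Rightarrow> fm \<Rightarrow> fm" where
  "ren f (x \<^bold>\<in> y) = (f x \<^bold>\<in> f y)"
| "ren f (x \<^bold>= y) = (f x \<^bold>= f y)"
| "ren f (Nand p q) = Nand (ren f p) (ren f q)"
| "ren f (\<^bold>\<forall>p) = (\<^bold>\<forall>(ren (case_nat 0 (\<lambda>n. Suc (f n))) p))"

text \<open>A structure is a type \<^typ>\<open>'a\<close> (its domain) with a binary relation \<open>E\<close> on it
  interpreting membership; \<open>s\<close> assigns values to the variables.\<close>

primrec sat :: "('a \<Rightarrow> 'a \<Rightarrow> bool) \<Rightarrow> fm \<Rightarrow> (nat \<Rightarrow> 'a) \<Rightarrow> bool" where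
  "sat E (x \<^bold>\<in> y) s \<longleftrightarrow> E (s x) (s y)"
| "sat E (x \<^bold>= y) s \<longleftrightarrow> s x = s y"
| "sat E (Nand p q) s \<longleftrightarrow> \<not> (sat E p s \<and> sat E q s)"
| "sat E (\<^bold>\<forall>p) s \<longleftrightarrow> (\<forall>a. sat E p (case_nat a s))"

lemma sat_connectives [simp]:
  "sat E (\<^bold>\<not>p) s \<longleftrightarrow> \<not> sat E p s"
  "sat E (p \<^bold>\<and> q) s \<longleftrightarrow> sat E p s \<and> sat E q s"
  "sat E (p \<^bold>\<or> q) s \<longleftrightarrow> sat E p s \<or> sat E q s"
  "sat E (p \<^bold>\<longrightarrow> q) s \<longleftrightarrow> (sat E p s \<longrightarrow> sat E q s)"
  "sat E (p \<^bold>\<longleftrightarrow> q) s \<longleftrightarrow> (sat E p s \<longleftrightarrow> sat E q s)"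
  "sat E (\<^bold>\<exists>p) s \<longleftrightarrow> (\<exists>a. sat E p (case_nat a s))"
  by (auto simp: Neg_def And_def Or_def Implies_def Iff_def Exists_def)

lemma sat_ren [simp]: "sat E (ren f p) s \<longleftrightarrow> sat E p (\<lambda>n. s (f n))"
proof (induction p arbitrary: f s)
  case (Forall p)
  have "(\<lambda>n. case_nat a s (case_nat 0 (\<lambda>n. Suc (f n)) n)) = case_nat a (\<lambda>n. s (f n))" for a
    by (auto split: nat.split)
  with Forall show ?case by simp
qed auto

text \<open>As usual, a formula with free variables holds in a structure iff its universal closure does.\<close>

definition models :: "('a \<Rightarrow> 'a \<Rightarrow> bool) \<Rightarrow> fm set \<Rightarrow> bool"
  where "models E T \<longleftrightarrow> (\<forall>p\<in>T. \<forall>s. sat E p s)"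

definition defined_set :: "('a \<Rightarrow> 'a \<Rightarrow> bool) \<Rightarrow> fm \<Rightarrow> 'a set"
  where "defined_set E p = {b. sat E p (\<lambda>_. b)}"

definition algebraic_in :: "('a \<Rightarrow> 'a \<Rightarrow> bool) \<Rightarrow> 'a \<Rightarrow> bool"
  where "algebraic_in E a \<longleftrightarrow>
    (\<exists>p. fv p \<subseteq> {0} \<and> finite (defined_set E p) \<and> a \<in> defined_set E p)"

definition definable_in :: "('a \<Rightarrow> 'a \<Rightarrow> bool) \<Rightarrow> 'a \<Rightarrow> bool"
  where "definable_in E a \<longleftrightarrow> (\<exists>p. fv p \<subseteq> {0} \<and> defined_set E p = {a})"

definition algebraic :: "('a \<Rightarrow> 'a \<Rightarrow> bool) \<Rightarrow> bool"
  where "algebraic E \<longleftrightarrow> (\<forall>a. algebraic_in E a)"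

definition pointwise_definable :: "('a \<Rightarrow> 'a \<Rightarrow> bool) \<Rightarrow> bool"
  where "pointwise_definable E \<longleftrightarrow> (\<forall>a. definable_in E a)"


section \<open>Set-theoretic notions inside a structure\<close>

text \<open>Each notion is given by its meaning in a structure (quantifiers range over the domain)
  and, below, by a formula; the lemmas \<open>sat_\<dots>\<close> state that the two agree.\<close>

context
  fixes E :: "'a \<Rightarrow> 'a \<Rightarrow> bool"  (infix "\<epsilon>" 50)
begin

definition "is_subset x y \<longleftrightarrow> (\<forall>z. z \<epsilon> x \<longrightarrow> z \<epsilon> y)"

definition "is_empty x \<longleftrightarrow> (\<forall>z. \<not> z \<epsilon> x)"

definition "is_upair a b c \<longleftrightarrow> (\<forall>z. z \<epsilon> c \<longleftrightarrow> z = a \<or> z = b)"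

definition "is_pair a b c \<longleftrightarrow> (\<exists>u v. is_upair a a u \<and> is_upair a b v \<and> is_upair u v c)"

definition "is_succ x y \<longleftrightarrow> (\<forall>z. z \<epsilon> y \<longleftrightarrow> z \<epsilon> x \<or> z = x)"

definition "is_transitive x \<longleftrightarrow> (\<forall>y. y \<epsilon> x \<longrightarrow> is_subset y x)"

definition "is_ordinal x \<longleftrightarrow> is_transitive x \<and> (\<forall>y. y \<epsilon> x \<longrightarrow> is_transitive y)"

definition "is_inductive I \<longleftrightarrow>
  (\<exists>z. is_empty z \<and> z \<epsilon> I) \<and> (\<forall>x. x \<epsilon> I \<longrightarrow> (\<exists>y. is_succ x y \<and> y \<epsilon> I))"

definition "is_omega w \<longleftrightarrow> is_inductive w \<and> (\<forall>I. is_inductive I \<longrightarrow> is_subset w I)"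

primrec is_num :: "nat \<Rightarrow> 'a \<Rightarrow> bool" where
  "is_num 0 x \<longleftrightarrow> is_empty x"
| "is_num (Suc k) x \<longleftrightarrow> (\<exists>y. is_num k y \<and> is_succ y x)"

text \<open>\<open>\<langle>x, y\<rangle> \<in> r\<close>; for a function \<open>r\<close>, this is \<open>r(x) = y\<close>.\<close>

definition "is_app r x y \<longleftrightarrow> (\<exists>p. is_pair x y p \<and> p \<epsilon> r)"

text \<open>\<open>f\<close> is a function with domain \<open>d\<close>.\<close>

definition "is_fun f d \<longleftrightarrow>
  (\<forall>p. p \<epsilon> f \<longrightarrow> (\<exists>x y. x \<epsilon> d \<and> is_pair x y p)) \<and>
  (\<forall>x. x \<epsilon> d \<longrightarrow> (\<exists>y. \<forall>z. is_app f x z \<longleftrightarrow> z = y))"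

definition "is_fun_into f d A \<longleftrightarrow> is_fun f d \<and> (\<forall>x y. is_app f x y \<longrightarrow> y \<epsilon> A)"

text \<open>\<open>A = V\<^sub>\<theta>\<close>, by the recursion \<open>V\<^sub>\<alpha> = (\<Union>\<beta><\<alpha>. Pow V\<^sub>\<beta>)\<close>.\<close>

definition "is_V th A \<longleftrightarrow> (\<exists>f t. is_succ th t \<and> is_fun f t \<and> is_app f th A \<and>
  (\<forall>a v. a \<epsilon> t \<and> is_app f a v \<longrightarrow>
    (\<forall>y. y \<epsilon> v \<longleftrightarrow> (\<exists>b u. b \<epsilon> a \<and> is_app f b u \<and> is_subset y u))))"

text \<open>\<open>T\<close> is the transitive closure of \<open>x\<close>.\<close>

definition "is_trcl x T \<longleftrightarrow> is_subset x T \<and> is_transitive T \<and>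
  (\<forall>U. is_subset x U \<and> is_transitive U \<longrightarrow> is_subset T U)"

text \<open>Formulas as objects of the structure are coded by triples \<open>\<langle>k, \<langle>a, b\<rangle>\<rangle>\<close>, with variables
  \<open>v\<^sub>i\<close> named by \<open>i \<in> \<omega>\<close>: \<open>k = 0\<close> codes \<open>v\<^sub>a \<in> v\<^sub>b\<close>, \<open>k = 1\<close> codes \<open>v\<^sub>a = v\<^sub>b\<close>, \<open>k = 2\<close> codes
  \<open>\<not> (a \<and> b)\<close> and \<open>k = 3\<close> codes \<open>\<forall>v\<^sub>a. b\<close>. If \<open>\<omega>\<close> of the structure is nonstandard, so are some
  of these formulas.\<close>

definition "is_code k a b c \<longleftrightarrow> (\<exists>t p. is_num k t \<and> is_pair a b p \<and> is_pair t p c)"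

definition "is_formula_closed w F \<longleftrightarrow>
  (\<forall>i j c. i \<epsilon> w \<and> j \<epsilon> w \<and> (is_code 0 i j c \<or> is_code 1 i j c) \<longrightarrow> c \<epsilon> F) \<and>
  (\<forall>a b c. a \<epsilon> F \<and> b \<epsilon> F \<and> is_code 2 a b c \<longrightarrow> c \<epsilon> F) \<and>
  (\<forall>i a c. i \<epsilon> w \<and> a \<epsilon> F \<and> is_code 3 i a c \<longrightarrow> c \<epsilon> F)"

definition "is_formulas w F \<longleftrightarrow>
  is_formula_closed w F \<and> (\<forall>G. is_formula_closed w G \<longrightarrow> is_subset F G)"

text \<open>The functions \<open>s\<close> and \<open>t\<close> agree except possibly at \<open>i\<close>.\<close>

definition "is_variant i s t \<longleftrightarrow> (\<forall>j y. j \<noteq> i \<longrightarrow> (is_app s j y \<longleftrightarrow> is_app t j y))"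

text \<open>For \<open>c \<in> F\<close> and \<open>s : \<omega> \<rightarrow> A\<close>, \<open>\<langle>c, s\<rangle> \<in> S\<close> iff \<open>(A, \<in>)\<close> satisfies \<open>c\<close> under the
  assignment \<open>s\<close>.\<close>

definition "is_satisfaction w F A S \<longleftrightarrow> (\<forall>s. is_fun_into s w A \<longrightarrow>
  (\<forall>i j c. i \<epsilon> w \<and> j \<epsilon> w \<and> is_code 0 i j c \<longrightarrow>
    (is_app S c s \<longleftrightarrow> (\<exists>x y. is_app s i x \<and> is_app s j y \<and> x \<epsilon> y))) \<and>
  (\<forall>i j c. i \<epsilon> w \<and> j \<epsilon> w \<and> is_code 1 i j c \<longrightarrow>
    (is_app S c s \<longleftrightarrow> (\<exists>x y. is_app s i x \<and> is_app s j y \<and> x = y))) \<and>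
  (\<forall>a b c. a \<epsilon> F \<and> b \<epsilon> F \<and> is_code 2 a b c \<longrightarrow>
    (is_app S c s \<longleftrightarrow> \<not> (is_app S a s \<and> is_app S b s))) \<and>
  (\<forall>i a c. i \<epsilon> w \<and> a \<epsilon> F \<and> is_code 3 i a c \<longrightarrow>
    (is_app S c s \<longleftrightarrow> (\<forall>t. is_fun_into t w A \<and> is_variant i s t \<longrightarrow> is_app S a t))))"

text \<open>\<open>s : \<omega> \<rightarrow> \<theta>\<close> is \<open>0\<close> from some point on. Such sequences represent finite lists of
  ordinal parameters below \<open>\<theta>\<close>.\<close>

definition "is_ordinal_params w th s \<longleftrightarrow> is_fun_into s w th \<and>
  (\<exists>m. m \<epsilon> w \<and> (\<forall>i y. m \<epsilon> i \<and> is_app s i y \<longrightarrow> is_empty y))"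

text \<open>\<open>x\<close> is the only element of \<open>A = V\<^sub>\<theta>\<close> such that \<open>(V\<^sub>\<theta>, \<in>)\<close> satisfies \<open>c\<close> with \<open>v\<^sub>0\<close> interpreted
  by \<open>x\<close> and the other variables by the ordinal parameters \<open>s\<close>.\<close>

definition "is_OD x \<longleftrightarrow> (\<exists>w F th A S c s z.
  is_omega w \<and> is_formulas w F \<and> is_ordinal th \<and> is_V th A \<and> is_satisfaction w F A S \<and>
  c \<epsilon> F \<and> is_ordinal_params w th s \<and> is_empty z \<and> x \<epsilon> A \<and>
  (\<forall>t y. is_fun_into t w A \<and> is_variant z s t \<and> is_app t z y \<longrightarrow> (is_app S c t \<longleftrightarrow> y = x)))"

definition "is_HOD x \<longleftrightarrow> is_OD x \<and> (\<exists>T. is_trcl x T \<and> (\<forall>y. y \<epsilon> T \<longrightarrow> is_OD y))"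

end

definition "subset_fm x y = (\<^bold>\<forall>(0 \<^bold>\<in> x+1 \<^bold>\<longrightarrow> 0 \<^bold>\<in> y+1))"

definition "empty_fm x = (\<^bold>\<forall>\<^bold>\<not>(0 \<^bold>\<in> x+1))"

definition "upair_fm a b c = (\<^bold>\<forall>(0 \<^bold>\<in> c+1 \<^bold>\<longleftrightarrow> 0 \<^bold>= a+1 \<^bold>\<or> 0 \<^bold>= b+1))"

definition "pair_fm a b c =
  (\<^bold>\<exists>\<^bold>\<exists>(upair_fm (a+2) (a+2) 1 \<^bold>\<and> upair_fm (a+2) (b+2) 0 \<^bold>\<and> upair_fm 1 0 (c+2)))"

definition "succ_fm x y = (\<^bold>\<forall>(0 \<^bold>\<in> y+1 \<^bold>\<longleftrightarrow> 0 \<^bold>\<in> x+1 \<^bold>\<or> 0 \<^bold>= x+1))"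

definition "transitive_fm x = (\<^bold>\<forall>(0 \<^bold>\<in> x+1 \<^bold>\<longrightarrow> subset_fm 0 (x+1)))"

definition "ordinal_fm x = (transitive_fm x \<^bold>\<and> (\<^bold>\<forall>(0 \<^bold>\<in> x+1 \<^bold>\<longrightarrow> transitive_fm 0)))"

definition "inductive_fm I =
  ((\<^bold>\<exists>(empty_fm 0 \<^bold>\<and> 0 \<^bold>\<in> I+1)) \<^bold>\<and> (\<^bold>\<forall>(0 \<^bold>\<in> I+1 \<^bold>\<longrightarrow> (\<^bold>\<exists>(succ_fm 1 0 \<^bold>\<and> 0 \<^bold>\<in> I+2)))))"

definition "omega_fm w = (inductive_fm w \<^bold>\<and> (\<^bold>\<forall>(inductive_fm 0 \<^bold>\<longrightarrow> subset_fm (w+1) 0)))"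

primrec num_fm :: "nat \<Rightarrow> nat \<Rightarrow> fm" where
  "num_fm 0 x = empty_fm x"
| "num_fm (Suc k) x = (\<^bold>\<exists>(num_fm k 0 \<^bold>\<and> succ_fm 0 (x+1)))"

definition "app_fm r x y = (\<^bold>\<exists>(pair_fm (x+1) (y+1) 0 \<^bold>\<and> 0 \<^bold>\<in> r+1))"

definition "fun_fm f d =
  ((\<^bold>\<forall>(0 \<^bold>\<in> f+1 \<^bold>\<longrightarrow> (\<^bold>\<exists>\<^bold>\<exists>(1 \<^bold>\<in> d+3 \<^bold>\<and> pair_fm 1 0 2)))) \<^bold>\<and>
   (\<^bold>\<forall>(0 \<^bold>\<in> d+1 \<^bold>\<longrightarrow> (\<^bold>\<exists>\<^bold>\<forall>(app_fm (f+3) 2 0 \<^bold>\<longleftrightarrow> 0 \<^bold>= 1)))))"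

definition "fun_into_fm f d A = (fun_fm f d \<^bold>\<and> (\<^bold>\<forall>\<^bold>\<forall>(app_fm (f+2) 1 0 \<^bold>\<longrightarrow> 0 \<^bold>\<in> A+2)))"

definition "V_fm th A =
  (\<^bold>\<exists>\<^bold>\<exists>(succ_fm (th+2) 0 \<^bold>\<and> fun_fm 1 0 \<^bold>\<and> app_fm 1 (th+2) (A+2) \<^bold>\<and>
    (\<^bold>\<forall>\<^bold>\<forall>(1 \<^bold>\<in> 2 \<^bold>\<and> app_fm 3 1 0 \<^bold>\<longrightarrow>
      (\<^bold>\<forall>(0 \<^bold>\<in> 1 \<^bold>\<longleftrightarrow> (\<^bold>\<exists>\<^bold>\<exists>(1 \<^bold>\<in> 4 \<^bold>\<and> app_fm 6 1 0 \<^bold>\<and> subset_fm 2 0))))))))"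

definition "trcl_fm x T = (subset_fm x T \<^bold>\<and> transitive_fm T \<^bold>\<and>
  (\<^bold>\<forall>(subset_fm (x+1) 0 \<^bold>\<and> transitive_fm 0 \<^bold>\<longrightarrow> subset_fm (T+1) 0)))"

definition "code_fm k a b c = (\<^bold>\<exists>\<^bold>\<exists>(num_fm k 1 \<^bold>\<and> pair_fm (a+2) (b+2) 0 \<^bold>\<and> pair_fm 1 0 (c+2)))"

definition "formula_closed_fm w F =
  ((\<^bold>\<forall>\<^bold>\<forall>\<^bold>\<forall>(2 \<^bold>\<in> w+3 \<^bold>\<and> 1 \<^bold>\<in> w+3 \<^bold>\<and> (code_fm 0 2 1 0 \<^bold>\<or> code_fm 1 2 1 0) \<^bold>\<longrightarrow> 0 \<^bold>\<in> F+3)) \<^bold>\<and>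
   (\<^bold>\<forall>\<^bold>\<forall>\<^bold>\<forall>(2 \<^bold>\<in> F+3 \<^bold>\<and> 1 \<^bold>\<in> F+3 \<^bold>\<and> code_fm 2 2 1 0 \<^bold>\<longrightarrow> 0 \<^bold>\<in> F+3)) \<^bold>\<and>
   (\<^bold>\<forall>\<^bold>\<forall>\<^bold>\<forall>(2 \<^bold>\<in> w+3 \<^bold>\<and> 1 \<^bold>\<in> F+3 \<^bold>\<and> code_fm 3 2 1 0 \<^bold>\<longrightarrow> 0 \<^bold>\<in> F+3)))"

definition "formulas_fm w F =
  (formula_closed_fm w F \<^bold>\<and> (\<^bold>\<forall>(formula_closed_fm (w+1) 0 \<^bold>\<longrightarrow> subset_fm (F+1) 0)))"

definition "variant_fm i s t =
  (\<^bold>\<forall>\<^bold>\<forall>(\<^bold>\<not>(1 \<^bold>= i+2) \<^bold>\<longrightarrow> (app_fm (s+2) 1 0 \<^bold>\<longleftrightarrow> app_fm (t+2) 1 0)))"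

definition "satisfaction_fm w F A S = (\<^bold>\<forall>(fun_into_fm 0 (w+1) (A+1) \<^bold>\<longrightarrow>
  (\<^bold>\<forall>\<^bold>\<forall>\<^bold>\<forall>(2 \<^bold>\<in> w+4 \<^bold>\<and> 1 \<^bold>\<in> w+4 \<^bold>\<and> code_fm 0 2 1 0 \<^bold>\<longrightarrow>
    (app_fm (S+4) 0 3 \<^bold>\<longleftrightarrow> (\<^bold>\<exists>\<^bold>\<exists>(app_fm 5 4 1 \<^bold>\<and> app_fm 5 3 0 \<^bold>\<and> 1 \<^bold>\<in> 0))))) \<^bold>\<and>
  (\<^bold>\<forall>\<^bold>\<forall>\<^bold>\<forall>(2 \<^bold>\<in> w+4 \<^bold>\<and> 1 \<^bold>\<in> w+4 \<^bold>\<and> code_fm 1 2 1 0 \<^bold>\<longrightarrow>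
    (app_fm (S+4) 0 3 \<^bold>\<longleftrightarrow> (\<^bold>\<exists>\<^bold>\<exists>(app_fm 5 4 1 \<^bold>\<and> app_fm 5 3 0 \<^bold>\<and> 1 \<^bold>= 0))))) \<^bold>\<and>
  (\<^bold>\<forall>\<^bold>\<forall>\<^bold>\<forall>(2 \<^bold>\<in> F+4 \<^bold>\<and> 1 \<^bold>\<in> F+4 \<^bold>\<and> code_fm 2 2 1 0 \<^bold>\<longrightarrow>
    (app_fm (S+4) 0 3 \<^bold>\<longleftrightarrow> \<^bold>\<not>(app_fm (S+4) 2 3 \<^bold>\<and> app_fm (S+4) 1 3)))) \<^bold>\<and>
  (\<^bold>\<forall>\<^bold>\<forall>\<^bold>\<forall>(2 \<^bold>\<in> w+4 \<^bold>\<and> 1 \<^bold>\<in> F+4 \<^bold>\<and> code_fm 3 2 1 0 \<^bold>\<longrightarrow>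
    (app_fm (S+4) 0 3 \<^bold>\<longleftrightarrow>
      (\<^bold>\<forall>(fun_into_fm 0 (w+5) (A+5) \<^bold>\<and> variant_fm 3 4 0 \<^bold>\<longrightarrow> app_fm (S+5) 2 0)))))))"

definition "ordinal_params_fm w th s = (fun_into_fm s w th \<^bold>\<and>
  (\<^bold>\<exists>(0 \<^bold>\<in> w+1 \<^bold>\<and> (\<^bold>\<forall>\<^bold>\<forall>(2 \<^bold>\<in> 1 \<^bold>\<and> app_fm (s+3) 1 0 \<^bold>\<longrightarrow> empty_fm 0)))))"

text \<open>Inside the eight quantifiers, the indices 7, \<dots>, 0 are \<open>w\<close>, \<open>F\<close>, \<open>\<theta>\<close>, \<open>A\<close>, \<open>S\<close>, \<open>c\<close>, \<open>s\<close>, \<open>z\<close>.\<close>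

definition "OD_fm x = (\<^bold>\<exists>\<^bold>\<exists>\<^bold>\<exists>\<^bold>\<exists>\<^bold>\<exists>\<^bold>\<exists>\<^bold>\<exists>\<^bold>\<exists>(
  omega_fm 7 \<^bold>\<and> formulas_fm 7 6 \<^bold>\<and> ordinal_fm 5 \<^bold>\<and> V_fm 5 4 \<^bold>\<and> satisfaction_fm 7 6 4 3 \<^bold>\<and>
  2 \<^bold>\<in> 6 \<^bold>\<and> ordinal_params_fm 7 5 1 \<^bold>\<and> empty_fm 0 \<^bold>\<and> x+8 \<^bold>\<in> 4 \<^bold>\<and>
  (\<^bold>\<forall>\<^bold>\<forall>(fun_into_fm 1 9 6 \<^bold>\<and> variant_fm 2 3 1 \<^bold>\<and> app_fm 1 2 0 \<^bold>\<longrightarrow>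
    (app_fm 5 4 1 \<^bold>\<longleftrightarrow> 0 \<^bold>= x+10)))))"

definition "HOD_fm x = (OD_fm x \<^bold>\<and> (\<^bold>\<exists>(trcl_fm (x+1) 0 \<^bold>\<and> (\<^bold>\<forall>(0 \<^bold>\<in> 1 \<^bold>\<longrightarrow> OD_fm 0)))))"

lemma sat_subset_fm [simp]: "sat E (subset_fm x y) s \<longleftrightarrow> is_subset E (s x) (s y)"
  by (simp add: subset_fm_def is_subset_def)

lemma sat_empty_fm [simp]: "sat E (empty_fm x) s \<longleftrightarrow> is_empty E (s x)"
  by (simp add: empty_fm_def is_empty_def)

lemma sat_upair_fm [simp]: "sat E (upair_fm a b c) s \<longleftrightarrow> is_upair E (s a) (s b) (s c)"
  by (simp add: upair_fm_def is_upair_def)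

lemma sat_pair_fm [simp]: "sat E (pair_fm a b c) s \<longleftrightarrow> is_pair E (s a) (s b) (s c)"
  by (simp add: pair_fm_def is_pair_def)

lemma sat_succ_fm [simp]: "sat E (succ_fm x y) s \<longleftrightarrow> is_succ E (s x) (s y)"
  by (simp add: succ_fm_def is_succ_def)

lemma sat_transitive_fm [simp]: "sat E (transitive_fm x) s \<longleftrightarrow> is_transitive E (s x)"
  by (simp add: transitive_fm_def is_transitive_def)

lemma sat_ordinal_fm [simp]: "sat E (ordinal_fm x) s \<longleftrightarrow> is_ordinal E (s x)"
  by (simp add: ordinal_fm_def is_ordinal_def)

lemma sat_inductive_fm [simp]: "sat E (inductive_fm x) s \<longleftrightarrow> is_inductive E (s x)"
  by (simp add: inductive_fm_def is_inductive_def)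

lemma sat_omega_fm [simp]: "sat E (omega_fm x) s \<longleftrightarrow> is_omega E (s x)"
  by (simp add: omega_fm_def is_omega_def)

lemma sat_num_fm [simp]: "sat E (num_fm k x) s \<longleftrightarrow> is_num E k (s x)"
  by (induction k arbitrary: x s) simp_all

lemma sat_app_fm [simp]: "sat E (app_fm r x y) s \<longleftrightarrow> is_app E (s r) (s x) (s y)"
  by (simp add: app_fm_def is_app_def)

lemma sat_fun_fm [simp]: "sat E (fun_fm f d) s \<longleftrightarrow> is_fun E (s f) (s d)"
  by (simp add: fun_fm_def is_fun_def eval_nat_numeral)

lemma sat_fun_into_fm [simp]: "sat E (fun_into_fm f d A) s \<longleftrightarrow> is_fun_into E (s f) (s d) (s A)"
  by (simp add: fun_into_fm_def is_fun_into_def)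

lemma sat_V_fm [simp]: "sat E (V_fm th A) s \<longleftrightarrow> is_V E (s th) (s A)"
  by (simp add: V_fm_def is_V_def)

lemma sat_trcl_fm [simp]: "sat E (trcl_fm x T) s \<longleftrightarrow> is_trcl E (s x) (s T)"
  by (simp add: trcl_fm_def is_trcl_def)

lemma sat_code_fm [simp]: "sat E (code_fm k a b c) s \<longleftrightarrow> is_code E k (s a) (s b) (s c)"
  by (simp add: code_fm_def is_code_def)

lemma sat_formula_closed_fm [simp]:
  "sat E (formula_closed_fm w F) s \<longleftrightarrow> is_formula_closed E (s w) (s F)"
  by (simp add: formula_closed_fm_def is_formula_closed_def eval_nat_numeral)

lemma sat_formulas_fm [simp]: "sat E (formulas_fm w F) s \<longleftrightarrow> is_formulas E (s w) (s F)"
  by (simp add: formulas_fm_def is_formulas_def)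

lemma sat_variant_fm [simp]: "sat E (variant_fm i t u) s \<longleftrightarrow> is_variant E (s i) (s t) (s u)"
  by (simp add: variant_fm_def is_variant_def)

lemma sat_satisfaction_fm [simp]:
  "sat E (satisfaction_fm w F A S) s \<longleftrightarrow> is_satisfaction E (s w) (s F) (s A) (s S)"
  by (simp add: satisfaction_fm_def is_satisfaction_def eval_nat_numeral)

lemma sat_ordinal_params_fm [simp]:
  "sat E (ordinal_params_fm w th t) s \<longleftrightarrow> is_ordinal_params E (s w) (s th) (s t)"
  by (simp add: ordinal_params_fm_def is_ordinal_params_def eval_nat_numeral)

lemma sat_OD_fm [simp]: "sat E (OD_fm x) s \<longleftrightarrow> is_OD E (s x)"
  by (simp add: OD_fm_def is_OD_def eval_nat_numeral)

lemma sat_HOD_fm [simp]: "sat E (HOD_fm x) s \<longleftrightarrow> is_HOD E (s x)"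
  by (simp add: HOD_fm_def is_HOD_def)


section \<open>Axioms\<close>

definition "Extensionality_ax = (\<^bold>\<forall>\<^bold>\<forall>((\<^bold>\<forall>(0 \<^bold>\<in> 2 \<^bold>\<longleftrightarrow> 0 \<^bold>\<in> 1)) \<^bold>\<longrightarrow> 1 \<^bold>= 0))"

definition "Foundation_ax =
  (\<^bold>\<forall>((\<^bold>\<exists>(0 \<^bold>\<in> 1)) \<^bold>\<longrightarrow> (\<^bold>\<exists>(0 \<^bold>\<in> 1 \<^bold>\<and> \<^bold>\<not>(\<^bold>\<exists>(0 \<^bold>\<in> 2 \<^bold>\<and> 0 \<^bold>\<in> 1))))))"

definition "Pairing_ax = (\<^bold>\<forall>\<^bold>\<forall>\<^bold>\<exists>(upair_fm 2 1 0))"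

definition "Union_ax = (\<^bold>\<forall>\<^bold>\<exists>\<^bold>\<forall>(0 \<^bold>\<in> 1 \<^bold>\<longleftrightarrow> (\<^bold>\<exists>(0 \<^bold>\<in> 3 \<^bold>\<and> 1 \<^bold>\<in> 0))))"

definition "Powerset_ax = (\<^bold>\<forall>\<^bold>\<exists>\<^bold>\<forall>(0 \<^bold>\<in> 1 \<^bold>\<longleftrightarrow> subset_fm 0 2))"

definition "Infinity_ax = (\<^bold>\<exists>(inductive_fm 0))"

text \<open>In \<open>p\<close>, index 0 is the element variable and all other indices are parameters:
  \<open>\<forall>a. \<exists>b. \<forall>x. x \<in> b \<longleftrightarrow> x \<in> a \<and> p(x)\<close>.\<close>

definition "Separation_ax p =
  (\<^bold>\<forall>\<^bold>\<exists>\<^bold>\<forall>(0 \<^bold>\<in> 1 \<^bold>\<longleftrightarrow> 0 \<^bold>\<in> 2 \<^bold>\<and> ren (case_nat 0 (\<lambda>n. n+3)) p))"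

text \<open>In \<open>p\<close>, index 0 is the argument, index 1 the value and all other indices are parameters:
  \<open>(\<forall>x y z. p(x,y) \<and> p(x,z) \<longrightarrow> y = z) \<longrightarrow> (\<forall>a. \<exists>b. \<forall>y. y \<in> b \<longleftrightarrow> (\<exists>x. x \<in> a \<and> p(x,y)))\<close>.\<close>

definition "Replacement_ax p =
  ((\<^bold>\<forall>\<^bold>\<forall>\<^bold>\<forall>(ren (case_nat 2 (case_nat 1 (\<lambda>n. n+3))) p \<^bold>\<and>
           ren (case_nat 2 (case_nat 0 (\<lambda>n. n+3))) p \<^bold>\<longrightarrow> 1 \<^bold>= 0)) \<^bold>\<longrightarrow>
   (\<^bold>\<forall>\<^bold>\<exists>\<^bold>\<forall>(0 \<^bold>\<in> 1 \<^bold>\<longleftrightarrow> (\<^bold>\<exists>(0 \<^bold>\<in> 3 \<^bold>\<and> ren (case_nat 0 (case_nat 1 (\<lambda>n. n+4))) p)))))"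

text \<open>Every set of nonempty sets has a choice function.\<close>

definition "Choice_ax = (\<^bold>\<forall>((\<^bold>\<forall>(0 \<^bold>\<in> 1 \<^bold>\<longrightarrow> \<^bold>\<not>(empty_fm 0))) \<^bold>\<longrightarrow>
  (\<^bold>\<exists>(fun_fm 0 1 \<^bold>\<and> (\<^bold>\<forall>\<^bold>\<forall>(app_fm 2 1 0 \<^bold>\<longrightarrow> 0 \<^bold>\<in> 1))))))"

definition ZF :: "fm set" where
  "ZF = {Extensionality_ax, Foundation_ax, Pairing_ax, Union_ax, Powerset_ax, Infinity_ax}
        \<union> range Separation_ax \<union> range Replacement_ax"

definition ZFC :: "fm set" where
  "ZFC = insert Choice_ax ZF"

definition V_eq_HOD :: fm where
  "V_eq_HOD = (\<^bold>\<forall>(HOD_fm 0))"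

lemma sat_axioms:
  "sat E Extensionality_ax s \<longleftrightarrow> (\<forall>x y. (\<forall>z. E z x \<longleftrightarrow> E z y) \<longrightarrow> x = y)"
  "sat E Foundation_ax s \<longleftrightarrow> (\<forall>x. (\<exists>y. E y x) \<longrightarrow> (\<exists>y. E y x \<and> \<not> (\<exists>z. E z x \<and> E z y)))"
  "sat E Pairing_ax s \<longleftrightarrow> (\<forall>x y. \<exists>z. is_upair E x y z)"
  "sat E Union_ax s \<longleftrightarrow> (\<forall>x. \<exists>u. \<forall>z. E z u \<longleftrightarrow> (\<exists>y. E y x \<and> E z y))"
  "sat E Powerset_ax s \<longleftrightarrow> (\<forall>x. \<exists>u. \<forall>z. E z u \<longleftrightarrow> is_subset E z x)"
  "sat E Infinity_ax s \<longleftrightarrow> (\<exists>I. is_inductive E I)"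
  "sat E Choice_ax s \<longleftrightarrow> (\<forall>a. (\<forall>x. E x a \<longrightarrow> \<not> is_empty E x) \<longrightarrow>
    (\<exists>f. is_fun E f a \<and> (\<forall>x y. is_app E f x y \<longrightarrow> E y x)))"
  "sat E V_eq_HOD s \<longleftrightarrow> (\<forall>x. is_HOD E x)"
  by (simp_all add: Extensionality_ax_def Foundation_ax_def Pairing_ax_def Union_ax_def Powerset_ax_def
      Infinity_ax_def Choice_ax_def V_eq_HOD_def)

lemma sat_Separation:
  "sat E (Separation_ax p) s \<longleftrightarrow> (\<forall>a. \<exists>b. \<forall>x. E x b \<longleftrightarrow> E x a \<and> sat E p (case_nat x s))"
proof -
  have "(\<lambda>n. case_nat x (case_nat b (case_nat a s)) (case n of 0 \<Rightarrow> 0 | Suc n \<Rightarrow> n + 3))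
    = case_nat x s" for x b a
    by (auto simp: eval_nat_numeral split: nat.split)
  then show ?thesis by (simp add: Separation_ax_def)
qed

lemma sat_Replacement:
  "sat E (Replacement_ax p) s \<longleftrightarrow>
    (\<forall>x y z. sat E p (case_nat x (case_nat y s)) \<and> sat E p (case_nat x (case_nat z s)) \<longrightarrow> y = z) \<longrightarrow>
    (\<forall>a. \<exists>b. \<forall>y. E y b \<longleftrightarrow> (\<exists>x. E x a \<and> sat E p (case_nat x (case_nat y s))))"
proof -
  have 1: "(\<lambda>n. case_nat z (case_nat y (case_nat x s)) (case_nat 2 (case_nat 1 (\<lambda>n. n+3)) n))
      = case_nat x (case_nat y s)" for x y z
    by (auto simp: eval_nat_numeral split: nat.split)
  have 2: "(\<lambda>n. case_nat z (case_nat y (case_nat x s)) (case_nat 2 (case_nat 0 (\<lambda>n. n+3)) n))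
      = case_nat x (case_nat z s)" for x y z
    by (auto simp: eval_nat_numeral split: nat.split)
  have 3: "(\<lambda>n. case_nat x (case_nat y (case_nat b (case_nat a s)))
        (case_nat 0 (case_nat 1 (\<lambda>n. n+4)) n)) = case_nat x (case_nat y s)" for x y a b
    by (auto simp: eval_nat_numeral split: nat.split)
  show ?thesis
    unfolding Replacement_ax_def by (simp only: sat_connectives sat.simps sat_ren 1 2 3) simp
qed

end

theory Submission
  imports Defs
begin

text \<open>Call two elements of the model indistinguishable if no pair \<open>(\<theta>, c)\<close>, with \<open>\<theta>\<close> an ordinal and \<open>c\<close>
  a (possibly nonstandard) formula code, has \<open>V\<^sub>\<theta>\<close> satisfy \<open>c\<close> of exactly one of them. By reflection,
  indistinguishable elements satisfy the same parameter-free formulas of the model. A finite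
  parameter-free definable class of pairwise distinguishable elements consists of definable elements:
  split it by the least \<open>\<theta>\<close> and a canonically chosen \<open>c\<close> which distinguish two of its members, and
  repeat with the smaller pieces.

  In an algebraic model, indistinguishable elements are equal. Otherwise take an \<open>\<epsilon>\<close>-minimal \<open>x\<close> which is
  indistinguishable from some \<open>y \<noteq> x\<close>. The members of \<open>x\<close>, and therefore also those of \<open>y\<close>, are
  distinguishable from everything else; being algebraic, they are definable by the splitting argument.
  But then membership of each of them is a parameter-free property, which \<open>x\<close> and \<open>y\<close> share, so \<open>x = y\<close>.
  The splitting argument now makes every element definable. Reflection turns a definition in the model
  into one in some \<open>V\<^sub>\<theta>\<close>, which yields \<open>V = HOD\<close>; choosing the element with the least \<open>\<theta>\<close> and the canonical
  \<open>c\<close> yields choice functions.\<close>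

text \<open>Truth in the whole structure is not definable in it (Tarski), so the relation of
  satisfying the same formulas could be used neither to split a definable class nor, through
  Foundation, to find an \<epsilon>-minimal counterexample. Truth in the levels \<open>V th\<close>
  is definable; quantifying over all levels gives the definable relation \<open>indist\<close>, and
  reflection makes it at least as fine as the undefinable one. Nonstandard codes cannot be told
  apart from genuine ones inside the structure, but they do no harm: a selected \<open>c\<close>
  serves only as an element that is definable without parameters and is never decoded into a
  formula. To be definable it must be selected uniformly from a nonempty set of codes, at a stage
  where neither choice nor a wellordering of the universe is available; codes, however, are built
  from \<omega> by pairing, which supports a recursive selection. The splitting ends because the
  class is finite in the metatheory.\<close>

named_theorems dfn

locale zf =
  fixes E :: "'a \<Rightarrow> 'a \<Rightarrow> bool"  (infix "\<epsilon>" 50)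
  assumes zf: "models E ZF"
begin

section \<open>Definability with parameters\<close>

text \<open>\<open>dpred C P\<close>: the predicate \<open>P\<close> on assignments is definable with parameters from \<open>C\<close>.
  Only \<open>C = UNIV\<close> (what Separation and Replacement accept) and \<open>C = {}\<close> (what definability of an
  element requires) matter. The rules \<open>dfn\<close> prove such goals syntactically; descending under a binder
  prepends the bound variable to the assignment.\<close>

definition tms :: "'a set \<Rightarrow> ((nat \<Rightarrow> 'a) \<Rightarrow> 'a) set"
  where "tms C = range (\<lambda>n s. s n) \<union> (\<lambda>a s. a) ` C"

definition dpred :: "'a set \<Rightarrow> ((nat \<Rightarrow> 'a) \<Rightarrow> bool) \<Rightarrow> bool"
  where "dpred C P \<longleftrightarrow> (\<exists>p t. (\<forall>n. t n \<in> tms C) \<and> (\<forall>s. P s \<longleftrightarrow> sat E p (\<lambda>n. t n s)))"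

definition dterm :: "'a set \<Rightarrow> ((nat \<Rightarrow> 'a) \<Rightarrow> 'a) \<Rightarrow> bool"
  where "dterm C t \<longleftrightarrow> dpred C (\<lambda>s. s 0 = t (\<lambda>n. s (Suc n)))"

lemma dpred_sat: "dpred C (\<lambda>s. sat E p (\<lambda>n. s (f n)))"
proof -
  have "\<forall>n. (\<lambda>s::nat \<Rightarrow> 'a. s (f n)) \<in> tms C" by (auto simp: tms_def)
  then show ?thesis unfolding dpred_def by (intro exI[of _ p] exI[of _ "\<lambda>n s. s (f n)"]) simp
qed

lemma dpred_eq_vars: "dpred C (\<lambda>s. s m = s n)"
  using dpred_sat[of C "0 \<^bold>= 1" "case_nat m (\<lambda>_. n)"] by simp

lemma dpred_mem_vars: "dpred C (\<lambda>s. s m \<epsilon> s n)"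
  using dpred_sat[of C "0 \<^bold>\<in> 1" "case_nat m (\<lambda>_. n)"] by simp

lemma dpred_nand:
  assumes "dpred C P" "dpred C Q"
  shows "dpred C (\<lambda>s. \<not> (P s \<and> Q s))"
proof -
  obtain p t where p: "\<forall>n. t n \<in> tms C" "\<And>s. P s \<longleftrightarrow> sat E p (\<lambda>n. t n s)" using assms(1) by (auto simp: dpred_def)
  obtain q u where q: "\<forall>n. u n \<in> tms C" "\<And>s. Q s \<longleftrightarrow> sat E q (\<lambda>n. u n s)" using assms(2) by (auto simp: dpred_def)
  \<comment> \<open>Even indices serve \<open>p\<close> and odd ones \<open>q\<close>, so that the
    two lists of terms do not clash.\<close>
  let ?t = "\<lambda>n. if even n then t (n div 2) else u (n div 2)"
  show ?thesis unfolding dpred_def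
  proof (intro exI[of _ "Nand (ren (\<lambda>n. 2*n) p) (ren (\<lambda>n. 2*n+1) q)"] exI[of _ ?t] conjI allI)
    show "?t n \<in> tms C" for n using p q by auto
  qed (simp add: p q)
qed

lemma dpred_not [dfn]:
  assumes "dpred C P"
  shows "dpred C (\<lambda>s. \<not> P s)"
  using dpred_nand[OF assms assms] by simp

lemma dpred_conj [dfn]:
  assumes "dpred C P" "dpred C Q"
  shows "dpred C (\<lambda>s. P s \<and> Q s)"
  using dpred_not[OF dpred_nand[OF assms]] by simp

lemma dpred_disj [dfn]:
  assumes "dpred C P" "dpred C Q"
  shows "dpred C (\<lambda>s. P s \<or> Q s)"
  using dpred_nand[OF dpred_not[OF assms(1)] dpred_not[OF assms(2)]] by simp

lemma dpred_imp [dfn]: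
  assumes "dpred C P" "dpred C Q"
  shows "dpred C (\<lambda>s. P s \<longrightarrow> Q s)"
  using dpred_disj[OF dpred_not[OF assms(1)] assms(2)] by (simp only: imp_conv_disj)

lemma dpred_iff [dfn]:
  assumes "dpred C P" "dpred C Q"
  shows "dpred C (\<lambda>s. P s \<longleftrightarrow> Q s)"
  using dpred_conj[OF dpred_imp[OF assms] dpred_imp[OF assms(2,1)]] by (simp only: iff_conv_conj_imp)

text \<open>Several indices of the formula, or none, may stand for the variable to be bound; the
  others stand for shifted variables or constants. A renaming sends precisely the former to index 0
  before \<open>Forall\<close> is applied.\<close>

lemma dpred_all [dfn]:
  assumes "dpred C (\<lambda>s. Q (s 0) (\<lambda>n. s (Suc n)))"
  shows "dpred C (\<lambda>s. \<forall>x. Q x s)"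
proof -
  obtain p t where p: "\<forall>n. t n \<in> tms C" "\<And>s. Q (s 0) (\<lambda>n. s (Suc n)) \<longleftrightarrow> sat E p (\<lambda>n. t n s)"
    using assms by (auto simp: dpred_def)
  have "\<exists>u. u \<in> tms C \<and> (t n \<noteq> (\<lambda>s. s 0) \<longrightarrow> (\<forall>x s. t n (case_nat x s) = u s))" for n
  proof -
    consider m where "t n = (\<lambda>s. s m)" | a where "a \<in> C" "t n = (\<lambda>s. a)" using p(1)[rule_format, of n] by (auto simp: tms_def)
    then show ?thesis
    proof cases
      case 1
      then show ?thesis
        by (cases m) (auto simp: tms_def intro!: exI[of _ "\<lambda>s. s (m - 1)"])
    next
      case 2
      then show ?thesis by (intro exI[of _ "t n"]) (auto simp: tms_def)
    qed
  qed
  then obtain u where "\<forall>n. u n \<in> tms C \<and> (t n \<noteq> (\<lambda>s. s 0) \<longrightarrow> (\<forall>x s. t n (case_nat x s) = u n s))"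
    using choice[of "\<lambda>n u. u \<in> tms C \<and> (t n \<noteq> (\<lambda>s. s 0) \<longrightarrow> (\<forall>x s. t n (case_nat x s) = u s))"] by blast
  then have u: "\<And>n. u n \<in> tms C" "\<And>n x s. t n \<noteq> (\<lambda>s. s 0) \<Longrightarrow> t n (case_nat x s) = u n s"
    by auto
  define f where "f n = (if t n = (\<lambda>s. s 0) then 0 else Suc n)" for n
  have *: "(\<lambda>n. case_nat x (\<lambda>n. u n s) (f n)) = (\<lambda>n. t n (case_nat x s))" for x s
    using u(2) by (auto simp: f_def)
  have "Q x s \<longleftrightarrow> sat E (ren f p) (case_nat x (\<lambda>n. u n s))" for x s
    using p(2)[of "case_nat x s"] by (simp add: *)
  then show ?thesis unfolding dpred_def
    by (intro exI[of _ "\<^bold>\<forall>(ren f p)"] exI[of _ u]) (simp add: u(1))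
qed

lemma dpred_ex [dfn]:
  assumes "dpred C (\<lambda>s. Q (s 0) (\<lambda>n. s (Suc n)))"
  shows "dpred C (\<lambda>s. \<exists>x. Q x s)"
  using dpred_not[OF dpred_all[OF dpred_not[OF assms]]] by simp

lemma dpred_True [dfn]: "dpred C (\<lambda>s. True)" and dpred_False [dfn]: "dpred C (\<lambda>s. False)"
  using dpred_eq_vars[of C 0 0] dpred_not[OF dpred_eq_vars[of C 0 0]] by simp_all

lemma dpred_ren:
  assumes "dpred C P"
  shows "dpred C (\<lambda>s. P (\<lambda>n. s (f n)))"
proof -
  obtain p t where p: "\<forall>n. t n \<in> tms C" "\<And>s. P s \<longleftrightarrow> sat E p (\<lambda>n. t n s)" using assms by (auto simp: dpred_def)
  have "\<forall>n. (\<lambda>s. t n (\<lambda>n. s (f n))) \<in> tms C"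
  proof
    fix n show "(\<lambda>s. t n (\<lambda>n. s (f n))) \<in> tms C" using p(1)[rule_format, of n] by (auto simp: tms_def)
  qed
  with p(2) show ?thesis unfolding dpred_def
    by (intro exI[of _ p] exI[of _ "\<lambda>n s. t n (\<lambda>n. s (f n))"]) auto
qed

lemma dterm_ren: "dterm C t \<Longrightarrow> dterm C (\<lambda>s. t (\<lambda>n. s (f n)))"
  unfolding dterm_def using dpred_ren[of C "\<lambda>s. s 0 = t (\<lambda>n. s (Suc n))" "case_nat 0 (\<lambda>n. Suc (f n))"] by simp

lemma dterm_at: "dterm C t \<Longrightarrow> dpred C (\<lambda>s. s k = t (\<lambda>n. s (f n)))"
  unfolding dterm_def using dpred_ren[of C "\<lambda>s. s 0 = t (\<lambda>n. s (Suc n))" "case_nat k f"] by simp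

lemma dterm_var [dfn]: "dterm C (\<lambda>s. s n)"
  unfolding dterm_def by (rule dpred_eq_vars)

lemma dterm_const [dfn]: "dterm UNIV (\<lambda>s. a)"
proof -
  have "\<forall>n. (case_nat (\<lambda>s. s 0) (\<lambda>n s. a) n) \<in> tms UNIV" by (auto simp: tms_def split: nat.split)
  then show ?thesis unfolding dterm_def dpred_def
    by (intro exI[of _ "0 \<^bold>= 1"] exI[of _ "case_nat (\<lambda>s. s 0) (\<lambda>n s. a)"]) simp
qed

text \<open>Substitution goes through a bound variable \<open>x = t s\<close>, so a term needs only
  a definable graph and no syntactic form.\<close>

lemma dpred_sub1:
  assumes "dpred C (\<lambda>s. R (s 0))" "dterm C t"
  shows "dpred C (\<lambda>s. R (t s))"
proof -
  have "dpred C (\<lambda>s. \<exists>x. x = t s \<and> R x)"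
    using dterm_at[OF assms(2), of 0 Suc] assms(1) by (intro dpred_ex dpred_conj)
  then show ?thesis by simp
qed

lemma dpred_sub2:
  assumes R: "dpred C (\<lambda>s. R (s 0) (s 1))" and t: "dterm C t" "dterm C u"
  shows "dpred C (\<lambda>s. R (t s) (u s))"
proof -
  have "dpred C (\<lambda>s. R (s (Suc 0)) (s 0))"
    using dpred_ren[OF R, of "case_nat 1 (\<lambda>_. 0)"] by simp
  then have "dpred C (\<lambda>s. \<exists>x y. x = t s \<and> y = u s \<and> R x y)"
    using dterm_at[OF t(1), of "Suc 0" "\<lambda>n. Suc (Suc n)"] dterm_at[OF t(2), of 0 "\<lambda>n. Suc (Suc n)"]
    by (intro dpred_ex dpred_conj)
  then show ?thesis by simp
qed

lemma dpred_sub3: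
  assumes R: "dpred C (\<lambda>s. R (s 0) (s 1) (s 2))" and t: "dterm C t" "dterm C u" "dterm C v"
  shows "dpred C (\<lambda>s. R (t s) (u s) (v s))"
proof -
  have "dpred C (\<lambda>s. R (s (Suc (Suc 0))) (s (Suc 0)) (s 0))"
    using dpred_ren[OF R, of "case_nat 2 (case_nat 1 (\<lambda>_. 0))"] by (simp add: eval_nat_numeral)
  then have "dpred C (\<lambda>s. \<exists>x y z. x = t s \<and> y = u s \<and> z = v s \<and> R x y z)"
    using dterm_at[OF t(1), of "Suc (Suc 0)" "\<lambda>n. Suc (Suc (Suc n))"]
      dterm_at[OF t(2), of "Suc 0" "\<lambda>n. Suc (Suc (Suc n))"] dterm_at[OF t(3), of 0 "\<lambda>n. Suc (Suc (Suc n))"]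
    by (intro dpred_ex dpred_conj)
  then show ?thesis by simp
qed

lemma dpred_sub4:
  assumes R: "dpred C (\<lambda>s. R (s 0) (s 1) (s 2) (s 3))" and t: "dterm C t" "dterm C u" "dterm C v" "dterm C w"
  shows "dpred C (\<lambda>s. R (t s) (u s) (v s) (w s))"
proof -
  have "dpred C (\<lambda>s. R (s (Suc (Suc (Suc 0)))) (s (Suc (Suc 0))) (s (Suc 0)) (s 0))"
    using dpred_ren[OF R, of "case_nat 3 (case_nat 2 (case_nat 1 (\<lambda>_. 0)))"] by (simp add: eval_nat_numeral)
  then have "dpred C (\<lambda>s. \<exists>x y z k. x = t s \<and> y = u s \<and> z = v s \<and> k = w s \<and> R x y z k)"
    using dterm_at[OF t(1), of "Suc (Suc (Suc 0))" "\<lambda>n. Suc (Suc (Suc (Suc n)))"]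
      dterm_at[OF t(2), of "Suc (Suc 0)" "\<lambda>n. Suc (Suc (Suc (Suc n)))"]
      dterm_at[OF t(3), of "Suc 0" "\<lambda>n. Suc (Suc (Suc (Suc n)))"]
      dterm_at[OF t(4), of 0 "\<lambda>n. Suc (Suc (Suc (Suc n)))"]
    by (intro dpred_ex dpred_conj)
  then show ?thesis by simp
qed

lemma dpred_eq [dfn]: "dterm C t \<Longrightarrow> dterm C u \<Longrightarrow> dpred C (\<lambda>s. t s = u s)"
  by (rule dpred_sub2) (rule dpred_eq_vars)

lemma dpred_mem [dfn]: "dterm C t \<Longrightarrow> dterm C u \<Longrightarrow> dpred C (\<lambda>s. t s \<epsilon> u s)"
  by (rule dpred_sub2) (rule dpred_mem_vars)

lemma dterm_sub1:
  assumes f: "dterm C (\<lambda>s. f (s 0))" and t: "dterm C t"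
  shows "dterm C (\<lambda>s. f (t s))"
  unfolding dterm_def
  by (rule dpred_sub2[of C "\<lambda>x y. x = f y", OF _ dterm_var dterm_ren[OF t]]) (use f in \<open>simp add: dterm_def\<close>)

lemma dterm_sub2:
  assumes f: "dterm C (\<lambda>s. f (s 0) (s 1))" and t: "dterm C t" "dterm C u"
  shows "dterm C (\<lambda>s. f (t s) (u s))"
  unfolding dterm_def
  by (rule dpred_sub3[of C "\<lambda>x y z. x = f y z", OF _ dterm_var dterm_ren[OF t(1)] dterm_ren[OF t(2)]])
    (use f in \<open>simp add: dterm_def eval_nat_numeral\<close>)

section \<open>Definability of the basic set-theoretic notions\<close>

lemma dpred_is_subset [dfn]: "dterm C t \<Longrightarrow> dterm C u \<Longrightarrow> dpred C (\<lambda>s. is_subset E (t s) (u s))"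
  by (rule dpred_sub2) (use dpred_sat[of C "subset_fm 0 1" "\<lambda>n. n"] in simp_all)

lemma dpred_is_empty [dfn]: "dterm C t \<Longrightarrow> dpred C (\<lambda>s. is_empty E (t s))"
  by (rule dpred_sub1) (use dpred_sat[of C "empty_fm 0" "\<lambda>n. n"] in simp_all)

lemma dpred_is_transitive [dfn]: "dterm C t \<Longrightarrow> dpred C (\<lambda>s. is_transitive E (t s))"
  by (rule dpred_sub1) (use dpred_sat[of C "transitive_fm 0" "\<lambda>n. n"] in simp_all)

lemma dpred_is_ordinal [dfn]: "dterm C t \<Longrightarrow> dpred C (\<lambda>s. is_ordinal E (t s))"
  by (rule dpred_sub1) (use dpred_sat[of C "ordinal_fm 0" "\<lambda>n. n"] in simp_all)

lemma dpred_is_inductive [dfn]: "dterm C t \<Longrightarrow> dpred C (\<lambda>s. is_inductive E (t s))"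
  by (rule dpred_sub1) (use dpred_sat[of C "inductive_fm 0" "\<lambda>n. n"] in simp_all)

lemma dpred_is_fun_into [dfn]: "dterm C t \<Longrightarrow> dterm C u \<Longrightarrow> dterm C v \<Longrightarrow> dpred C (\<lambda>s. is_fun_into E (t s) (u s) (v s))"
  by (rule dpred_sub3) (use dpred_sat[of C "fun_into_fm 0 1 2" "\<lambda>n. n"] in simp_all)

lemma dpred_is_formula_closed [dfn]: "dterm C t \<Longrightarrow> dterm C u \<Longrightarrow> dpred C (\<lambda>s. is_formula_closed E (t s) (u s))"
  by (rule dpred_sub2) (use dpred_sat[of C "formula_closed_fm 0 1" "\<lambda>n. n"] in simp_all)

lemma dpred_is_variant [dfn]: "dterm C t \<Longrightarrow> dterm C u \<Longrightarrow> dterm C v \<Longrightarrow> dpred C (\<lambda>s. is_variant E (t s) (u s) (v s))"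
  by (rule dpred_sub3) (use dpred_sat[of C "variant_fm 0 1 2" "\<lambda>n. n"] in simp_all)

lemma dpred_is_satisfaction [dfn]:
  "dterm C t \<Longrightarrow> dterm C u \<Longrightarrow> dterm C v \<Longrightarrow> dterm C w \<Longrightarrow> dpred C (\<lambda>s. is_satisfaction E (t s) (u s) (v s) (w s))"
  by (rule dpred_sub4) (use dpred_sat[of C "satisfaction_fm 0 1 2 3" "\<lambda>n. n"] in simp_all)

text \<open>Without parameters every member of \<open>tms\<close> is a variable, and a renaming
  absorbs the list of terms.\<close>

lemma dpred_empty_iff: "dpred {} P \<longleftrightarrow> (\<exists>p. \<forall>s. P s \<longleftrightarrow> sat E p s)"
proof
  assume "dpred {} P"
  then obtain p t where p: "\<forall>n. t n \<in> tms {}" "\<And>s. P s \<longleftrightarrow> sat E p (\<lambda>n. t n s)" by (auto simp: dpred_def)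
  from p(1) have "\<forall>n. \<exists>m. t n = (\<lambda>s. s m)" by (auto simp: tms_def)
  then obtain f where "\<And>n. t n = (\<lambda>s. s (f n))" by metis
  then have "P s \<longleftrightarrow> sat E (ren f p) s" for s using p(2) by simp
  then show "\<exists>p. \<forall>s. P s \<longleftrightarrow> sat E p s" by blast
next
  assume "\<exists>p. \<forall>s. P s \<longleftrightarrow> sat E p s"
  then obtain p where "P = (\<lambda>s. sat E p s)" by auto
  then show "dpred {} P" using dpred_sat[of "{}" p "\<lambda>n. n"] by simp
qed

lemma fv_ren: "fv (ren f p) \<subseteq> f ` fv p"
proof (induction p arbitrary: f)
  case (Forall p)
  show ?case
  proof
    fix n assume "n \<in> fv (ren f (\<^bold>\<forall>p))"
    then have "Suc n \<in> fv (ren (case_nat 0 (\<lambda>n. Suc (f n))) p)" by simp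
    with Forall obtain m where "m \<in> fv p" "Suc n = (case m of 0 \<Rightarrow> 0 | Suc n \<Rightarrow> Suc (f n))" by blast
    then show "n \<in> f ` fv (\<^bold>\<forall>p)" by (cases m) auto
  qed
next
  case (Nand p q)
  then show ?case by (simp add: image_Un) blast
qed auto

text \<open>Collapsing all variables to index 0 enforces the condition on \<open>fv\<close> and
  preserves the meaning, as \<open>P\<close> looks at \<open>s 0\<close> only.\<close>

lemma dpred_empty_unary:
  assumes "dpred {} (\<lambda>s. P (s 0))"
  obtains p where "fv p \<subseteq> {0}" "\<And>s. sat E p s \<longleftrightarrow> P (s 0)"
proof -
  obtain p where p: "\<And>s. P (s 0) \<longleftrightarrow> sat E p s" using assms by (auto simp: dpred_empty_iff)
  have "fv (ren (\<lambda>_. 0) p) \<subseteq> {0}" using fv_ren[of "\<lambda>_. 0" p] by auto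
  moreover have "sat E (ren (\<lambda>_. 0) p) s \<longleftrightarrow> P (s 0)" for s by (simp add: p[symmetric])
  ultimately show thesis by (rule that)
qed

section \<open>Class comprehension\<close>

lemma set_ext: "(\<And>z. z \<epsilon> x \<longleftrightarrow> z \<epsilon> y) \<Longrightarrow> x = y"
  using zf sat_axioms(1)[of E] by (auto simp: models_def ZF_def)

text \<open>Brings a definable relation into the shape that the axiom schemes take: argument slots
  followed by one assignment that holds the parameters.\<close>

lemma dpred_params:
  assumes "dpred UNIV (\<lambda>s. P (s 0) (s 1))"
  obtains p s where "\<And>x y. P x y \<longleftrightarrow> sat E p (case_nat x (case_nat y s))"
proof -
  obtain p t where p: "\<forall>n. t n \<in> tms UNIV" "\<And>s. P (s 0) (s 1) \<longleftrightarrow> sat E p (\<lambda>n. t n s)"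
    using assms by (auto simp: dpred_def)
  \<comment> \<open>All variables past index 0 may be evaluated at \<open>y\<close>, since
    \<open>P\<close> depends on \<open>s 0\<close> and \<open>s 1\<close> only. A constant at index
    \<open>n\<close> gets its own slot \<open>n + 2\<close>, where \<open>e\<close> stores its
    value.\<close>
  define f where "f n = (if t n = (\<lambda>s. s 0) then 0 else if \<exists>m. t n = (\<lambda>s. s (Suc m)) then 1 else n + 2)" for n
  define e where "e n = t n undefined" for n
  have "(case_nat x (case_nat y e)) (f n) = t n (case_nat x (\<lambda>_. y))" for x y n
  proof -
    consider "t n = (\<lambda>s. s 0)" | m where "t n = (\<lambda>s. s (Suc m))" "t n \<noteq> (\<lambda>s. s 0)"
      | a where "t n = (\<lambda>s. a)" "t n \<noteq> (\<lambda>s. s 0)" "\<nexists>m. t n = (\<lambda>s. s (Suc m))"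
    proof -
      have "(\<exists>m. t n = (\<lambda>s. s m)) \<or> (\<exists>a. t n = (\<lambda>s. a))"
        using p(1)[rule_format, of n] by (auto simp: tms_def)
      then show ?thesis using that not0_implies_Suc by metis
    qed
    then show ?thesis
      by cases (auto simp: f_def e_def)
  qed
  then have "P x y \<longleftrightarrow> sat E (ren f p) (case_nat x (case_nat y e))" for x y
    using p(2)[of "case_nat x (\<lambda>_. y)"] by simp
  then show thesis by (rule that)
qed

lemma separation:
  assumes "dpred UNIV (\<lambda>s. P (s 0))"
  shows "\<exists>b. \<forall>x. x \<epsilon> b \<longleftrightarrow> x \<epsilon> a \<and> P x"
proof -
  obtain p s where p: "\<And>x y. P x \<longleftrightarrow> sat E p (case_nat x (case_nat y s))"
    using dpred_params[of "\<lambda>x y. P x"] assms by blast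
  \<comment> \<open>Slot 1 belongs to the second argument, on which \<open>P\<close> does not
    depend, so any value will do.\<close>
  have "sat E (Separation_ax p) (case_nat undefined s)" using zf by (auto simp: models_def ZF_def)
  then show ?thesis unfolding sat_Separation using p by simp
qed

lemma replacement:
  assumes "dterm UNIV (\<lambda>s. f (s 0))"
  shows "\<exists>b. \<forall>y. y \<epsilon> b \<longleftrightarrow> (\<exists>x. x \<epsilon> a \<and> y = f x)"
proof -
  have "dpred UNIV (\<lambda>s. s 1 = f (s 0))" using dterm_at[OF assms, of 1 "\<lambda>_. 0"] by simp
  then obtain p s where p: "\<And>x y. y = f x \<longleftrightarrow> sat E p (case_nat x (case_nat y s))"
    by (rule dpred_params[of "\<lambda>x y. y = f x"]) blast
  have "sat E (Replacement_ax p) s" using zf by (auto simp: models_def ZF_def)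
  then show ?thesis unfolding sat_Replacement by (simp add: p[symmetric])
qed

text \<open>\<open>class_set Q\<close> is the empty set if the class \<open>Q\<close> is proper. This makes \<open>dterm_class_set\<close> unconditional.\<close>

definition class_set :: "('a \<Rightarrow> bool) \<Rightarrow> 'a"
  where "class_set Q = (THE b. (\<forall>x. x \<epsilon> b \<longleftrightarrow> Q x) \<or> (\<nexists>b. \<forall>x. x \<epsilon> b \<longleftrightarrow> Q x) \<and> is_empty E b)"

lemma ex1_class_set: "\<exists>!b. (\<forall>x. x \<epsilon> b \<longleftrightarrow> Q x) \<or> (\<nexists>b. \<forall>x. x \<epsilon> b \<longleftrightarrow> Q x) \<and> is_empty E b"
proof -
  obtain e where e: "is_empty E e"
    using separation[OF dpred_False] by (auto simp: is_empty_def)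
  show ?thesis
  proof (cases "\<exists>b. \<forall>x. x \<epsilon> b \<longleftrightarrow> Q x")
    case True
    then obtain b where "\<forall>x. x \<epsilon> b \<longleftrightarrow> Q x" by blast
    then show ?thesis by (intro ex1I[of _ b]) (auto intro: set_ext)
  next
    case False
    then show ?thesis using e by (intro ex1I[of _ e]) (auto simp: is_empty_def intro: set_ext)
  qed
qed

lemma eq_class_set_iff: "b = class_set Q \<longleftrightarrow> (\<forall>x. x \<epsilon> b \<longleftrightarrow> Q x) \<or> (\<nexists>b. \<forall>x. x \<epsilon> b \<longleftrightarrow> Q x) \<and> is_empty E b"
  using theI'[OF ex1_class_set[of Q]] ex1_class_set[of Q] unfolding class_set_def by blast

lemma dterm_class_set [dfn]:
  assumes "dpred C (\<lambda>s. Q (s 0) (\<lambda>n. s (Suc n)))"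
  shows "dterm C (\<lambda>s. class_set (\<lambda>x. Q x s))"
proof -
  \<comment> \<open>In \<open>eq_class_set_iff\<close>, \<open>Q\<close> occurs under one quantifier
    and again under two, hence the two shifts.\<close>
  have "dpred C (\<lambda>s. Q (s 0) (\<lambda>n. s (Suc (Suc n))))"
    using dpred_ren[OF assms, of "case_nat 0 (\<lambda>n. Suc (Suc n))"] by simp
  moreover have "dpred C (\<lambda>s. Q (s 0) (\<lambda>n. s (Suc (Suc (Suc n)))))"
    using dpred_ren[OF assms, of "case_nat 0 (\<lambda>n. Suc (Suc (Suc n)))"] by simp
  ultimately show ?thesis unfolding dterm_def eq_class_set_iff
    by (intro dfn)
qed

lemma mem_class_set_iff: "\<forall>x. x \<epsilon> b \<longleftrightarrow> Q x \<Longrightarrow> x \<epsilon> class_set Q \<longleftrightarrow> Q x"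
  using eq_class_set_iff[of b Q] by auto

lemma mem_class_set:
  assumes "dpred UNIV (\<lambda>s. Q (s 0))" "\<And>x. Q x \<Longrightarrow> x \<epsilon> a"
  shows "x \<epsilon> class_set Q \<longleftrightarrow> Q x"
proof -
  obtain b where "\<forall>x. x \<epsilon> b \<longleftrightarrow> x \<epsilon> a \<and> Q x" using separation[OF assms(1), of a] by blast
  with assms(2) have "\<forall>x. x \<epsilon> b \<longleftrightarrow> Q x" by blast
  then show ?thesis by (rule mem_class_set_iff)
qed

section \<open>Set operations as total definable terms\<close>

definition "emp = class_set (\<lambda>_. False)"
definition "upair x y = class_set (\<lambda>z. z = x \<or> z = y)"
definition "opair x y = upair (upair x x) (upair x y)"
definition "sUnion x = class_set (\<lambda>z. \<exists>y. y \<epsilon> x \<and> z \<epsilon> y)"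
definition "pow x = class_set (\<lambda>z. is_subset E z x)"
definition "cup x y = sUnion (upair x y)"
definition "suc x = cup x (upair x x)"
definition "sep a P = class_set (\<lambda>x. x \<epsilon> a \<and> P x)"
definition "repl a f = class_set (\<lambda>y. \<exists>x. x \<epsilon> a \<and> y = f x)"
text \<open>A total definite description: the inner class has at most one element, so its union is
  that element, or \<open>emp\<close> if there is none.\<close>

definition "the1 P = sUnion (class_set (\<lambda>x. P x \<and> (\<forall>y. P y \<longrightarrow> y = x)))"

lemma dterm_emp [dfn]: "dterm C (\<lambda>s. emp)" unfolding emp_def by (intro dfn)
lemma dterm_upair [dfn]: "dterm C t \<Longrightarrow> dterm C u \<Longrightarrow> dterm C (\<lambda>s. upair (t s) (u s))"
  by (rule dterm_sub2) (unfold upair_def, intro dfn)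
lemma dterm_opair [dfn]: "dterm C t \<Longrightarrow> dterm C u \<Longrightarrow> dterm C (\<lambda>s. opair (t s) (u s))"
  by (rule dterm_sub2) (unfold opair_def, intro dfn)
lemma dterm_sUnion [dfn]: "dterm C t \<Longrightarrow> dterm C (\<lambda>s. sUnion (t s))"
  by (rule dterm_sub1) (unfold sUnion_def, intro dfn)
lemma dterm_pow [dfn]: "dterm C t \<Longrightarrow> dterm C (\<lambda>s. pow (t s))"
  by (rule dterm_sub1) (unfold pow_def, intro dfn)
lemma dterm_cup [dfn]: "dterm C t \<Longrightarrow> dterm C u \<Longrightarrow> dterm C (\<lambda>s. cup (t s) (u s))"
  by (rule dterm_sub2) (unfold cup_def, intro dfn)
lemma dterm_suc [dfn]: "dterm C t \<Longrightarrow> dterm C (\<lambda>s. suc (t s))"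
  by (rule dterm_sub1) (unfold suc_def, intro dfn)

lemma dterm_sep [dfn]:
  assumes t: "dterm C t" and P: "dpred C (\<lambda>s. P (s 0) (\<lambda>n. s (Suc n)))"
  shows "dterm C (\<lambda>s. sep (t s) (\<lambda>x. P x s))"
  unfolding sep_def by (intro dfn dterm_ren[OF t] P)

lemma dterm_repl [dfn]:
  assumes t: "dterm C t" and f: "dterm C (\<lambda>s. f (s 0) (\<lambda>n. s (Suc n)))"
  shows "dterm C (\<lambda>s. repl (t s) (\<lambda>x. f x s))"
proof -
  have "dterm C (\<lambda>s. f (s 0) (\<lambda>n. s (Suc (Suc n))))"
    using dterm_ren[OF f, of "case_nat 0 (\<lambda>n. Suc (Suc n))"] by simp
  then show ?thesis unfolding repl_def by (intro dfn dterm_ren[OF t])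
qed

lemma dterm_the1 [dfn]:
  assumes P: "dpred C (\<lambda>s. P (s 0) (\<lambda>n. s (Suc n)))"
  shows "dterm C (\<lambda>s. the1 (\<lambda>x. P x s))"
proof -
  have "dpred C (\<lambda>s. P (s 0) (\<lambda>n. s (Suc (Suc n))))"
    using dpred_ren[OF P, of "case_nat 0 (\<lambda>n. Suc (Suc n))"] by simp
  then show ?thesis unfolding the1_def by (intro dfn P)
qed

lemma mem_emp [simp]: "\<not> x \<epsilon> emp"
  unfolding emp_def by (subst mem_class_set) (intro dfn | simp)+

lemma pairing: "\<exists>b. \<forall>z. z \<epsilon> b \<longleftrightarrow> z = x \<or> z = y"
  and union: "\<exists>b. \<forall>z. z \<epsilon> b \<longleftrightarrow> (\<exists>y. y \<epsilon> x \<and> z \<epsilon> y)"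
  and powerset: "\<exists>b. \<forall>z. z \<epsilon> b \<longleftrightarrow> is_subset E z x"
  and infinity: "\<exists>I. is_inductive E I"
  using zf sat_axioms(3-6)[of E] by (auto simp: models_def ZF_def is_upair_def)

lemma mem_upair [simp]: "z \<epsilon> upair x y \<longleftrightarrow> z = x \<or> z = y"
  using pairing unfolding upair_def by (rule exE) (rule mem_class_set_iff)

lemma mem_sUnion [simp]: "z \<epsilon> sUnion x \<longleftrightarrow> (\<exists>y. y \<epsilon> x \<and> z \<epsilon> y)"
  using union unfolding sUnion_def by (rule exE) (rule mem_class_set_iff)

lemma mem_pow [simp]: "z \<epsilon> pow x \<longleftrightarrow> is_subset E z x"
  using powerset unfolding pow_def by (rule exE) (rule mem_class_set_iff)

lemma mem_cup [simp]: "z \<epsilon> cup x y \<longleftrightarrow> z \<epsilon> x \<or> z \<epsilon> y"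
  by (auto simp: cup_def)

lemma mem_suc [simp]: "z \<epsilon> suc x \<longleftrightarrow> z \<epsilon> x \<or> z = x"
  by (auto simp: suc_def)

lemma mem_sep:
  assumes "dpred UNIV (\<lambda>s. P (s 0))"
  shows "x \<epsilon> sep a P \<longleftrightarrow> x \<epsilon> a \<and> P x"
  unfolding sep_def by (rule mem_class_set[of _ a]) (intro dfn assms | simp)+

lemma mem_repl:
  assumes "dterm UNIV (\<lambda>s. f (s 0))"
  shows "y \<epsilon> repl a f \<longleftrightarrow> (\<exists>x. x \<epsilon> a \<and> y = f x)"
  using replacement[OF assms] unfolding repl_def by (rule exE) (rule mem_class_set_iff)

lemma the1_eq:
  assumes "P a" "\<And>y. P y \<Longrightarrow> y = a"
  shows "the1 P = a"
proof -
  have P: "P x \<and> (\<forall>y. P y \<longrightarrow> y = x) \<longleftrightarrow> x = a" for x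
    using assms by blast
  have "x \<epsilon> class_set (\<lambda>x. P x \<and> (\<forall>y. P y \<longrightarrow> y = x)) \<longleftrightarrow> x = a" for x
    unfolding P by (rule mem_class_set_iff[of "upair a a"]) simp
  then show ?thesis unfolding the1_def by (intro set_ext) simp
qed

lemma upair_eq_iff: "upair a b = upair c d \<longleftrightarrow> a = c \<and> b = d \<or> a = d \<and> b = c"
proof
  assume "upair a b = upair c d"
  then have "z = a \<or> z = b \<longleftrightarrow> z = c \<or> z = d" for z using mem_upair by metis
  from this[of a] this[of b] this[of c] this[of d] show "a = c \<and> b = d \<or> a = d \<and> b = c" by auto
qed (auto intro: set_ext)

lemma opair_inject [simp]: "opair a b = opair c d \<longleftrightarrow> a = c \<and> b = d"
  unfolding opair_def upair_eq_iff by auto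

lemma is_upair_iff [simp]: "is_upair E a b c \<longleftrightarrow> c = upair a b"
  unfolding is_upair_def by (auto intro: set_ext)

lemma is_pair_iff [simp]: "is_pair E a b c \<longleftrightarrow> c = opair a b"
  unfolding is_pair_def opair_def by simp

lemma is_app_iff [simp]: "is_app E r x y \<longleftrightarrow> opair x y \<epsilon> r"
  unfolding is_app_def by simp

lemma is_empty_iff [simp]: "is_empty E x \<longleftrightarrow> x = emp"
  unfolding is_empty_def by (auto intro: set_ext)

lemma is_succ_iff [simp]: "is_succ E x y \<longleftrightarrow> y = suc x"
  unfolding is_succ_def by (auto intro: set_ext)

lemma upair_subset_pow: "x \<epsilon> a \<Longrightarrow> y \<epsilon> a \<Longrightarrow> upair x y \<epsilon> pow a"
  by (auto simp: is_subset_def)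

lemma opair_in_pow: "x \<epsilon> a \<Longrightarrow> y \<epsilon> b \<Longrightarrow> opair x y \<epsilon> pow (pow (cup a b))"
  unfolding opair_def by (intro upair_subset_pow) simp_all

section \<open>Ordinals\<close>

lemma foundation: "y \<epsilon> x \<Longrightarrow> \<exists>y. y \<epsilon> x \<and> (\<forall>z. z \<epsilon> y \<longrightarrow> \<not> z \<epsilon> x)"
  using zf sat_axioms(2)[of E] by (auto simp: models_def ZF_def) blast

lemma transitiveD: "is_transitive E x \<Longrightarrow> y \<epsilon> x \<Longrightarrow> z \<epsilon> y \<Longrightarrow> z \<epsilon> x"
  by (auto simp: is_transitive_def is_subset_def)

text \<open>Foundation speaks of sets, so the counterexamples must form one; hence the bound
  \<open>d\<close>. The unbounded \<open>mem_induct\<close> has to wait until every set is known to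
  lie in a transitive one.\<close>

lemma transitive_induct:
  assumes "dpred UNIV (\<lambda>s. P (s 0))" "is_transitive E d" "x \<epsilon> d"
    and step: "\<And>x. x \<epsilon> d \<Longrightarrow> (\<forall>y. y \<epsilon> x \<longrightarrow> P y) \<Longrightarrow> P x"
  shows "P x"
proof (rule ccontr)
  assume "\<not> P x"
  then have "x \<epsilon> sep d (\<lambda>x. \<not> P x)" using assms by (subst mem_sep) (intro dfn | simp)+
  from foundation[OF this] obtain y where y: "y \<epsilon> sep d (\<lambda>x. \<not> P x)" "\<forall>z. z \<epsilon> y \<longrightarrow> \<not> z \<epsilon> sep d (\<lambda>x. \<not> P x)"
    by blast
  have m: "z \<epsilon> sep d (\<lambda>x. \<not> P x) \<longleftrightarrow> z \<epsilon> d \<and> \<not> P z" for z using assms by (subst mem_sep) (intro dfn | simp)+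
  from y have "P y" unfolding m by (intro step) (use assms(2) transitiveD in blast)+
  with y(1) show False by (simp add: m)
qed

lemma mem_irrefl [simp]: "\<not> x \<epsilon> x"
  using foundation[of x "upair x x"] by auto

abbreviation "ord x \<equiv> is_ordinal E x"

lemma ord_transitive: "ord x \<Longrightarrow> is_transitive E x"
  by (simp add: is_ordinal_def)

lemma is_transitive_iff: "is_transitive E x \<longleftrightarrow> (\<forall>y z. y \<epsilon> x \<longrightarrow> z \<epsilon> y \<longrightarrow> z \<epsilon> x)"
  unfolding is_transitive_def is_subset_def by blast

lemma ord_mem: "ord x \<Longrightarrow> y \<epsilon> x \<Longrightarrow> ord y"
  unfolding is_ordinal_def using transitiveD by blast

lemma ord_suc: "ord x \<Longrightarrow> ord (suc x)"
  unfolding is_ordinal_def is_transitive_iff mem_suc by blast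

lemma ord_sUnion: "(\<And>y. y \<epsilon> x \<Longrightarrow> ord y) \<Longrightarrow> ord (sUnion x)"
  unfolding is_ordinal_def is_transitive_iff mem_sUnion by blast

lemma ord_induct:
  assumes dpred: "dpred UNIV (\<lambda>s. P (s 0))" and x: "ord x"
    and step: "\<And>x. ord x \<Longrightarrow> (\<And>y. y \<epsilon> x \<Longrightarrow> P y) \<Longrightarrow> P x"
  shows "P x"
proof (rule transitive_induct[OF dpred, of "suc x"])
  show "is_transitive E (suc x)" using ord_transitive[OF ord_suc[OF x]] .
  show "P y" if "y \<epsilon> suc x" "\<forall>z. z \<epsilon> y \<longrightarrow> P z" for y
    using step[of y] ord_mem[OF ord_suc[OF x] that(1)] that(2) by blast
qed simp

text \<open>Double induction: if \<open>x\<close> and \<open>y\<close> were incomparable while each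
  member of either is comparable with the other ordinal, then \<open>x\<close> and \<open>y\<close>
  would have the same members.\<close>

lemma ord_linear: 
  assumes "ord x" "ord y"
  shows "x \<epsilon> y \<or> x = y \<or> y \<epsilon> x"
proof -
  have "\<forall>y. ord y \<longrightarrow> x \<epsilon> y \<or> x = y \<or> y \<epsilon> x"
  proof (rule ord_induct[OF _ assms(1)])
    fix x assume x: "ord x" and IH: "\<And>z. z \<epsilon> x \<Longrightarrow> \<forall>y. ord y \<longrightarrow> z \<epsilon> y \<or> z = y \<or> y \<epsilon> z"
    show "\<forall>y. ord y \<longrightarrow> x \<epsilon> y \<or> x = y \<or> y \<epsilon> x"
    proof (intro allI impI)
      fix y assume "ord y"
      then show "x \<epsilon> y \<or> x = y \<or> y \<epsilon> x"
      proof (rule ord_induct[rotated])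
        fix y assume y: "ord y" and IH2: "\<And>z. z \<epsilon> y \<Longrightarrow> x \<epsilon> z \<or> x = z \<or> z \<epsilon> x"
        show "x \<epsilon> y \<or> x = y \<or> y \<epsilon> x"
        proof (rule ccontr)
          assume n: "\<not> ?thesis"
          have "x = y"
          proof (rule set_ext)
            fix z show "z \<epsilon> x \<longleftrightarrow> z \<epsilon> y"
              using n IH IH2 y x transitiveD[OF ord_transitive] by metis
          qed
          with n show False by simp
        qed
      qed (intro dfn)
    qed
  qed (intro dfn)
  with assms show ?thesis by blast
qed

definition "least_ord P = the1 (\<lambda>x. ord x \<and> P x \<and> (\<forall>y. y \<epsilon> x \<longrightarrow> \<not> P y))"

lemma dterm_least_ord [dfn]:
  assumes P: "dpred C (\<lambda>s. P (s 0) (\<lambda>n. s (Suc n)))"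
  shows "dterm C (\<lambda>s. least_ord (\<lambda>x. P x s))"
proof -
  have "dpred C (\<lambda>s. P (s 0) (\<lambda>n. s (Suc (Suc n))))"
    using dpred_ren[OF P, of "case_nat 0 (\<lambda>n. Suc (Suc n))"] by simp
  then show ?thesis unfolding least_ord_def by (intro dfn P)
qed

lemma least_ord:
  assumes dpred: "dpred UNIV (\<lambda>s. P (s 0))" and x: "ord x" "P x"
  shows "ord (least_ord P)" "P (least_ord P)" "\<And>y. y \<epsilon> least_ord P \<Longrightarrow> \<not> P y"
proof -
  have "\<exists>x. ord x \<and> P x \<and> (\<forall>y. y \<epsilon> x \<longrightarrow> \<not> P y)"
  proof (rule ccontr)
    assume n: "\<not> ?thesis"
    have "\<not> P x"
      by (rule ord_induct[OF _ x(1)]) (use n in \<open>intro dfn dpred | blast\<close>)+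
    with x show False by blast
  qed
  then obtain a where a: "ord a \<and> P a \<and> (\<forall>y. y \<epsilon> a \<longrightarrow> \<not> P y)" by blast
  have "least_ord P = a" unfolding least_ord_def
    by (rule the1_eq) (use a ord_linear in blast)+
  with a show "ord (least_ord P)" "P (least_ord P)" "\<And>y. y \<epsilon> least_ord P \<Longrightarrow> \<not> P y" by auto
qed

lemma ord_subset: "ord x \<Longrightarrow> ord y \<Longrightarrow> is_subset E x y \<longleftrightarrow> x \<epsilon> y \<or> x = y"
  using ord_linear[of x y] transitiveD[OF ord_transitive, of y x] 
  unfolding is_subset_def by (meson mem_irrefl)

section \<open>Omega\<close>

definition "omega = class_set (\<lambda>x. \<forall>I. is_inductive E I \<longrightarrow> x \<epsilon> I)"

lemma dterm_omega [dfn]: "dterm C (\<lambda>s. omega)"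
  unfolding omega_def by (intro dfn)

lemma is_inductive_iff: "is_inductive E I \<longleftrightarrow> emp \<epsilon> I \<and> (\<forall>x. x \<epsilon> I \<longrightarrow> suc x \<epsilon> I)"
  unfolding is_inductive_def by auto

lemma mem_omega: "x \<epsilon> omega \<longleftrightarrow> (\<forall>I. is_inductive E I \<longrightarrow> x \<epsilon> I)"
proof -
  obtain I where "is_inductive E I" using infinity by blast
  then show ?thesis unfolding omega_def by (intro mem_class_set[of _ I]) (intro dfn | blast)+
qed

lemma emp_omega [simp]: "emp \<epsilon> omega" and suc_omega: "x \<epsilon> omega \<Longrightarrow> suc x \<epsilon> omega"
  by (auto simp: mem_omega is_inductive_iff)

lemma is_omega_iff [simp]: "is_omega E w \<longleftrightarrow> w = omega"
proof
  assume "is_omega E w"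
  then show "w = omega"
    by (intro set_ext) (auto simp: is_omega_def is_subset_def mem_omega)
qed (auto simp: is_omega_def is_subset_def mem_omega is_inductive_iff)

lemma omega_induct:
  assumes dpred: "dpred UNIV (\<lambda>s. P (s 0))" and x: "x \<epsilon> omega"
    and "P emp" "\<And>x. x \<epsilon> omega \<Longrightarrow> P x \<Longrightarrow> P (suc x)"
  shows "P x"
proof -
  have m: "x \<epsilon> sep omega P \<longleftrightarrow> x \<epsilon> omega \<and> P x" for x by (rule mem_sep[OF dpred])
  have "is_inductive E (sep omega P)" using assms(3,4) suc_omega by (auto simp: is_inductive_iff m)
  then show ?thesis using x m by (auto simp: mem_omega)
qed

lemma ord_omega: "ord omega"
proof -
  have 1: "is_subset E x omega" if "x \<epsilon> omega" for x
    by (rule omega_induct[OF _ that]) (intro dfn | auto simp: is_subset_def)+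
  have 2: "is_transitive E x" if "x \<epsilon> omega" for x
    by (rule omega_induct[OF _ that]) (intro dfn | auto simp: is_transitive_iff)+
  show ?thesis using 1 2 by (auto simp: is_ordinal_def is_transitive_def)
qed

primrec num :: "nat \<Rightarrow> 'a" where
  "num 0 = emp"
| "num (Suc k) = suc (num k)"

lemma is_num_iff [simp]: "is_num E k x \<longleftrightarrow> x = num k"
  by (induction k arbitrary: x) auto

lemma num_omega [simp]: "num k \<epsilon> omega"
  by (induction k) (auto intro: suc_omega)

lemma num_less: "j < k \<Longrightarrow> num j \<epsilon> num k"
  by (induction k) (auto simp: less_Suc_eq)

lemma num_inject [simp]: "num j = num k \<longleftrightarrow> j = k"
  by (metis linorder_neqE_nat mem_irrefl num_less)

lemma dterm_num [dfn]: "dterm C (\<lambda>s. num k)"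
  by (induction k) (simp_all add: dterm_emp dterm_suc)

definition "fcode k a b = opair (num k) (opair a b)"

lemma dterm_fcode [dfn]: "dterm C t \<Longrightarrow> dterm C u \<Longrightarrow> dterm C (\<lambda>s. fcode k (t s) (u s))"
  unfolding fcode_def by (intro dfn)

lemma fcode_inject [simp]: "fcode k a b = fcode j c d \<longleftrightarrow> k = j \<and> a = c \<and> b = d"
  by (simp add: fcode_def)

lemma is_code_iff [simp]: "is_code E k a b c \<longleftrightarrow> c = fcode k a b"
  by (auto simp: is_code_def fcode_def)

section \<open>Recursion\<close>

definition "rng g = class_set (\<lambda>u. \<exists>b. opair b u \<epsilon> g)"
definition "product u v = class_set (\<lambda>p. \<exists>a b. a \<epsilon> u \<and> b \<epsilon> v \<and> p = opair a b)"
definition "graph_on f x = repl x (\<lambda>y. opair y (f y))"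
definition "restr f x = sep f (\<lambda>p. \<exists>y z. y \<epsilon> x \<and> p = opair y z)"
text \<open>In \<open>approx\<close>, the set \<open>f\<close> may contain elements that are not pairs; \<open>restr\<close> discards them.\<close>

definition "approx H f d \<longleftrightarrow> is_transitive E d \<and> (\<forall>x y. opair x y \<epsilon> f \<longleftrightarrow> x \<epsilon> d \<and> y = H x (restr f x))"
definition "rec H x = the1 (\<lambda>y. \<exists>f d. approx H f d \<and> opair x y \<epsilon> f)"

lemma dterm_rng [dfn]: "dterm C t \<Longrightarrow> dterm C (\<lambda>s. rng (t s))"
  by (rule dterm_sub1) (unfold rng_def, intro dfn)

lemma dterm_product [dfn]: "dterm C t \<Longrightarrow> dterm C u \<Longrightarrow> dterm C (\<lambda>s. product (t s) (u s))"
  by (rule dterm_sub2) (unfold product_def, intro dfn)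

lemma dterm_restr [dfn]: "dterm C t \<Longrightarrow> dterm C u \<Longrightarrow> dterm C (\<lambda>s. restr (t s) (u s))"
  by (rule dterm_sub2) (unfold restr_def, intro dfn)

lemma dterm_graph_on [dfn]:
  assumes "dterm C t" "dterm C (\<lambda>s. f (s 0))"
  shows "dterm C (\<lambda>s. graph_on f (t s))"
  unfolding graph_on_def by (intro dfn assms)

lemma dpred_approx [dfn]:
  assumes H: "dterm C (\<lambda>s. H (s 0) (s 1))" and "dterm C t" "dterm C u"
  shows "dpred C (\<lambda>s. approx H (t s) (u s))"
  by (rule dpred_sub2[OF _ assms(2,3)]) (unfold approx_def, intro dfn dterm_sub2[OF H])

lemma dterm_rec:
  assumes H: "dterm C (\<lambda>s. H (s 0) (s 1))" and t: "dterm C t"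
  shows "dterm C (\<lambda>s. rec H (t s))"
  by (rule dterm_sub1[OF _ t]) (unfold rec_def, intro dfn H)

lemma opair_sUnion: "opair a b \<epsilon> g \<Longrightarrow> a \<epsilon> sUnion (sUnion g)" "opair a b \<epsilon> g \<Longrightarrow> b \<epsilon> sUnion (sUnion g)"
  unfolding opair_def mem_sUnion using mem_upair by metis+

lemma mem_rng [simp]: "u \<epsilon> rng g \<longleftrightarrow> (\<exists>b. opair b u \<epsilon> g)"
  unfolding rng_def by (rule mem_class_set[of _ "sUnion (sUnion g)"]) (intro dfn, blast intro: opair_sUnion)

lemma mem_product: "p \<epsilon> product u v \<longleftrightarrow> (\<exists>a b. a \<epsilon> u \<and> b \<epsilon> v \<and> p = opair a b)"
  unfolding product_def by (rule mem_class_set[of _ "pow (pow (cup u v))"]) (intro dfn, blast intro: opair_in_pow)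

lemma opair_mem_product [simp]: "opair a b \<epsilon> product u v \<longleftrightarrow> a \<epsilon> u \<and> b \<epsilon> v"
  unfolding mem_product by simp

lemma mem_graph_on: "dterm UNIV (\<lambda>s. f (s 0)) \<Longrightarrow> p \<epsilon> graph_on f x \<longleftrightarrow> (\<exists>y. y \<epsilon> x \<and> p = opair y (f y))"
  unfolding graph_on_def by (rule mem_repl) (intro dfn)

lemma opair_mem_graph_on: "dterm UNIV (\<lambda>s. f (s 0)) \<Longrightarrow> opair y z \<epsilon> graph_on f x \<longleftrightarrow> y \<epsilon> x \<and> z = f y"
  by (subst mem_graph_on) auto

lemma mem_rng_graph_on: "dterm UNIV (\<lambda>s. f (s 0)) \<Longrightarrow> u \<epsilon> rng (graph_on f x) \<longleftrightarrow> (\<exists>y. y \<epsilon> x \<and> u = f y)"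
  by (simp add: opair_mem_graph_on)

lemma mem_restr: "p \<epsilon> restr f x \<longleftrightarrow> p \<epsilon> f \<and> (\<exists>y z. y \<epsilon> x \<and> p = opair y z)"
  unfolding restr_def by (rule mem_sep) (intro dfn)

context
  fixes H :: "'a \<Rightarrow> 'a \<Rightarrow> 'a"
  assumes H: "dterm UNIV (\<lambda>s. H (s 0) (s 1))"
begin

lemma approx_unique:
  assumes f: "approx H f d" and g: "approx H g e" and "x \<epsilon> d" "x \<epsilon> e"
  shows "opair x y \<epsilon> f \<longleftrightarrow> opair x y \<epsilon> g"
proof -
  have "x \<epsilon> e \<longrightarrow> (\<forall>y. opair x y \<epsilon> f \<longleftrightarrow> opair x y \<epsilon> g)"
  proof (rule transitive_induct[where P="\<lambda>x. x \<epsilon> e \<longrightarrow> (\<forall>y. opair x y \<epsilon> f \<longleftrightarrow> opair x y \<epsilon> g)"])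
    show "dpred UNIV (\<lambda>s. s 0 \<epsilon> e \<longrightarrow> (\<forall>y. opair (s 0) y \<epsilon> f \<longleftrightarrow> opair (s 0) y \<epsilon> g))" by (intro dfn)
    show "is_transitive E d" using f by (simp add: approx_def)
    fix x assume x: "x \<epsilon> d" and IH: "\<forall>z. z \<epsilon> x \<longrightarrow> z \<epsilon> e \<longrightarrow> (\<forall>y. opair z y \<epsilon> f \<longleftrightarrow> opair z y \<epsilon> g)"
    show "x \<epsilon> e \<longrightarrow> (\<forall>y. opair x y \<epsilon> f \<longleftrightarrow> opair x y \<epsilon> g)"
    proof
      assume "x \<epsilon> e"
      then have "\<forall>z. z \<epsilon> x \<longrightarrow> z \<epsilon> e" using g transitiveD unfolding approx_def by blast
      with IH have "restr f x = restr g x" by (intro set_ext) (unfold mem_restr, blast)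
      with f g x \<open>x \<epsilon> e\<close> show "\<forall>y. opair x y \<epsilon> f \<longleftrightarrow> opair x y \<epsilon> g" by (simp add: approx_def)
    qed
  qed fact
  with assms show ?thesis by blast
qed

lemma approx_rec:
  assumes f: "approx H f d" and x: "x \<epsilon> d"
  shows "opair x y \<epsilon> f \<longleftrightarrow> y = rec H x"
proof -
  have 1: "opair x z \<epsilon> f \<longleftrightarrow> z = H x (restr f x)" for z using f x by (simp add: approx_def)
  have "rec H x = H x (restr f x)" unfolding rec_def
  proof (rule the1_eq)
    show "\<exists>f' d. approx H f' d \<and> opair x (H x (restr f x)) \<epsilon> f'" using f 1 by blast
    fix y assume "\<exists>f d. approx H f d \<and> opair x y \<epsilon> f"
    then obtain g e where g: "approx H g e" "opair x y \<epsilon> g" by blast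
    then have "x \<epsilon> e" by (simp add: approx_def)
    with g f x have "opair x y \<epsilon> f" using approx_unique by blast
    then show "y = H x (restr f x)" by (simp add: 1)
  qed
  with 1 show ?thesis by simp
qed

lemma dterm_rec_UNIV: "dterm UNIV (\<lambda>s. rec H (s 0))"
  by (intro dterm_rec[OF H] dfn)

lemma approx_restr:
  assumes f: "approx H f d" and x: "x \<epsilon> d"
  shows "restr f x = graph_on (rec H) x"
proof (rule set_ext)
  fix p
  have "\<forall>y. y \<epsilon> x \<longrightarrow> y \<epsilon> d" using f x transitiveD unfolding approx_def by blast
  then have "opair y z \<epsilon> f \<longleftrightarrow> z = rec H y" if "y \<epsilon> x" for y z
    using approx_rec[OF f] that by blast
  then show "p \<epsilon> restr f x \<longleftrightarrow> p \<epsilon> graph_on (rec H) x"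
    unfolding mem_restr mem_graph_on[OF dterm_rec_UNIV] by metis
qed

lemma approx_rec_eq:
  assumes f: "approx H f d" and x: "x \<epsilon> d"
  shows "rec H x = H x (graph_on (rec H) x)"
  using approx_rec[OF f x, of "H x (restr f x)"] f x approx_restr[OF f x] by (simp add: approx_def)

text \<open>Approximations need not be glued together: on the arguments already covered they all
  agree with \<open>rec H\<close>, whose graph there is a set by Replacement. If \<open>x\<close> is
  not yet covered, one more pair extends this graph to \<open>x\<close>.\<close>

lemma ex_approx:
  assumes d: "is_transitive E d" and x: "x \<epsilon> d"
  shows "\<exists>f e. approx H f e \<and> x \<epsilon> e"
proof (rule transitive_induct[OF _ d x])
  show "dpred UNIV (\<lambda>s. \<exists>f e. approx H f e \<and> s 0 \<epsilon> e)" by (intro dfn H)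
  fix x assume x: "x \<epsilon> d" and IH: "\<forall>y. y \<epsilon> x \<longrightarrow> (\<exists>f e. approx H f e \<and> y \<epsilon> e)"
  \<comment> \<open>The covered arguments in \<open>d\<close>. They form a transitive set which
    contains all members of \<open>x\<close>.\<close>
  define d0 where "d0 = sep d (\<lambda>x. \<exists>f e. approx H f e \<and> x \<epsilon> e)"
  have d0: "y \<epsilon> d0 \<longleftrightarrow> y \<epsilon> d \<and> (\<exists>f e. approx H f e \<and> y \<epsilon> e)" for y
    unfolding d0_def by (rule mem_sep) (intro dfn H)
  have trd0: "z \<epsilon> d0" if "y \<epsilon> d0" "z \<epsilon> y" for y z
    using that d transitiveD unfolding d0 approx_def by blast
  have xd0: "y \<epsilon> d0" if "y \<epsilon> x" for y
    using that IH x d transitiveD unfolding d0 by blast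
  define v where "v = H x (graph_on (rec H) x)"
  define d1 where "d1 = cup d0 (upair x x)"
  define f1 where "f1 = cup (graph_on (rec H) d0) (upair (opair x v) (opair x v))"
  show "\<exists>f e. approx H f e \<and> x \<epsilon> e"
  proof (cases "x \<epsilon> d0")
    case True
    then show ?thesis by (simp add: d0)
  next
    case False
    have f1: "opair y z \<epsilon> f1 \<longleftrightarrow> y \<epsilon> d0 \<and> z = rec H y \<or> y = x \<and> z = v" for y z
      by (simp add: f1_def opair_mem_graph_on[OF dterm_rec_UNIV])
    have restr: "restr f1 y = graph_on (rec H) y" if "y \<epsilon> d1" for y
    proof (rule set_ext)
      fix p
      have "z \<epsilon> d0" if "z \<epsilon> y" for z
        using that \<open>y \<epsilon> d1\<close> trd0 xd0 by (auto simp: d1_def)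
      then have "opair z w \<epsilon> f1 \<longleftrightarrow> w = rec H z" if "z \<epsilon> y" for z w
        using that False unfolding f1 by metis
      then show "p \<epsilon> restr f1 y \<longleftrightarrow> p \<epsilon> graph_on (rec H) y"
        unfolding mem_restr mem_graph_on[OF dterm_rec_UNIV] by metis
    qed
    have "approx H f1 d1" unfolding approx_def
    proof (intro conjI allI)
      show "is_transitive E d1" unfolding is_transitive_iff d1_def using trd0 xd0 by auto
      fix y z
      have "H y (restr f1 y) = rec H y" if "y \<epsilon> d0"
      proof -
        from that obtain f e where "approx H f e" "y \<epsilon> e" by (auto simp: d0)
        from approx_rec_eq[OF this] that restr show ?thesis by (simp add: d1_def)
      qed
      moreover have "H x (restr f1 x) = v" by (simp add: restr v_def d1_def)
      ultimately show "opair y z \<epsilon> f1 \<longleftrightarrow> y \<epsilon> d1 \<and> z = H y (restr f1 y)"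
        unfolding f1 by (auto simp: d1_def)
    qed
    moreover have "x \<epsilon> d1" by (simp add: d1_def)
    ultimately show ?thesis by blast
  qed
qed

text \<open>Provisional form of the recursion equation: that every set lies in a transitive one is
  itself proved by recursion along \<omega>.\<close>

lemma rec_transitive:
  assumes "is_transitive E d" "x \<epsilon> d"
  shows "rec H x = H x (graph_on (rec H) x)"
  using ex_approx[OF assms] approx_rec_eq by blast

end

text \<open>Iterated unions of \<open>x\<close>, collected over \<omega>. There is no circularity,
  since \<omega> is known to be a transitive set and \<open>rec_transitive\<close> applies to its
  elements.\<close>

lemma ex_transitive: "\<exists>d. is_transitive E d \<and> is_subset E x d"
proof -
  define H where "H z g = cup x (sUnion (sUnion (rng g)))" for z g :: 'a
  have H: "dterm UNIV (\<lambda>s. H (s 0) (s 1))" unfolding H_def by (intro dfn)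
  let ?d = "sUnion (rng (graph_on (rec H) omega))"
  have d: "z \<epsilon> ?d \<longleftrightarrow> (\<exists>n. n \<epsilon> omega \<and> z \<epsilon> rec H n)" for z
    using mem_rng_graph_on[OF dterm_rec_UNIV[OF H]] by auto
  have eq: "z \<epsilon> rec H n \<longleftrightarrow> z \<epsilon> x \<or> (\<exists>m w. m \<epsilon> n \<and> w \<epsilon> rec H m \<and> z \<epsilon> w)" if "n \<epsilon> omega" for n z
    unfolding rec_transitive[OF H ord_transitive[OF ord_omega] that] 
    unfolding H_def mem_cup mem_sUnion mem_rng_graph_on[OF dterm_rec_UNIV[OF H, unfolded H_def]] by blast
  have "is_transitive E ?d" unfolding is_transitive_iff d
    using eq suc_omega mem_suc by metis
  moreover have "is_subset E x ?d" unfolding is_subset_def d using eq emp_omega by blast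
  ultimately show ?thesis by blast
qed

text \<open>The intersection of all transitive supersets of \<open>x\<close>, cut out of one of them
  by Separation.\<close>

lemma ex_trcl: "\<exists>T. is_trcl E x T"
proof -
  obtain d where d: "is_transitive E d" "is_subset E x d" using ex_transitive by blast
  define T where "T = sep d (\<lambda>y. \<forall>U. is_subset E x U \<and> is_transitive E U \<longrightarrow> y \<epsilon> U)"
  have T: "y \<epsilon> T \<longleftrightarrow> y \<epsilon> d \<and> (\<forall>U. is_subset E x U \<and> is_transitive E U \<longrightarrow> y \<epsilon> U)" for y
    unfolding T_def by (rule mem_sep) (intro dfn)
  have "is_transitive E T" unfolding is_transitive_iff
  proof (intro allI impI)
    fix y z assume yz: "y \<epsilon> T" "z \<epsilon> y"
    then have "z \<epsilon> d" using transitiveD[OF d(1) _ yz(2)] by (simp add: T)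
    moreover have "z \<epsilon> U" if "is_subset E x U" "is_transitive E U" for U
      using transitiveD[OF that(2) _ yz(2)] yz(1) that by (simp add: T)
    ultimately show "z \<epsilon> T" by (simp add: T)
  qed
  moreover have "is_subset E x T" using d(2) by (simp add: is_subset_def T)
  moreover have "is_subset E T U" if "is_subset E x U" "is_transitive E U" for U
    using that by (simp add: is_subset_def[of E T] T)
  ultimately have "is_trcl E x T" unfolding is_trcl_def by blast
  then show ?thesis by blast
qed

lemma mem_transitive: "\<exists>d. is_transitive E d \<and> x \<epsilon> d"
  using ex_transitive[of "upair x x"] unfolding is_subset_def mem_upair by blast

lemma mem_induct:
  assumes dpred: "dpred UNIV (\<lambda>s. P (s 0))" and step: "\<And>x. (\<forall>y. y \<epsilon> x \<longrightarrow> P y) \<Longrightarrow> P x"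
  shows "P x"
proof -
  obtain d where d: "is_transitive E d" "x \<epsilon> d" using mem_transitive by blast
  show ?thesis by (rule transitive_induct[OF dpred d]) (rule step)
qed

lemma rec_eq:
  assumes "dterm UNIV (\<lambda>s. H (s 0) (s 1))"
  shows "rec H x = H x (graph_on (rec H) x)"
  using mem_transitive rec_transitive[OF assms] by blast

section \<open>The cumulative hierarchy\<close>

text \<open>\<open>V x\<close> is defined for every set \<open>x\<close> and equals \<open>V\<^sub>\<alpha>\<close> for the rank \<open>\<alpha>\<close> of \<open>x\<close>.\<close>

definition "V = rec (\<lambda>_ g. sUnion (repl (rng g) pow))"

lemma dterm_V [dfn]: "dterm C t \<Longrightarrow> dterm C (\<lambda>s. V (t s))"
  unfolding V_def by (rule dterm_rec) (intro dfn)

lemma mem_V: "y \<epsilon> V x \<longleftrightarrow> (\<exists>b. b \<epsilon> x \<and> is_subset E y (V b))"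
proof -
  have "V x = sUnion (repl (rng (graph_on V x)) pow)"
    unfolding V_def by (rule rec_eq[of "\<lambda>_ g. sUnion (repl (rng g) pow)"]) (intro dfn)
  moreover have "u \<epsilon> repl (rng (graph_on V x)) pow \<longleftrightarrow> (\<exists>b. b \<epsilon> rng (graph_on V x) \<and> u = pow b)" for u
    by (rule mem_repl) (intro dfn)
  moreover have "b \<epsilon> rng (graph_on V x) \<longleftrightarrow> (\<exists>y. y \<epsilon> x \<and> b = V y)" for b
    by (rule mem_rng_graph_on) (intro dfn)
  ultimately have "y \<epsilon> V x \<longleftrightarrow> (\<exists>u. (\<exists>b. (\<exists>z. z \<epsilon> x \<and> b = V z) \<and> u = pow b) \<and> y \<epsilon> u)"
    by (simp only: mem_sUnion)
  then show ?thesis by (simp only: mem_pow ex_simps[symmetric] cong: conj_cong) blast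
qed

lemma V_transitive: "is_transitive E (V x)"
proof (rule mem_induct[where P="\<lambda>x. is_transitive E (V x)"])
  show "dpred UNIV (\<lambda>s. is_transitive E (V (s 0)))" by (intro dfn)
  fix x assume IH: "\<forall>y. y \<epsilon> x \<longrightarrow> is_transitive E (V y)"
  show "is_transitive E (V x)" unfolding is_transitive_iff
  proof (intro allI impI)
    fix y z assume "y \<epsilon> V x" "z \<epsilon> y"
    then obtain b where b: "b \<epsilon> x" "z \<epsilon> V b" unfolding mem_V[of y] is_subset_def by blast
    with IH have "is_subset E z (V b)" by (auto simp: is_transitive_def)
    with b show "z \<epsilon> V x" unfolding mem_V[of z] by blast
  qed
qed

lemma V_mem_mono: "a \<epsilon> b \<Longrightarrow> z \<epsilon> V a \<Longrightarrow> z \<epsilon> V b"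
  using V_transitive[of a] unfolding mem_V[of z b] is_transitive_def by blast

text \<open>Collection for ordinal witnesses, without choice: Replacement is applied to the least
  witnesses, and \<open>suc\<close> keeps each of them strictly below the union.\<close>

lemma ord_collect:
  assumes dpred: "dpred UNIV (\<lambda>s. R (s 0) (s 1))" and R: "\<And>y. y \<epsilon> x \<Longrightarrow> \<exists>a. ord a \<and> R y a"
  shows "\<exists>a. ord a \<and> (\<forall>y. y \<epsilon> x \<longrightarrow> (\<exists>b. b \<epsilon> a \<and> R y b))"
proof -
  let ?r = "repl x (\<lambda>y. suc (least_ord (R y)))"
  have D2: "dpred UNIV (\<lambda>s. R (s m) (s n))" for m n by (rule dpred_sub2[OF dpred]) (intro dfn)+
  have D1: "dpred UNIV (\<lambda>s. R y (s 0))" for y by (rule dpred_sub2[OF dpred]) (intro dfn)+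
  have r: "u \<epsilon> ?r \<longleftrightarrow> (\<exists>y. y \<epsilon> x \<and> u = suc (least_ord (R y)))" for u
    by (rule mem_repl) (intro dfn D2)
  have l: "ord (least_ord (R y))" "R y (least_ord (R y))" if "y \<epsilon> x" for y
    using R[OF that] least_ord[OF D1] by blast+
  have "ord (sUnion ?r)" by (rule ord_sUnion) (use r l ord_suc in auto)
  moreover have "\<exists>b. b \<epsilon> sUnion ?r \<and> R y b" if "y \<epsilon> x" for y
    using l[OF that] r that by (intro exI[of _ "least_ord (R y)"]) auto
  ultimately show ?thesis by blast
qed

lemma ex_subset_V: "\<exists>a. ord a \<and> is_subset E x (V a)"
proof (rule mem_induct[where P="\<lambda>x. \<exists>a. ord a \<and> is_subset E x (V a)"])
  show "dpred UNIV (\<lambda>s. \<exists>a. ord a \<and> is_subset E (s 0) (V a))" by (intro dfn)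
  fix x assume IH: "\<forall>y. y \<epsilon> x \<longrightarrow> (\<exists>a. ord a \<and> is_subset E y (V a))"
  have "\<exists>a. ord a \<and> (\<forall>y. y \<epsilon> x \<longrightarrow> (\<exists>b. b \<epsilon> a \<and> is_subset E y (V b)))"
    by (rule ord_collect) (use IH in \<open>intro dfn | blast\<close>)+
  then show "\<exists>a. ord a \<and> is_subset E x (V a)" unfolding is_subset_def[of _ x] mem_V .
qed

lemma ex_V: "\<exists>a. ord a \<and> x \<epsilon> V a"
proof -
  obtain a where "ord a" "is_subset E x (V a)" using ex_subset_V by blast
  then show ?thesis by (intro exI[of _ "suc a"]) (auto simp: mem_V[of x] ord_suc)
qed

lemma is_fun_iff: "is_fun E f d \<longleftrightarrow> (\<forall>p. p \<epsilon> f \<longrightarrow> (\<exists>x y. x \<epsilon> d \<and> p = opair x y)) \<and>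
  (\<forall>x. x \<epsilon> d \<longrightarrow> (\<exists>y. \<forall>z. opair x z \<epsilon> f \<longleftrightarrow> z = y))"
  unfolding is_fun_def by simp

lemma is_fun_graph_on: "dterm UNIV (\<lambda>s. f (s 0)) \<Longrightarrow> is_fun E (graph_on f d) d"
  unfolding is_fun_iff by (auto simp: opair_mem_graph_on mem_graph_on)

text \<open>Ties the recursively defined \<open>V\<close> to the official relation, whose witness is
  a function on \<open>suc th\<close>; such a function obeys the recursion of \<open>V\<close> and
  agrees with it by induction.\<close>

lemma is_V_iff:
  assumes th: "ord th"
  shows "is_V E th A \<longleftrightarrow> A = V th"
proof
  assume "is_V E th A"
  then obtain f where f: "is_fun E f (suc th)" "opair th A \<epsilon> f"
    "\<And>a v y. a \<epsilon> suc th \<Longrightarrow> opair a v \<epsilon> f \<Longrightarrow> y \<epsilon> v \<longleftrightarrow> (\<exists>b u. b \<epsilon> a \<and> opair b u \<epsilon> f \<and> is_subset E y u)"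
    unfolding is_V_def is_succ_iff is_app_iff by blast
  have "\<forall>v. opair th v \<epsilon> f \<longrightarrow> v = V th"
  proof (rule transitive_induct[OF _ ord_transitive[OF ord_suc[OF th]], where P="\<lambda>x. \<forall>v. opair x v \<epsilon> f \<longrightarrow> v = V x"])
    show "dpred UNIV (\<lambda>s. \<forall>v. opair (s 0) v \<epsilon> f \<longrightarrow> v = V (s 0))" by (intro dfn)
    fix a assume a: "a \<epsilon> suc th" and IH: "\<forall>b. b \<epsilon> a \<longrightarrow> (\<forall>v. opair b v \<epsilon> f \<longrightarrow> v = V b)"
    have bt: "b \<epsilon> suc th" if "b \<epsilon> a" for b using transitiveD[OF ord_transitive[OF ord_suc[OF th]] a that] .
    have *: "opair b v \<epsilon> f \<longleftrightarrow> v = V b" if ba: "b \<epsilon> a" for b v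
    proof -
      obtain u where "\<forall>z. opair b z \<epsilon> f \<longleftrightarrow> z = u" using bt[OF ba] f(1) unfolding is_fun_iff by blast
      with IH ba show ?thesis by simp
    qed
    show "\<forall>v. opair a v \<epsilon> f \<longrightarrow> v = V a"
    proof (intro allI impI set_ext)
      fix v y assume "opair a v \<epsilon> f"
      from f(3)[OF a this] show "y \<epsilon> v \<longleftrightarrow> y \<epsilon> V a" unfolding mem_V using * by metis
    qed
  qed simp
  with f(2) show "A = V th" by blast
next
  have V: "dterm UNIV (\<lambda>s. V (s 0))" by (intro dfn)
  have tr: "is_transitive E (suc th)" using ord_transitive[OF ord_suc[OF th]] .
  assume A: "A = V th"
  let ?f = "graph_on V (suc th)"
  have f: "opair a v \<epsilon> ?f \<longleftrightarrow> a \<epsilon> suc th \<and> v = V a" for a v by (rule opair_mem_graph_on[OF V])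
  have "y \<epsilon> v \<longleftrightarrow> (\<exists>b u. b \<epsilon> a \<and> opair b u \<epsilon> ?f \<and> is_subset E y u)" if "a \<epsilon> suc th \<and> opair a v \<epsilon> ?f" for a v y
  proof -
    have "b \<epsilon> suc th" if "b \<epsilon> a" for b using transitiveD[OF tr _ that] \<open>a \<epsilon> suc th \<and> _\<close> by blast
    with that show ?thesis unfolding f mem_V[of y] using mem_V by blast
  qed
  then show "is_V E th A" unfolding is_V_def is_succ_iff is_app_iff
    using is_fun_graph_on[OF V, of "suc th"] f A by (intro exI[of _ ?f] exI[of _ "suc th"]) simp
qed

section \<open>Formula codes\<close>

text \<open>The closure of \<open>\<omega>\<close> under pairing, in stages. It bounds the class of formula codes, and the stages
  carry the recursion that chooses codes definably.\<close>

definition "pair_level = rec (\<lambda>_ g. cup omega (sUnion (repl (rng g) (\<lambda>u. product u u))))"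

lemma dterm_pair_level [dfn]: "dterm C t \<Longrightarrow> dterm C (\<lambda>s. pair_level (t s))"
  unfolding pair_level_def by (rule dterm_rec) (intro dfn)

lemma mem_pair_level: "p \<epsilon> pair_level x \<longleftrightarrow> p \<epsilon> omega \<or> (\<exists>b u v. b \<epsilon> x \<and> u \<epsilon> pair_level b \<and> v \<epsilon> pair_level b \<and> p = opair u v)"
proof -
  have "pair_level x = cup omega (sUnion (repl (rng (graph_on pair_level x)) (\<lambda>u. product u u)))"
    unfolding pair_level_def by (rule rec_eq[of "\<lambda>_ g. cup omega (sUnion (repl (rng g) (\<lambda>u. product u u)))"]) (intro dfn)
  moreover have "u \<epsilon> repl (rng (graph_on pair_level x)) (\<lambda>u. product u u) \<longleftrightarrow> (\<exists>b. b \<epsilon> rng (graph_on pair_level x) \<and> u = product b b)" for u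
    by (rule mem_repl) (intro dfn)
  moreover have "b \<epsilon> rng (graph_on pair_level x) \<longleftrightarrow> (\<exists>y. y \<epsilon> x \<and> b = pair_level y)" for b
    by (rule mem_rng_graph_on) (intro dfn)
  ultimately have "p \<epsilon> pair_level x \<longleftrightarrow> p \<epsilon> omega \<or>
      (\<exists>u. (\<exists>b. (\<exists>z. z \<epsilon> x \<and> b = pair_level z) \<and> u = product b b) \<and> p \<epsilon> u)"
    by (simp only: mem_cup mem_sUnion)
  then show ?thesis using mem_product[of p] by metis
qed

text \<open>Each component already appears at a finite stage in the sense of the structure; the
  larger of the two stages contains both.\<close>

lemma pair_level_omega_opair:
  assumes "a \<epsilon> pair_level omega" "b \<epsilon> pair_level omega"
  shows "opair a b \<epsilon> pair_level omega"
proof -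
  have least_level: "\<exists>n. n \<epsilon> omega \<and> a \<epsilon> pair_level n" if "a \<epsilon> pair_level omega" for a
    using that suc_omega emp_omega mem_suc unfolding mem_pair_level[of a] by metis
  obtain m n where mn: "m \<epsilon> omega" "a \<epsilon> pair_level m" "n \<epsilon> omega" "b \<epsilon> pair_level n" using least_level assms by blast
  have mono: "is_subset E x y \<Longrightarrow> a \<epsilon> pair_level x \<Longrightarrow> a \<epsilon> pair_level y" for a x y
    unfolding mem_pair_level[of a] is_subset_def by blast
  have o: "ord m" "ord n" using mn ord_mem[OF ord_omega] by blast+
  then have "is_subset E m n \<or> is_subset E n m" using ord_linear[OF o] ord_subset by blast
  with mono mn show ?thesis unfolding mem_pair_level[of "opair a b"] by blast
qed

definition "Formulas = class_set (\<lambda>c. \<forall>G. is_formula_closed E omega G \<longrightarrow> c \<epsilon> G)"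

lemma dterm_Formulas [dfn]: "dterm C (\<lambda>s. Formulas)"
  unfolding Formulas_def by (intro dfn)

lemma is_formula_closed_iff: "is_formula_closed E omega F \<longleftrightarrow>
  (\<forall>i j. i \<epsilon> omega \<and> j \<epsilon> omega \<longrightarrow> fcode 0 i j \<epsilon> F \<and> fcode 1 i j \<epsilon> F) \<and>
  (\<forall>a b. a \<epsilon> F \<and> b \<epsilon> F \<longrightarrow> fcode 2 a b \<epsilon> F) \<and>
  (\<forall>i a. i \<epsilon> omega \<and> a \<epsilon> F \<longrightarrow> fcode 3 i a \<epsilon> F)"
proof -
  have "(\<forall>i j c. i \<epsilon> omega \<and> j \<epsilon> omega \<and> (c = fcode 0 i j \<or> c = fcode 1 i j) \<longrightarrow> c \<epsilon> F) \<longleftrightarrow>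
      (\<forall>i j. i \<epsilon> omega \<and> j \<epsilon> omega \<longrightarrow> fcode 0 i j \<epsilon> F \<and> fcode 1 i j \<epsilon> F)" by metis
  moreover have "(\<forall>a b c. a \<epsilon> F \<and> b \<epsilon> F \<and> c = fcode 2 a b \<longrightarrow> c \<epsilon> F) \<longleftrightarrow>
      (\<forall>a b. a \<epsilon> F \<and> b \<epsilon> F \<longrightarrow> fcode 2 a b \<epsilon> F)" by simp
  moreover have "(\<forall>i a c. i \<epsilon> omega \<and> a \<epsilon> F \<and> c = fcode 3 i a \<longrightarrow> c \<epsilon> F) \<longleftrightarrow>
      (\<forall>i a. i \<epsilon> omega \<and> a \<epsilon> F \<longrightarrow> fcode 3 i a \<epsilon> F)" by simp
  ultimately show ?thesis unfolding is_formula_closed_def is_code_iff by (simp only:)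
qed

lemma formula_closed_pair_level: "is_formula_closed E omega (pair_level omega)"
proof -
  have "x \<epsilon> pair_level omega" if "x \<epsilon> omega" for x using that by (simp add: mem_pair_level[of x])
  then show ?thesis unfolding is_formula_closed_iff fcode_def by (blast intro: pair_level_omega_opair num_omega)
qed

lemma mem_Formulas: "c \<epsilon> Formulas \<longleftrightarrow> (\<forall>G. is_formula_closed E omega G \<longrightarrow> c \<epsilon> G)"
  unfolding Formulas_def by (rule mem_class_set[of _ "pair_level omega"]) (use formula_closed_pair_level in \<open>intro dfn | blast\<close>)+

lemma Formulas_pair_level: "c \<epsilon> Formulas \<Longrightarrow> c \<epsilon> pair_level omega"
  using formula_closed_pair_level by (simp add: mem_Formulas)

lemma Formulas_intros:
  "i \<epsilon> omega \<Longrightarrow> j \<epsilon> omega \<Longrightarrow> fcode 0 i j \<epsilon> Formulas"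
  "i \<epsilon> omega \<Longrightarrow> j \<epsilon> omega \<Longrightarrow> fcode 1 i j \<epsilon> Formulas"
  "a \<epsilon> Formulas \<Longrightarrow> b \<epsilon> Formulas \<Longrightarrow> fcode 2 a b \<epsilon> Formulas"
  "i \<epsilon> omega \<Longrightarrow> a \<epsilon> Formulas \<Longrightarrow> fcode 3 i a \<epsilon> Formulas"
  unfolding mem_Formulas is_formula_closed_iff by blast+

lemma is_formulas_Formulas: "is_formulas E omega Formulas"
proof -
  have "is_formula_closed E omega Formulas" unfolding is_formula_closed_iff by (blast intro: Formulas_intros)
  then show ?thesis unfolding is_formulas_def by (simp add: is_subset_def mem_Formulas)
qed

section \<open>Course-of-values recursion\<close>

text \<open>The value of \<open>crec K\<close> at \<open>x\<close> is computed from the graph \<open>cv_below K x\<close> of \<open>crec K\<close> on the transitive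
  closure of \<open>x\<close>: the constituents of a formula code are not members of it but lie in its transitive
  closure.\<close>

definition "cv_graph K = rec (\<lambda>x g. cup (sUnion (rng g)) (upair (opair x (K x (sUnion (rng g)))) (opair x (K x (sUnion (rng g))))))"
definition "cv_below K x = sUnion (rng (graph_on (cv_graph K) x))"
definition "crec K x = K x (cv_below K x)"

context
  fixes K :: "'a \<Rightarrow> 'a \<Rightarrow> 'a"
  assumes K: "dterm UNIV (\<lambda>s. K (s 0) (s 1))"
begin

lemma cv_graph_step: "dterm UNIV (\<lambda>s. (\<lambda>x g. cup (sUnion (rng g)) (upair (opair x (K x (sUnion (rng g)))) (opair x (K x (sUnion (rng g)))))) (s 0) (s 1))"
  by (intro dfn dterm_sub2[OF K])

lemma dterm_cv_graph: "dterm UNIV (\<lambda>s. cv_graph K (s 0))"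
  unfolding cv_graph_def by (rule dterm_rec[OF cv_graph_step]) (intro dfn)

lemma mem_cv_below: "p \<epsilon> cv_below K x \<longleftrightarrow> (\<exists>z. z \<epsilon> x \<and> p \<epsilon> cv_graph K z)"
  unfolding cv_below_def mem_sUnion mem_rng_graph_on[OF dterm_cv_graph] by blast

lemma mem_cv_graph: "p \<epsilon> cv_graph K x \<longleftrightarrow> p \<epsilon> cv_below K x \<or> p = opair x (crec K x)"
proof -
  have "cv_graph K x = cup (cv_below K x) (upair (opair x (crec K x)) (opair x (crec K x)))"
    unfolding crec_def cv_below_def unfolding cv_graph_def by (rule rec_eq[OF cv_graph_step])
  then show ?thesis by simp
qed

lemma dterm_crec: "dterm UNIV t \<Longrightarrow> dterm UNIV (\<lambda>s. crec K (t s))"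
  by (rule dterm_sub1) (unfold crec_def cv_below_def, intro dfn dterm_cv_graph dterm_sub2[OF K])

lemma cv_graph_value: "opair y v \<epsilon> cv_graph K x \<Longrightarrow> v = crec K y"
proof -
  have "\<forall>y v. opair y v \<epsilon> cv_graph K x \<longrightarrow> v = crec K y"
  proof (rule mem_induct[where P="\<lambda>x. \<forall>y v. opair y v \<epsilon> cv_graph K x \<longrightarrow> v = crec K y"])
    show "dpred UNIV (\<lambda>s. \<forall>y v. opair y v \<epsilon> cv_graph K (s 0) \<longrightarrow> v = crec K y)"
      by (intro dfn dterm_cv_graph dterm_sub1[OF dterm_cv_graph] dterm_crec)
    show "\<forall>y v. opair y v \<epsilon> cv_graph K x \<longrightarrow> v = crec K y" if "\<forall>z. z \<epsilon> x \<longrightarrow> (\<forall>y v. opair y v \<epsilon> cv_graph K z \<longrightarrow> v = crec K y)" for x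
      using that unfolding mem_cv_graph[of _ x] mem_cv_below opair_inject by blast
  qed
  then show "opair y v \<epsilon> cv_graph K x \<Longrightarrow> v = crec K y" by blast
qed

lemma cv_below_value: "opair y v \<epsilon> cv_below K x \<Longrightarrow> v = crec K y"
  unfolding mem_cv_below using cv_graph_value by blast

lemma cv_below_mem: "y \<epsilon> x \<Longrightarrow> opair y (crec K y) \<epsilon> cv_below K x"
  using mem_cv_below[of _ x] mem_cv_graph[of _ y] by blast

lemma cv_below_trans: "p \<epsilon> cv_below K z \<Longrightarrow> z \<epsilon> x \<Longrightarrow> p \<epsilon> cv_below K x"
  using mem_cv_below[of _ x] mem_cv_graph[of _ z] by blast

text \<open>A component of a Kuratowski pair lies two membership steps below it. Admitting any
  \<open>p\<close> already recorded below \<open>a\<close> allows iteration through the nested pairs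
  of \<open>fcode\<close>.\<close>

lemma cv_below_opair:
  assumes "p \<epsilon> cv_below K a \<or> p = opair a (crec K a)"
  shows "p \<epsilon> cv_below K (opair a b)" "p \<epsilon> cv_below K (opair b a)"
proof -
  have "p \<epsilon> cv_below K (upair a b)" "p \<epsilon> cv_below K (upair b a)" using assms cv_below_mem[of a] cv_below_trans[of p a] by auto
  then show "p \<epsilon> cv_below K (opair a b)" "p \<epsilon> cv_below K (opair b a)"
    unfolding opair_def by (auto elim: cv_below_trans)
qed

lemma cv_below_fcode: "opair a v \<epsilon> cv_below K (fcode k a b) \<longleftrightarrow> v = crec K a" "opair b v \<epsilon> cv_below K (fcode k a b) \<longleftrightarrow> v = crec K b"
proof -
  have "opair a (crec K a) \<epsilon> cv_below K (opair a b)" "opair b (crec K b) \<epsilon> cv_below K (opair a b)" by (auto intro: cv_below_opair)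
  then have "opair a (crec K a) \<epsilon> cv_below K (fcode k a b)" "opair b (crec K b) \<epsilon> cv_below K (fcode k a b)"
    unfolding fcode_def by (auto intro: cv_below_opair)
  then show "opair a v \<epsilon> cv_below K (fcode k a b) \<longleftrightarrow> v = crec K a" "opair b v \<epsilon> cv_below K (fcode k a b) \<longleftrightarrow> v = crec K b"
    using cv_below_value by blast+
qed

end

section \<open>Satisfaction\<close>

lemma is_fun_into_iff: "is_fun_into E f d A \<longleftrightarrow> is_fun E f d \<and> (\<forall>x y. opair x y \<epsilon> f \<longrightarrow> y \<epsilon> A)"
  unfolding is_fun_into_def by simp

lemma fun_value: "is_fun_into E f d A \<Longrightarrow> x \<epsilon> d \<Longrightarrow> \<exists>y. y \<epsilon> A \<and> opair x y \<epsilon> f"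
  unfolding is_fun_into_iff is_fun_iff by metis

lemma fun_unique: "is_fun_into E f d A \<Longrightarrow> x \<epsilon> d \<Longrightarrow> opair x y \<epsilon> f \<Longrightarrow> opair x z \<epsilon> f \<Longrightarrow> y = z"
  unfolding is_fun_into_iff is_fun_iff by metis

lemma fun_into_pow: "is_fun_into E f d A \<Longrightarrow> f \<epsilon> pow (product d A)"
  unfolding is_fun_into_iff is_fun_iff mem_pow is_subset_def mem_product by blast

text \<open>The recursion sends a code to the set of assignments satisfying it in \<open>A\<close>;
  \<open>U\<close> records the earlier values, so \<open>opair a v \<epsilon> U\<close> says that
  \<open>v\<close> is this set for the constituent \<open>a\<close>.\<close>

definition "sat_step A c U = class_set (\<lambda>s. is_fun_into E s omega A \<and>
  ((\<exists>i j x y. c = fcode 0 i j \<and> opair i x \<epsilon> s \<and> opair j y \<epsilon> s \<and> x \<epsilon> y) \<or>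
   (\<exists>i j x y. c = fcode 1 i j \<and> opair i x \<epsilon> s \<and> opair j y \<epsilon> s \<and> x = y) \<or>
   (\<exists>a b. c = fcode 2 a b \<and> \<not> ((\<exists>v. opair a v \<epsilon> U \<and> s \<epsilon> v) \<and> (\<exists>v. opair b v \<epsilon> U \<and> s \<epsilon> v))) \<or>
   (\<exists>i a. c = fcode 3 i a \<and> (\<forall>t. is_fun_into E t omega A \<and> is_variant E i s t \<longrightarrow> (\<exists>v. opair a v \<epsilon> U \<and> t \<epsilon> v)))))"

lemma dterm_sat_step: "dterm UNIV (\<lambda>s. sat_step A (s 0) (s 1))"
  unfolding sat_step_def by (intro dfn)

lemma mem_sat_step: "s \<epsilon> sat_step A c U \<longleftrightarrow> is_fun_into E s omega A \<and>
  ((\<exists>i j x y. c = fcode 0 i j \<and> opair i x \<epsilon> s \<and> opair j y \<epsilon> s \<and> x \<epsilon> y) \<or>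
   (\<exists>i j x y. c = fcode 1 i j \<and> opair i x \<epsilon> s \<and> opair j y \<epsilon> s \<and> x = y) \<or>
   (\<exists>a b. c = fcode 2 a b \<and> \<not> ((\<exists>v. opair a v \<epsilon> U \<and> s \<epsilon> v) \<and> (\<exists>v. opair b v \<epsilon> U \<and> s \<epsilon> v))) \<or>
   (\<exists>i a. c = fcode 3 i a \<and> (\<forall>t. is_fun_into E t omega A \<and> is_variant E i s t \<longrightarrow> (\<exists>v. opair a v \<epsilon> U \<and> t \<epsilon> v))))"
  unfolding sat_step_def by (rule mem_class_set[of _ "pow (product omega A)"]) (intro dfn, blast intro: fun_into_pow)

lemma mem_crec_sat_step:
  assumes "is_fun_into E s omega A"
  shows "s \<epsilon> crec (sat_step A) (fcode 0 i j) \<longleftrightarrow> (\<exists>x y. opair i x \<epsilon> s \<and> opair j y \<epsilon> s \<and> x \<epsilon> y)"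
    "s \<epsilon> crec (sat_step A) (fcode 1 i j) \<longleftrightarrow> (\<exists>x y. opair i x \<epsilon> s \<and> opair j y \<epsilon> s \<and> x = y)"
    "s \<epsilon> crec (sat_step A) (fcode 2 a b) \<longleftrightarrow> \<not> (s \<epsilon> crec (sat_step A) a \<and> s \<epsilon> crec (sat_step A) b)"
    "s \<epsilon> crec (sat_step A) (fcode 3 i a) \<longleftrightarrow>
      (\<forall>t. is_fun_into E t omega A \<and> is_variant E i s t \<longrightarrow> t \<epsilon> crec (sat_step A) a)"
  unfolding crec_def[of _ "fcode k c d" for k c d] mem_sat_step using assms
  by (simp_all add: cv_below_fcode[OF dterm_sat_step])

text \<open>The recursion runs inside the structure and so covers nonstandard codes as well; this
  lets \<open>truth\<close> range over all of \<open>Formulas\<close>.\<close>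

lemma ex_satisfaction: "\<exists>S. is_satisfaction E omega Formulas A S"
proof -
  define S where "S = class_set (\<lambda>p. \<exists>c s. p = opair c s \<and> c \<epsilon> Formulas \<and> s \<epsilon> crec (sat_step A) c)"
  have "p \<epsilon> S \<longleftrightarrow> (\<exists>c s. p = opair c s \<and> c \<epsilon> Formulas \<and> s \<epsilon> crec (sat_step A) c)" for p
    unfolding S_def
  proof (rule mem_class_set[of _ "product Formulas (pow (product omega A))"])
    show "dpred UNIV (\<lambda>s. \<exists>c t. s 0 = opair c t \<and> c \<epsilon> Formulas \<and> t \<epsilon> crec (sat_step A) c)"
      by (intro dfn dterm_crec[OF dterm_sat_step])
    fix p assume "\<exists>c s. p = opair c s \<and> c \<epsilon> Formulas \<and> s \<epsilon> crec (sat_step A) c"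
    then obtain c s where "p = opair c s" "c \<epsilon> Formulas" "s \<epsilon> crec (sat_step A) c" by blast
    then show "p \<epsilon> product Formulas (pow (product omega A))" unfolding crec_def mem_sat_step using fun_into_pow by simp
  qed
  then have S: "opair c s \<epsilon> S \<longleftrightarrow> c \<epsilon> Formulas \<and> s \<epsilon> crec (sat_step A) c" for c s by simp
  have "is_satisfaction E omega Formulas A S"
    unfolding is_satisfaction_def is_app_iff is_code_iff
    by (intro allI impI conjI; elim conjE; hypsubst; unfold S) (simp_all add: Formulas_intros mem_crec_sat_step del: One_nat_def)
  then show ?thesis by blast
qed

lemma is_satisfactionD:
  assumes "is_satisfaction E omega Formulas A S" "is_fun_into E s omega A"
  shows "i \<epsilon> omega \<Longrightarrow> j \<epsilon> omega \<Longrightarrow> opair (fcode 0 i j) s \<epsilon> S \<longleftrightarrow> (\<exists>x y. opair i x \<epsilon> s \<and> opair j y \<epsilon> s \<and> x \<epsilon> y)"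
    "i \<epsilon> omega \<Longrightarrow> j \<epsilon> omega \<Longrightarrow> opair (fcode 1 i j) s \<epsilon> S \<longleftrightarrow> (\<exists>x y. opair i x \<epsilon> s \<and> opair j y \<epsilon> s \<and> x = y)"
    "a \<epsilon> Formulas \<Longrightarrow> b \<epsilon> Formulas \<Longrightarrow> opair (fcode 2 a b) s \<epsilon> S \<longleftrightarrow> \<not> (opair a s \<epsilon> S \<and> opair b s \<epsilon> S)"
    "i \<epsilon> omega \<Longrightarrow> a \<epsilon> Formulas \<Longrightarrow> opair (fcode 3 i a) s \<epsilon> S \<longleftrightarrow>
      (\<forall>t. is_fun_into E t omega A \<and> is_variant E i s t \<longrightarrow> opair a t \<epsilon> S)"
  using assms unfolding is_satisfaction_def is_app_iff is_code_iff by (simp_all del: One_nat_def)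

lemma ex_variant:
  assumes s: "is_fun_into E s d A" and i: "i \<epsilon> d" and a: "a \<epsilon> A"
  shows "\<exists>t. is_fun_into E t d A \<and> is_variant E i s t \<and> opair i a \<epsilon> t"
proof -
  define t where "t = cup (sep s (\<lambda>p. \<not> (\<exists>y. p = opair i y))) (upair (opair i a) (opair i a))"
  have "p \<epsilon> sep s (\<lambda>p. \<not> (\<exists>y. p = opair i y)) \<longleftrightarrow> p \<epsilon> s \<and> \<not> (\<exists>y. p = opair i y)" for p
    by (rule mem_sep) (intro dfn)
  then have mt: "p \<epsilon> t \<longleftrightarrow> p \<epsilon> s \<and> \<not> (\<exists>y. p = opair i y) \<or> p = opair i a" for p
    unfolding t_def by simp
  then have t: "opair j y \<epsilon> t \<longleftrightarrow> (if j = i then y = a else opair j y \<epsilon> s)" for j y by auto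
  have "is_fun_into E t d A" unfolding is_fun_into_iff is_fun_iff
  proof (intro conjI allI impI)
    show "\<exists>x y. x \<epsilon> d \<and> p = opair x y" if "p \<epsilon> t" for p
      using that i s unfolding is_fun_into_iff is_fun_iff mt by blast
    show "\<exists>y. \<forall>z. opair x z \<epsilon> t \<longleftrightarrow> z = y" if "x \<epsilon> d" for x
      using that i s unfolding is_fun_into_iff is_fun_iff t by (cases "x = i") auto
    show "y \<epsilon> A" if "opair x y \<epsilon> t" for x y
      using that a s unfolding is_fun_into_iff t by (cases "x = i") auto
  qed
  moreover have "is_variant E i s t" unfolding is_variant_def by (simp add: t)
  ultimately show ?thesis using t by (intro exI[of _ t]) simp
qed

text \<open>De Bruijn formulas become formulas with named variables: \<open>r\<close> gives the names of the free
  variables and \<open>k\<close> is a name larger than all of them.\<close>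

primrec code :: "nat \<Rightarrow> (nat \<Rightarrow> nat) \<Rightarrow> fm \<Rightarrow> 'a" where
  "code k r (x \<^bold>\<in> y) = fcode 0 (num (r x)) (num (r y))"
| "code k r (x \<^bold>= y) = fcode 1 (num (r x)) (num (r y))"
| "code k r (Nand p q) = fcode 2 (code k r p) (code k r q)"
| "code k r (\<^bold>\<forall>p) = fcode 3 (num k) (code (Suc k) (case_nat k r) p)"

lemma code_Formulas: "code k r p \<epsilon> Formulas"
  by (induction p arbitrary: k r) (simp_all only: code.simps Formulas_intros num_omega)

text \<open>A middle term, evaluated in the metatheory: \<open>satisfaction_code\<close> compares it
  with internal satisfaction, \<open>reflection\<close> with truth in the whole structure.\<close>

primrec satr :: "'a \<Rightarrow> fm \<Rightarrow> (nat \<Rightarrow> 'a) \<Rightarrow> bool" where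
  "satr A (x \<^bold>\<in> y) s \<longleftrightarrow> s x \<epsilon> s y"
| "satr A (x \<^bold>= y) s \<longleftrightarrow> s x = s y"
| "satr A (Nand p q) s \<longleftrightarrow> \<not> (satr A p s \<and> satr A q s)"
| "satr A (\<^bold>\<forall>p) s \<longleftrightarrow> (\<forall>a. a \<epsilon> A \<longrightarrow> satr A p (case_nat a s))"

text \<open>The bound on \<open>r\<close> makes the name \<open>k\<close> fresh, so a change of the
  internal assignment at \<open>k\<close> leaves the values of all free variables intact.\<close>

lemma satisfaction_code:
  assumes S: "is_satisfaction E omega Formulas A S"
  shows "is_fun_into E s omega A \<Longrightarrow> (\<And>n. r n < k) \<Longrightarrow> (\<And>n. opair (num (r n)) (e n) \<epsilon> s) \<Longrightarrow>
    opair (code k r p) s \<epsilon> S \<longleftrightarrow> satr A p e"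
proof (induction p arbitrary: k r s e)
  case (Member x y)
  show ?case using Member fun_unique[OF Member(1)] num_omega
    by (simp only: code.simps satr.simps is_satisfactionD(1)[OF S Member(1)]) blast
next
  case (Equal x y)
  show ?case using Equal fun_unique[OF Equal(1)] num_omega
    by (simp only: code.simps satr.simps is_satisfactionD(2)[OF S Equal(1)]) blast
next
  case (Nand p q)
  show ?case
    by (simp only: code.simps satr.simps is_satisfactionD(3)[OF S Nand.prems(1)] code_Formulas
        Nand.IH(1)[OF Nand.prems] Nand.IH(2)[OF Nand.prems])
next
  case (Forall p)
  note s = Forall.prems
  have IH: "opair (code (Suc k) (case_nat k r) p) t \<epsilon> S \<longleftrightarrow> satr A p (case_nat a e)"
    if t: "is_fun_into E t omega A" "is_variant E (num k) s t" "opair (num k) a \<epsilon> t" for t a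
  proof (rule Forall.IH[OF t(1)])
    show "case_nat k r n < Suc k" for n using s(2) by (auto split: nat.split simp: less_Suc_eq)
    show "opair (num (case_nat k r n)) (case_nat a e n) \<epsilon> t" for n
    proof (cases n)
      case (Suc m)
      have "r m \<noteq> k" using s(2)[of m] by simp
      then show ?thesis using Suc s(3)[of m] t(2) by (simp add: is_variant_def)
    qed (use t in simp)
  qed
  \<comment> \<open>Variants at \<open>k\<close> and elements of \<open>A\<close> match: each
    variant has a value at \<open>k\<close>, and each element is the value of some variant.\<close>
  have "(\<forall>t. is_fun_into E t omega A \<and> is_variant E (num k) s t \<longrightarrow> opair (code (Suc k) (case_nat k r) p) t \<epsilon> S) \<longleftrightarrow>
    (\<forall>a. a \<epsilon> A \<longrightarrow> satr A p (case_nat a e))"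
    using IH ex_variant[OF s(1) num_omega] fun_value[OF _ num_omega] by meson
  then show ?case by (simp only: code.simps satr.simps is_satisfactionD(4)[OF S s(1) num_omega code_Formulas])
qed

section \<open>Reflection\<close>

lemma tms_var: "(\<lambda>s. s n) \<in> tms C" and tms_const: "a \<in> C \<Longrightarrow> (\<lambda>s. a) \<in> tms C"
  by (auto simp: tms_def)

lemma dpred_tms:
  assumes "dpred C P" "\<And>n. u n \<in> tms C"
  shows "dpred C (\<lambda>s. P (\<lambda>n. u n s))"
proof -
  obtain p t where p: "\<forall>n. t n \<in> tms C" "\<And>s. P s \<longleftrightarrow> sat E p (\<lambda>n. t n s)" using assms(1) by (auto simp: dpred_def)
  have "\<forall>n. (\<lambda>s. t n (\<lambda>m. u m s)) \<in> tms C"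
  proof
    fix n
    have "(\<exists>m. t n = (\<lambda>s. s m)) \<or> (\<exists>a\<in>C. t n = (\<lambda>s. a))" using p(1)[rule_format, of n] by (auto simp: tms_def)
    then show "(\<lambda>s. t n (\<lambda>m. u m s)) \<in> tms C" using assms(2) tms_const by (elim disjE exE bexE) simp_all
  qed
  with p(2) show ?thesis unfolding dpred_def
    by (intro exI[of _ p] exI[of _ "\<lambda>n s. t n (\<lambda>m. u m s)"]) auto
qed

lemma dpred_cong: "dpred C P \<Longrightarrow> (\<And>s. P s \<longleftrightarrow> Q s) \<Longrightarrow> dpred C Q"
  unfolding dpred_def by simp

lemma dpred_upd:
  assumes "dpred C P"
  shows "dpred C (\<lambda>s. \<forall>x. x \<epsilon> s N \<longrightarrow> P (s(k := x)))"
proof -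
  have eq: "(\<lambda>n. s (if n = k then 0 else Suc n)) = (\<lambda>n. s (Suc n))(k := s 0)" for s :: "nat \<Rightarrow> 'a"
    by auto
  have "dpred C (\<lambda>s. P ((\<lambda>n. s (Suc n))(k := s 0)))"
    using dpred_ren[OF assms, of "\<lambda>n. if n = k then 0 else Suc n"] unfolding eq .
  then show ?thesis by (intro dfn)
qed

text \<open>Finite tuples are assignments \<open>e\<close> whose first \<open>k\<close> values range over the set \<open>s N\<close> and whose other
  values are fixed by \<open>s\<close>. Quantification over them is definable by induction on \<open>k\<close>, without
  coding tuples inside the model.\<close>

definition tuple :: "nat \<Rightarrow> nat \<Rightarrow> (nat \<Rightarrow> 'a) \<Rightarrow> (nat \<Rightarrow> 'a) \<Rightarrow> bool"
  where "tuple N k s e \<longleftrightarrow> (\<forall>i<k. e i \<epsilon> s N) \<and> (\<forall>i\<ge>k. e i = s (min i N))"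

lemma tuple_0: "tuple N 0 s e \<longleftrightarrow> e = (\<lambda>i. s (min i N))"
  unfolding tuple_def by auto

lemma tuple_Suc:
  assumes "k < N"
  shows "tuple N (Suc k) s e \<longleftrightarrow> e k \<epsilon> s N \<and> tuple N k (s(k := e k)) e"
proof -
  have "min i N \<noteq> k" if "i \<noteq> k" for i using that assms by (simp add: min_def)
  then have "e i = (s(k := e k)) (min i N) \<longleftrightarrow> i = k \<or> e i = s (min i N)" for i
    using assms by (cases "i = k") (simp_all add: min_def)
  moreover have "k \<le> i \<longleftrightarrow> i = k \<or> Suc k \<le> i" for i by linarith
  ultimately have "(\<forall>i\<ge>k. e i = (s(k := e k)) (min i N)) \<longleftrightarrow> (\<forall>i\<ge>Suc k. e i = s (min i N))"
    by (metis Suc_n_not_le_n)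
  moreover have "(s(k := e k)) N = s N" using assms by simp
  ultimately show ?thesis unfolding tuple_def less_Suc_eq by metis
qed

lemma all_tuple_Suc:
  assumes "k < N"
  shows "(\<forall>e. tuple N (Suc k) s e \<longrightarrow> Q e) \<longleftrightarrow> (\<forall>x. x \<epsilon> s N \<longrightarrow> (\<forall>e. tuple N k (s(k := x)) e \<longrightarrow> Q e))"
proof -
  have *: "e k = x" if "tuple N k (s(k := x)) e" for e x
  proof -
    have "e k = (s(k := x)) (min k N)" using that unfolding tuple_def by blast
    then show ?thesis using assms by simp
  qed
  show ?thesis unfolding tuple_Suc[OF assms] using * by metis
qed

text \<open>The cut-off \<open>min i N\<close> in \<open>tuple\<close> confines the assignment to
  \<open>s 0\<close>, ..., \<open>s N\<close>, so that \<open>s (Suc N)\<close> is free to carry the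
  other argument of \<open>Q\<close>.\<close>

lemma dpred_all_tuple:
  assumes Q: "dpred C (\<lambda>s. Q (\<lambda>i. s (Suc i)) (s 0))" and "k \<le> N"
  shows "dpred C (\<lambda>s. \<forall>e. tuple N k s e \<longrightarrow> Q e (s (Suc N)))"
  using assms(2)
proof (induction k)
  case 0
  have "dpred C (\<lambda>s. Q (\<lambda>i. s (min i N)) (s (Suc N)))"
    using dpred_ren[OF Q, of "case_nat (Suc N) (\<lambda>i. min i N)"] by simp
  then show ?case unfolding tuple_0 by simp
next
  case (Suc k)
  then have k: "k < N" by simp
  have "dpred C (\<lambda>s. \<forall>x. x \<epsilon> s N \<longrightarrow> (\<forall>e. tuple N k (s(k := x)) e \<longrightarrow> Q e ((s(k := x)) (Suc N))))"
    using Suc by (intro dpred_upd) simp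
  then show ?case unfolding all_tuple_Suc[OF k] using k by simp
qed

text \<open>One coordinate at a time: \<open>ord_collect\<close> bounds the ordinals obtained for
  the values of coordinate \<open>k\<close>, and monotonicity lifts all of them to the common
  bound.\<close>

lemma ex_ord_all_tuple:
  assumes Q: "dpred UNIV (\<lambda>s. Q (\<lambda>i. s (Suc i)) (s 0))" and "k \<le> N"
    and mono: "\<And>e a b. ord b \<Longrightarrow> a \<epsilon> b \<Longrightarrow> Q e a \<Longrightarrow> Q e b"
    and ex: "\<And>e. \<exists>a. ord a \<and> Q e a"
  shows "\<exists>a. ord a \<and> (\<forall>e. tuple N k s e \<longrightarrow> Q e a)"
  using assms(2)
proof (induction k arbitrary: s)
  case 0
  then show ?case using ex unfolding tuple_0 by simp
next
  case (Suc k)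
  then have k: "k < N" by simp
  let ?R = "\<lambda>x a. \<forall>e. tuple N k (s(k := x)) e \<longrightarrow> Q e a"
  have "\<exists>a. ord a \<and> (\<forall>x. x \<epsilon> s N \<longrightarrow> (\<exists>b. b \<epsilon> a \<and> ?R x b))"
  proof (rule ord_collect)
    \<comment> \<open>Only the coordinate \<open>k\<close> and the ordinal stay variable; the other
      entries of \<open>s\<close> become parameters.\<close>
    let ?u = "\<lambda>n t. if n = k then t 0 else if n = Suc N then t 1 else s n"
    have "?u n \<in> tms UNIV" for n by (cases "n = k"; cases "n = Suc N") (simp_all add: tms_var tms_const)
    from dpred_tms[OF dpred_all_tuple[OF Q, of k N], of ?u, OF _ this] k
    have Du: "dpred UNIV (\<lambda>t. \<forall>e. tuple N k (\<lambda>n. ?u n t) e \<longrightarrow> Q e (t 1))" by simp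
    have tup: "tuple N k (\<lambda>n. ?u n t) e \<longleftrightarrow> tuple N k (s(k := t 0)) e" for t e
      unfolding tuple_def using k by (auto simp: min_def)
    show "dpred UNIV (\<lambda>t. \<forall>e. tuple N k (s(k := t 0)) e \<longrightarrow> Q e (t 1))"
      using Du by (rule dpred_cong) (simp only: tup)
    show "\<exists>a. ord a \<and> ?R x a" if "x \<epsilon> s N" for x using Suc.IH k by simp
  qed
  then obtain a where "ord a" "\<forall>x. x \<epsilon> s N \<longrightarrow> (\<exists>b. b \<epsilon> a \<and> ?R x b)" by blast
  then have "\<forall>x. x \<epsilon> s N \<longrightarrow> ?R x a" using mono by blast
  with \<open>ord a\<close> show ?case unfolding all_tuple_Suc[OF k] by blast
qed

text \<open>\<open>B\<close> contains a counterexample to each universal subformula of \<open>p\<close> which fails under an assignment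
  with values in \<open>A\<close>. The variables from \<open>N\<close> on do not occur and get the dummy value \<open>A\<close>.\<close>

primrec witnessed :: "nat \<Rightarrow> fm \<Rightarrow> 'a \<Rightarrow> 'a \<Rightarrow> bool" where
  "witnessed N (x \<^bold>\<in> y) A B \<longleftrightarrow> True"
| "witnessed N (x \<^bold>= y) A B \<longleftrightarrow> True"
| "witnessed N (Nand p q) A B \<longleftrightarrow> witnessed N p A B \<and> witnessed N q A B"
| "witnessed N (\<^bold>\<forall>p) A B \<longleftrightarrow> witnessed N p A B \<and> (\<forall>e. tuple N N (\<lambda>_. A) e \<longrightarrow>
    (\<exists>a. \<not> sat E p (case_nat a e)) \<longrightarrow> (\<exists>a. a \<epsilon> B \<and> \<not> sat E p (case_nat a e)))"

lemma dpred_witnessed_body: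
  "dpred C (\<lambda>s. (\<exists>a. \<not> sat E p (case_nat a (\<lambda>i. s (Suc i)))) \<longrightarrow> (\<exists>a. a \<epsilon> s 0 \<and> \<not> sat E p (case_nat a (\<lambda>i. s (Suc i)))))"
proof -
  have "(\<lambda>n. s (case n of 0 \<Rightarrow> 0 | Suc i \<Rightarrow> Suc (Suc i))) = case_nat (s 0) (\<lambda>i. s (Suc (Suc i)))" for s :: "nat \<Rightarrow> 'a"
    by (auto split: nat.split)
  then have "dpred C (\<lambda>s. sat E p (case_nat (s 0) (\<lambda>i. s (Suc (Suc i)))))"
    using dpred_sat[of C p "case_nat 0 (\<lambda>i. Suc (Suc i))"] by simp
  then show ?thesis by (intro dfn)
qed

lemma dpred_witnessed_vars: "dpred C (\<lambda>s. witnessed N p (s 0) (s 1))"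
proof (induction p)
  case (Forall p)
  let ?Q = "\<lambda>e B. (\<exists>a. \<not> sat E p (case_nat a e)) \<longrightarrow> (\<exists>a. a \<epsilon> B \<and> \<not> sat E p (case_nat a e))"
  have "dpred C (\<lambda>s. \<forall>e. tuple N N s e \<longrightarrow> ?Q e (s (Suc N)))"
    by (rule dpred_all_tuple) (rule dpred_witnessed_body, simp)
  \<comment> \<open>The slot \<open>Suc N\<close> becomes \<open>B\<close> and all others become
    \<open>A\<close>.\<close>
  from dpred_ren[OF this, of "\<lambda>i. if i = Suc N then 1 else 0"]
  have "dpred C (\<lambda>s. \<forall>e. tuple N N (\<lambda>i. s (if i = Suc N then 1 else 0)) e \<longrightarrow> ?Q e (s 1))" by simp
  then have "dpred C (\<lambda>s. \<forall>e. tuple N N (\<lambda>_. s 0) e \<longrightarrow> ?Q e (s 1))"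
  proof (rule dpred_cong)
    fix s :: "nat \<Rightarrow> 'a"
    have "min i N \<noteq> Suc N" for i by (simp add: min_def)
    then have "tuple N N (\<lambda>i. s (if i = Suc N then 1 else 0)) = tuple N N (\<lambda>_. s 0)"
      by (simp add: tuple_def fun_eq_iff)
    then show "(\<forall>e. tuple N N (\<lambda>i. s (if i = Suc N then 1 else 0)) e \<longrightarrow> ?Q e (s 1)) \<longleftrightarrow>
        (\<forall>e. tuple N N (\<lambda>_. s 0) e \<longrightarrow> ?Q e (s 1))" by (simp only:)
  qed
  from dpred_conj[OF Forall this] show ?case by simp
qed (simp_all add: dpred_True dpred_conj)

lemma dpred_witnessed [dfn]: "dterm C t \<Longrightarrow> dterm C u \<Longrightarrow> dpred C (\<lambda>s. witnessed N p (t s) (u s))"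
  by (rule dpred_sub2[OF dpred_witnessed_vars])

lemma witnessed_mono: "is_subset E B B' \<Longrightarrow> witnessed N p A B \<Longrightarrow> witnessed N p A B'"
  by (induction p) (simp_all add: is_subset_def, blast)

lemma ord_upper:
  assumes "ord a" "ord b"
  shows "\<exists>c. ord c \<and> a \<epsilon> c \<and> b \<epsilon> c"
proof -
  have "a \<epsilon> suc b \<and> b \<epsilon> suc b \<or> a \<epsilon> suc a \<and> b \<epsilon> suc a" using ord_linear[OF assms] by auto
  then show ?thesis using assms ord_suc by blast
qed

lemma V_subset: "a \<epsilon> b \<Longrightarrow> is_subset E (V a) (V b)"
  unfolding is_subset_def using V_mem_mono by blast

text \<open>Each tuple that admits a counterexample has one in some level, and
  \<open>ex_ord_all_tuple\<close> bounds these levels over all tuples from \<open>A\<close>; levels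
  for different subformulas are merged by going up.\<close>

lemma ex_witnessed: "\<exists>a. ord a \<and> witnessed N p A (V a)"
proof (induction p)
  case (Nand p q)
  then obtain a b where ab: "ord a" "witnessed N p A (V a)" "ord b" "witnessed N q A (V b)" by blast
  then obtain c where "ord c" "a \<epsilon> c" "b \<epsilon> c" using ord_upper by blast
  with ab show ?case using witnessed_mono[OF V_subset] by auto
next
  case (Forall p)
  let ?Q = "\<lambda>e a. (\<exists>x. \<not> sat E p (case_nat x e)) \<longrightarrow> (\<exists>x. x \<epsilon> V a \<and> \<not> sat E p (case_nat x e))"
  have "\<exists>a. ord a \<and> (\<forall>e. tuple N N (\<lambda>_. A) e \<longrightarrow> ?Q e a)"
  proof (rule ex_ord_all_tuple)
    show "dpred UNIV (\<lambda>s. ?Q (\<lambda>i. s (Suc i)) (s 0))"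
    proof -
      have "(\<lambda>n. s (case n of 0 \<Rightarrow> 0 | Suc i \<Rightarrow> Suc (Suc i))) = case_nat (s 0) (\<lambda>i. s (Suc (Suc i)))" for s :: "nat \<Rightarrow> 'a"
        by (auto split: nat.split)
      then have "dpred UNIV (\<lambda>s. sat E p (case_nat (s 0) (\<lambda>i. s (Suc (Suc i)))))"
        using dpred_sat[of UNIV p "case_nat 0 (\<lambda>i. Suc (Suc i))"] by simp
      then show ?thesis by (intro dfn)
    qed
    show "?Q e b" if "ord b" "a \<epsilon> b" "?Q e a" for e a b using that V_mem_mono by blast
    show "\<exists>a. ord a \<and> ?Q e a" for e using ex_V by blast
  qed simp
  then obtain a where a: "ord a" "\<forall>e. tuple N N (\<lambda>_. A) e \<longrightarrow> ?Q e a" by blast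
  from Forall obtain b where b: "ord b" "witnessed N p A (V b)" by blast
  obtain c where c: "ord c" "a \<epsilon> c" "b \<epsilon> c" using ord_upper a(1) b(1) by blast
  have "witnessed N p A (V c)" using witnessed_mono[OF V_subset] b c by blast
  moreover have "\<forall>e. tuple N N (\<lambda>_. A) e \<longrightarrow> ?Q e c" using a(2) V_mem_mono[OF c(2)] by blast
  ultimately show ?case using c(1) by auto
qed (use ord_omega in auto)

text \<open>The supremum of \<omega> ordinals, each above the previous ones and with witnesses for
  tuples from their levels. Taking least ordinals at each step turns this into a recursion without
  choice.\<close>

lemma ex_closure_point:
  assumes a: "ord a"
  shows "\<exists>th. ord th \<and> a \<epsilon> th \<and> (\<forall>b. b \<epsilon> th \<longrightarrow>
    (\<exists>c d. c \<epsilon> th \<and> d \<epsilon> th \<and> b \<epsilon> c \<and> witnessed N p (V c) (V d)))"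
proof -
  define R where "R u b \<longleftrightarrow> u \<epsilon> b \<and> witnessed N p (V u) (V b)" for u b
  have DR: "dpred UNIV (\<lambda>s. R (t s) (u s))" if "dterm UNIV t" "dterm UNIV u" for t u
    unfolding R_def by (intro dfn that)
  have R_mono: "R u c" if "R u b" "b \<epsilon> c" "ord c" for u b c
    using that witnessed_mono[OF V_subset] transitiveD[OF ord_transitive] unfolding R_def by blast
  \<comment> \<open>The condition on the next ordinal, with \<open>rng g\<close> as the set of
    earlier values.\<close>
  define G where "G g b \<longleftrightarrow> a \<epsilon> b \<and> (\<forall>u. u \<epsilon> rng g \<longrightarrow> R u b)" for g b
  define H where "H x g = least_ord (G g)" for x g :: 'a
  have H: "dterm UNIV (\<lambda>s. H (s 0) (s 1))" unfolding H_def G_def by (intro dfn DR)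
  have dH: "dterm UNIV (\<lambda>s. rec H (s 0))" by (rule dterm_rec_UNIV[OF H])
  have f: "ord (rec H n) \<and> a \<epsilon> rec H n \<and> (\<forall>m. m \<epsilon> n \<longrightarrow> R (rec H m) (rec H n))" if "ord n" for n
  proof (rule ord_induct[OF _ that, where P="\<lambda>n. ord (rec H n) \<and> a \<epsilon> rec H n \<and> (\<forall>m. m \<epsilon> n \<longrightarrow> R (rec H m) (rec H n))"])
    show "dpred UNIV (\<lambda>s. ord (rec H (s 0)) \<and> a \<epsilon> rec H (s 0) \<and> (\<forall>m. m \<epsilon> s 0 \<longrightarrow> R (rec H m) (rec H (s 0))))"
      by (intro dfn DR dterm_rec[OF H])
    fix n assume "ord n" and IH: "\<And>m. m \<epsilon> n \<Longrightarrow> ord (rec H m) \<and> a \<epsilon> rec H m \<and> (\<forall>k. k \<epsilon> m \<longrightarrow> R (rec H k) (rec H m))"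
    let ?g = "graph_on (rec H) n"
    have g: "u \<epsilon> rng ?g \<longleftrightarrow> (\<exists>m. m \<epsilon> n \<and> u = rec H m)" for u by (rule mem_rng_graph_on[OF dH])
    have "\<exists>b. ord b \<and> (\<forall>u. u \<epsilon> rng ?g \<longrightarrow> (\<exists>c. c \<epsilon> b \<and> R u c))"
    proof (rule ord_collect)
      show "dpred UNIV (\<lambda>s. R (s 0) (s 1))" by (intro dfn DR)
      fix u assume "u \<epsilon> rng ?g"
      then obtain m where "m \<epsilon> n" "u = rec H m" using g by blast
      then have u: "ord u" using IH by simp
      obtain b where b: "ord b" "witnessed N p (V u) (V b)" using ex_witnessed by blast
      obtain c where "ord c" "u \<epsilon> c" "b \<epsilon> c" using ord_upper[OF u b(1)] by blast
      then show "\<exists>b. ord b \<and> R u b" unfolding R_def using witnessed_mono[OF V_subset] b by blast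
    qed
    then obtain b where b: "ord b" "\<forall>u. u \<epsilon> rng ?g \<longrightarrow> (\<exists>c. c \<epsilon> b \<and> R u c)" by blast
    obtain c where c: "ord c" "b \<epsilon> c" "a \<epsilon> c" using ord_upper[OF b(1) a] by blast
    have "R u c" if "u \<epsilon> rng ?g" for u
      using b that c R_mono by blast
    then have "G ?g c" unfolding G_def using c by blast
    moreover have "dpred UNIV (\<lambda>s. G ?g (s 0))" unfolding G_def by (intro dfn DR)
    ultimately have "ord (least_ord (G ?g))" "G ?g (least_ord (G ?g))" using least_ord c(1) by blast+
    moreover have "rec H n = least_ord (G ?g)" using rec_eq[OF H, of n] H_def[of n ?g] by (rule trans)
    ultimately have "ord (rec H n)" "G ?g (rec H n)" by simp_all
    then show "ord (rec H n) \<and> a \<epsilon> rec H n \<and> (\<forall>m. m \<epsilon> n \<longrightarrow> R (rec H m) (rec H n))"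
      unfolding G_def g by blast
  qed
  define th where "th = sUnion (rng (graph_on (rec H) omega))"
  have th: "b \<epsilon> th \<longleftrightarrow> (\<exists>n. n \<epsilon> omega \<and> b \<epsilon> rec H n)" for b
    unfolding th_def mem_sUnion mem_rng_graph_on[OF dH] by blast
  have omega: "ord n" if "n \<epsilon> omega" for n using that ord_omega ord_mem by blast
  have "ord th" unfolding th_def
    by (rule ord_sUnion) (unfold mem_rng_graph_on[OF dH], use f omega in blast)
  moreover have "a \<epsilon> th" unfolding th using f[OF omega[OF emp_omega]] emp_omega by blast
  moreover have "\<exists>c d. c \<epsilon> th \<and> d \<epsilon> th \<and> b \<epsilon> c \<and> witnessed N p (V c) (V d)" if b: "b \<epsilon> th" for b
  proof -
    from b obtain n where n: "n \<epsilon> omega" "b \<epsilon> rec H n" unfolding th by blast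
    have R: "R (rec H m) (rec H (suc m))" if "m \<epsilon> omega" for m
      using f[OF omega[OF suc_omega[OF that]]] by simp
    have "rec H m \<epsilon> th" if "m \<epsilon> omega" for m unfolding th using R[OF that] suc_omega[OF that] unfolding R_def by blast
    then show ?thesis using n R[OF n(1)] suc_omega unfolding R_def by blast
  qed
  ultimately show ?thesis by blast
qed

text \<open>The bound is not lowered or raised under a binder: \<open>witnessed\<close> uses one
  \<open>N\<close> for all subformulas.\<close>

primrec vars_below :: "nat \<Rightarrow> fm \<Rightarrow> bool" where
  "vars_below N (x \<^bold>\<in> y) \<longleftrightarrow> x < N \<and> y < N"
| "vars_below N (x \<^bold>= y) \<longleftrightarrow> x < N \<and> y < N"
| "vars_below N (Nand p q) \<longleftrightarrow> vars_below N p \<and> vars_below N q"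
| "vars_below N (\<^bold>\<forall>p) \<longleftrightarrow> vars_below N p"

lemma vars_below_mono: "vars_below N p \<Longrightarrow> N \<le> M \<Longrightarrow> vars_below M p"
  by (induction p) auto

lemma ex_vars_below: "\<exists>N. vars_below N p"
proof (induction p)
  case (Member x y)
  show ?case by (rule exI[of _ "Suc (max x y)"]) auto
next
  case (Equal x y)
  show ?case by (rule exI[of _ "Suc (max x y)"]) auto
next
  case (Nand p q)
  then obtain M N where "vars_below M p" "vars_below N q" by blast
  then show ?case using vars_below_mono[of _ _ "max M N"] by (intro exI[of _ "max M N"]) simp
qed simp

lemma sat_cong: "vars_below N p \<Longrightarrow> (\<And>n. n < N \<Longrightarrow> s n = t n) \<Longrightarrow> sat E p s \<longleftrightarrow> sat E p t"
proof (induction p arbitrary: s t)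
  case (Forall p)
  have "sat E p (case_nat a s) \<longleftrightarrow> sat E p (case_nat a t)" for a
    by (rule Forall.IH) (use Forall.prems in \<open>auto split: nat.split\<close>)
  then show ?case by simp
next
  case (Nand p q)
  have "sat E p s \<longleftrightarrow> sat E p t" by (rule Nand.IH(1)) (use Nand.prems in auto)
  moreover have "sat E q s \<longleftrightarrow> sat E q t" by (rule Nand.IH(2)) (use Nand.prems in auto)
  ultimately show ?case by simp
qed simp_all

text \<open>The Tarski-Vaught criterion: only the universal case needs the closure property, which
  places a counterexample in \<open>V th\<close> whenever there is one at all.\<close>

lemma reflection_closure_point:
  assumes th: "ord th" "b \<epsilon> th"
    and cl: "\<forall>b. b \<epsilon> th \<longrightarrow> (\<exists>c d. c \<epsilon> th \<and> d \<epsilon> th \<and> b \<epsilon> c \<and> witnessed N p (V c) (V d))"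
    and "vars_below N p" "\<And>i. e i \<epsilon> V th"
  shows "sat E p e \<longleftrightarrow> satr (V th) p e"
  using cl assms(4,5)
proof (induction p arbitrary: e)
  case (Nand p q)
  have "sat E p e \<longleftrightarrow> satr (V th) p e" using Nand.prems by (intro Nand.IH(1)) (simp_all, blast)
  moreover have "sat E q e \<longleftrightarrow> satr (V th) q e" using Nand.prems by (intro Nand.IH(2)) (simp_all, blast)
  ultimately show ?case by simp
next
  case (Forall p)
  have IH: "sat E p (case_nat a e) \<longleftrightarrow> satr (V th) p (case_nat a e)" if "a \<epsilon> V th" for a
    using Forall.prems that by (intro Forall.IH) (simp_all split: nat.split, blast)
  have "\<exists>a. a \<epsilon> V th \<and> \<not> sat E p (case_nat a e)" if ex: "\<exists>a. \<not> sat E p (case_nat a e)"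
  proof -
    \<comment> \<open>Finitely many values of \<open>e\<close> lie in one level below
      \<open>th\<close>; all values together need not.\<close>
    have "\<exists>b. b \<epsilon> th \<and> (\<forall>i<n. e i \<epsilon> V b)" for n
    proof (induction n)
      case 0
      then show ?case using th by blast
    next
      case (Suc n)
      then obtain b where b: "b \<epsilon> th" "\<forall>i<n. e i \<epsilon> V b" by blast
      from Forall.prems(3)[of n] obtain c where c: "c \<epsilon> th" "is_subset E (e n) (V c)" unfolding mem_V[of "e n"] by blast
      have o: "ord b" "ord c" using b c th ord_mem by blast+
      obtain m where m: "m \<epsilon> th" "b = m \<or> b \<epsilon> m" "c = m \<or> c \<epsilon> m" using ord_linear[OF o] b c by blast
      obtain d where d: "d \<epsilon> th" "m \<epsilon> d" using Forall.prems(1) m(1) by blast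
      have "ord d" using d th ord_mem by blast
      then have "b \<epsilon> d" "c \<epsilon> d" using m d transitiveD[OF ord_transitive, of d] by blast+
      then have "e i \<epsilon> V d" if "i < Suc n" for i
        using that b(2) c(2) V_mem_mono[of b d] mem_V[of "e n" d] by (auto simp: less_Suc_eq)
      with d show ?case by blast
    qed
    then obtain b where b: "b \<epsilon> th" "\<forall>i<N. e i \<epsilon> V b" by blast
    then obtain c d where c: "c \<epsilon> th" "d \<epsilon> th" "b \<epsilon> c" "witnessed N (\<^bold>\<forall>p) (V c) (V d)" using Forall.prems(1) by blast
    \<comment> \<open>\<open>witnessed\<close> speaks of tuples with the dummy value
      \<open>V c\<close> from \<open>N\<close> on; the change is invisible to \<open>p\<close>,
      whose variables are below \<open>N\<close>.\<close>
    define e' where "e' i = (if i < N then e i else V c)" for i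
    have "tuple N N (\<lambda>_. V c) e'" unfolding tuple_def e'_def using b(2) V_mem_mono[OF c(3)] by auto
    moreover have s: "sat E p (case_nat a e') \<longleftrightarrow> sat E p (case_nat a e)" for a
      by (rule sat_cong[of N]) (use Forall.prems in \<open>auto simp: e'_def split: nat.split\<close>)
    ultimately obtain a where "a \<epsilon> V d" "\<not> sat E p (case_nat a e)" using ex c(4) by auto
    then show ?thesis using V_mem_mono[OF c(2)] by blast
  qed
  then show ?case using IH by auto
qed simp_all

lemma reflection:
  assumes "ord a"
  shows "\<exists>th. ord th \<and> a \<epsilon> th \<and> (\<forall>e. (\<forall>i. e i \<epsilon> V th) \<longrightarrow> (sat E p e \<longleftrightarrow> satr (V th) p e))"
proof -
  obtain N where "vars_below N p" using ex_vars_below by blast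
  with ex_closure_point[OF assms, of N p] reflection_closure_point show ?thesis by metis
qed

section \<open>Definable choice of formula codes\<close>

text \<open>To choose from a set \<open>C\<close> of pairs: take the least level containing both components of a pair
  in \<open>C\<close>, choose a first component by recursion, then a matching second one.\<close>

definition "apply_fn k x = the1 (\<lambda>y. opair x y \<epsilon> k)"
definition "least_level C = least_ord (\<lambda>b. \<exists>u v. u \<epsilon> pair_level b \<and> v \<epsilon> pair_level b \<and> opair u v \<epsilon> C)"
definition "pick1 g C = apply_fn (apply_fn g (least_level C)) (sep (pair_level (least_level C)) (\<lambda>u. \<exists>v. v \<epsilon> pair_level (least_level C) \<and> opair u v \<epsilon> C))"
definition "pick2 g C = apply_fn (apply_fn g (least_level C)) (sep (pair_level (least_level C)) (\<lambda>v. opair (pick1 g C) v \<epsilon> C))"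
definition "pick g C = the1 (\<lambda>y. (\<exists>n. n \<epsilon> omega \<and> n \<epsilon> C) \<and> y = least_ord (\<lambda>n. n \<epsilon> omega \<and> n \<epsilon> C) \<or>
  \<not> (\<exists>n. n \<epsilon> omega \<and> n \<epsilon> C) \<and> y = opair (pick1 g C) (pick2 g C))"
definition "choose_level = rec (\<lambda>x g. repl (pow (pair_level x)) (\<lambda>C. opair C (pick g C)))"
definition "choose_code C = apply_fn (choose_level omega) C"

lemma dterm_apply_fn [dfn]: "dterm C t \<Longrightarrow> dterm C u \<Longrightarrow> dterm C (\<lambda>s. apply_fn (t s) (u s))"
  by (rule dterm_sub2) (unfold apply_fn_def, intro dfn)
lemma dterm_least_level [dfn]: "dterm C t \<Longrightarrow> dterm C (\<lambda>s. least_level (t s))"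
  by (rule dterm_sub1) (unfold least_level_def, intro dfn)
lemma dterm_pick1 [dfn]: "dterm C t \<Longrightarrow> dterm C u \<Longrightarrow> dterm C (\<lambda>s. pick1 (t s) (u s))"
  by (rule dterm_sub2) (unfold pick1_def, intro dfn)
lemma dterm_pick2 [dfn]: "dterm C t \<Longrightarrow> dterm C u \<Longrightarrow> dterm C (\<lambda>s. pick2 (t s) (u s))"
  by (rule dterm_sub2) (unfold pick2_def, intro dfn)
lemma dterm_pick [dfn]: "dterm C t \<Longrightarrow> dterm C u \<Longrightarrow> dterm C (\<lambda>s. pick (t s) (u s))"
  by (rule dterm_sub2) (unfold pick_def, intro dfn)
lemma dterm_choose_level [dfn]: "dterm C t \<Longrightarrow> dterm C (\<lambda>s. choose_level (t s))"
  unfolding choose_level_def by (rule dterm_rec) (intro dfn)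
lemma dterm_choose_code [dfn]: "dterm C t \<Longrightarrow> dterm C (\<lambda>s. choose_code (t s))"
  unfolding choose_code_def by (intro dfn)

lemma apply_fn_graph_on: "dterm UNIV (\<lambda>s. f (s 0)) \<Longrightarrow> x \<epsilon> d \<Longrightarrow> apply_fn (graph_on f d) x = f x"
  unfolding apply_fn_def by (rule the1_eq) (simp_all add: opair_mem_graph_on)

lemma choose_level_eq: "is_subset E C (pair_level x) \<Longrightarrow> apply_fn (choose_level x) C = pick (graph_on choose_level x) C"
proof -
  assume C: "is_subset E C (pair_level x)"
  have "choose_level x = repl (pow (pair_level x)) (\<lambda>C. opair C (pick (graph_on choose_level x) C))"
    unfolding choose_level_def by (rule rec_eq[of "\<lambda>x g. repl (pow (pair_level x)) (\<lambda>C. opair C (pick g C))"]) (intro dfn)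
  then have "choose_level x = graph_on (pick (graph_on choose_level x)) (pow (pair_level x))" unfolding graph_on_def[of "pick (graph_on choose_level x)"] .
  then have "apply_fn (choose_level x) C = apply_fn (graph_on (pick (graph_on choose_level x)) (pow (pair_level x))) C" by (rule arg_cong)
  also have "\<dots> = pick (graph_on choose_level x) C"
    by (rule apply_fn_graph_on) (use C in \<open>intro dfn | simp\<close>)+
  finally show ?thesis .
qed

text \<open>A member of \<open>C\<close> outside \<omega> is a pair of elements of an earlier stage,
  so \<open>least_level C\<close> is below \<open>x\<close> and the choice at that stage, correct by
  induction, can be used for both components.\<close>

lemma choose_level_mem:
  assumes "ord x"
  shows "\<forall>C. is_subset E C (pair_level x) \<and> C \<noteq> emp \<longrightarrow> apply_fn (choose_level x) C \<epsilon> C"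
proof (rule ord_induct[OF _ assms])
  show "dpred UNIV (\<lambda>s. \<forall>C. is_subset E C (pair_level (s 0)) \<and> C \<noteq> emp \<longrightarrow> apply_fn (choose_level (s 0)) C \<epsilon> C)" by (intro dfn)
  fix x assume x: "ord x" and IH: "\<And>y. y \<epsilon> x \<Longrightarrow> \<forall>C. is_subset E C (pair_level y) \<and> C \<noteq> emp \<longrightarrow> apply_fn (choose_level y) C \<epsilon> C"
  show "\<forall>C. is_subset E C (pair_level x) \<and> C \<noteq> emp \<longrightarrow> apply_fn (choose_level x) C \<epsilon> C"
  proof (intro allI impI; elim conjE)
    fix C assume C: "is_subset E C (pair_level x)" "C \<noteq> emp"
    let ?g = "graph_on choose_level x"
    have "pick ?g C \<epsilon> C"
    proof (cases "\<exists>n. n \<epsilon> omega \<and> n \<epsilon> C")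
      case True
      then obtain n where n: "n \<epsilon> omega \<and> n \<epsilon> C" "ord n" using ord_mem ord_omega by blast
      have "dpred UNIV (\<lambda>s. s 0 \<epsilon> omega \<and> s 0 \<epsilon> C)" by (intro dfn)
      from least_ord(2)[OF this n(2,1)] have "least_ord (\<lambda>n. n \<epsilon> omega \<and> n \<epsilon> C) \<epsilon> C" by blast
      moreover have "pick ?g C = least_ord (\<lambda>n. n \<epsilon> omega \<and> n \<epsilon> C)"
        unfolding pick_def by (rule the1_eq) (use True in blast)+
      ultimately show ?thesis by simp
    next
      case False
      have pick: "pick ?g C = opair (pick1 ?g C) (pick2 ?g C)"
        unfolding pick_def by (rule the1_eq) (use False in blast)+
      let ?P = "\<lambda>b. \<exists>u v. u \<epsilon> pair_level b \<and> v \<epsilon> pair_level b \<and> opair u v \<epsilon> C"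
      obtain p where p: "p \<epsilon> C" using C(2) set_ext[of C emp] by auto
      then have "p \<epsilon> pair_level x" "\<not> p \<epsilon> omega" using C(1) False by (auto simp: is_subset_def)
      then obtain b where b: "b \<epsilon> x" "?P b" using p unfolding mem_pair_level[of p x] by blast
      have ob: "ord b" using x b ord_mem by blast
      have DP: "dpred UNIV (\<lambda>s. ?P (s 0))" by (intro dfn)
      define l where "l = least_level C"
      have l: "ord l" "?P l" "\<And>y. y \<epsilon> l \<Longrightarrow> \<not> ?P y"
        unfolding l_def least_level_def using least_ord[OF DP ob b(2)] by blast+
      have "l = b \<or> l \<epsilon> b" using ord_linear[OF l(1) ob] l(3) b(2) by blast
      then have lx: "l \<epsilon> x" using b(1) x transitiveD[OF ord_transitive] by blast
      have g: "apply_fn ?g l = choose_level l" by (rule apply_fn_graph_on[OF _ lx]) (intro dfn)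
      define X where "X = sep (pair_level l) (\<lambda>u. \<exists>v. v \<epsilon> pair_level l \<and> opair u v \<epsilon> C)"
      have X: "u \<epsilon> X \<longleftrightarrow> u \<epsilon> pair_level l \<and> (\<exists>v. v \<epsilon> pair_level l \<and> opair u v \<epsilon> C)" for u
        unfolding X_def by (rule mem_sep) (intro dfn)
      have "is_subset E X (pair_level l)" "X \<noteq> emp" using X l(2) by (auto simp: is_subset_def)
      then have "apply_fn (choose_level l) X \<epsilon> X" using IH[OF lx] by blast
      then have 1: "pick1 ?g C \<epsilon> X" unfolding pick1_def l_def[symmetric] X_def[symmetric] g .
      define Y where "Y = sep (pair_level l) (\<lambda>v. opair (pick1 ?g C) v \<epsilon> C)"
      have Y: "v \<epsilon> Y \<longleftrightarrow> v \<epsilon> pair_level l \<and> opair (pick1 ?g C) v \<epsilon> C" for v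
        unfolding Y_def by (rule mem_sep) (intro dfn)
      have "is_subset E Y (pair_level l)" "Y \<noteq> emp" using Y 1[unfolded X] by (auto simp: is_subset_def)
      then have "apply_fn (choose_level l) Y \<epsilon> Y" using IH[OF lx] by blast
      then have "pick2 ?g C \<epsilon> Y" unfolding pick2_def l_def[symmetric] Y_def[symmetric] g .
      then show ?thesis unfolding pick Y by blast
    qed
    then show "apply_fn (choose_level x) C \<epsilon> C" using choose_level_eq[OF C(1)] by simp
  qed
qed

lemma choose_code_mem:
  assumes P: "dpred UNIV (\<lambda>s. P (s 0))" and "c \<epsilon> Formulas" "P c"
  shows "choose_code (sep Formulas P) \<epsilon> Formulas" "P (choose_code (sep Formulas P))"
proof -
  have m: "x \<epsilon> sep Formulas P \<longleftrightarrow> x \<epsilon> Formulas \<and> P x" for x by (rule mem_sep[OF P])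
  have "is_subset E (sep Formulas P) (pair_level omega)" using Formulas_pair_level by (simp add: is_subset_def m)
  moreover have "sep Formulas P \<noteq> emp" using m[of c] assms(2,3) by auto
  ultimately have "choose_code (sep Formulas P) \<epsilon> sep Formulas P" unfolding choose_code_def using choose_level_mem[OF ord_omega] by blast
  then show "choose_code (sep Formulas P) \<epsilon> Formulas" "P (choose_code (sep Formulas P))" by (simp_all add: m)
qed

section \<open>Truth in the levels of the hierarchy\<close>

text \<open>\<open>code0 p\<close> refers to every free variable of \<open>p\<close> by the name \<open>0\<close>, as \<open>defined_set\<close> evaluates \<open>p\<close> under
  constant assignments.\<close>

definition "const_asg x = product omega (upair x x)"
definition "truth th c x \<longleftrightarrow> (\<exists>S. is_satisfaction E omega Formulas (V th) S \<and> opair c (const_asg x) \<epsilon> S)"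
definition "code0 p = code 1 (\<lambda>_. 0) p"

lemma dpred_truth [dfn]: "dterm C t \<Longrightarrow> dterm C u \<Longrightarrow> dterm C v \<Longrightarrow> dpred C (\<lambda>s. truth (t s) (u s) (v s))"
  by (rule dpred_sub3) (unfold truth_def const_asg_def, intro dfn)

lemma const_asg_fun_into: "x \<epsilon> A \<Longrightarrow> is_fun_into E (const_asg x) omega A"
  unfolding is_fun_into_iff is_fun_iff const_asg_def mem_product by auto

lemma code0_Formulas: "code0 p \<epsilon> Formulas"
  by (simp add: code0_def code_Formulas)

text \<open>Stated for every assignment with value \<open>x\<close> at name 0 and not only for
  constant ones, because \<open>is_OD\<close> tests variants of a parameter sequence.\<close>

lemma satisfaction_code0:
  assumes "is_satisfaction E omega Formulas A S" "is_fun_into E t omega A" "opair emp x \<epsilon> t"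
  shows "opair (code0 p) t \<epsilon> S \<longleftrightarrow> satr A p (\<lambda>_. x)"
  unfolding code0_def by (rule satisfaction_code[OF assms(1,2)]) (use assms(3) in auto)

lemma truth_code0:
  assumes "x \<epsilon> V th"
  shows "truth th (code0 p) x \<longleftrightarrow> satr (V th) p (\<lambda>_. x)"
proof -
  have "opair emp x \<epsilon> const_asg x" by (simp add: const_asg_def)
  then show ?thesis unfolding truth_def
    using satisfaction_code0[OF _ const_asg_fun_into[OF assms]] ex_satisfaction by blast
qed

text \<open>Lets a definable element appear as a parameter-free constant in the \<open>dfn\<close>
  calculus.\<close>

lemma definable_iff: "definable_in E a \<longleftrightarrow> dterm {} (\<lambda>s. a)"
proof
  assume "definable_in E a"
  then obtain p where p: "{b. sat E p (\<lambda>_. b)} = {a}" by (auto simp: definable_in_def defined_set_def)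
  have "dpred {} (\<lambda>s. sat E p (\<lambda>_. s 0))" by (rule dpred_sat[of "{}" p "\<lambda>_. 0"])
  then show "dterm {} (\<lambda>s. a)" unfolding dterm_def by (rule dpred_cong) (use p in blast)
next
  assume "dterm {} (\<lambda>s. a)"
  then have "dpred {} (\<lambda>s. (\<lambda>x. x = a) (s 0))" unfolding dterm_def .
  then obtain p where "fv p \<subseteq> {0}" "\<And>s. sat E p s \<longleftrightarrow> s 0 = a" by (rule dpred_empty_unary[of "\<lambda>x. x = a"]) blast
  then show "definable_in E a" by (auto simp: definable_in_def defined_set_def)
qed

lemma algebraicD:
  assumes "algebraic_in E a"
  obtains P where "dpred {} (\<lambda>s. P (s 0))" "finite {b. P b}" "P a"
proof -
  obtain p where p: "finite {b. sat E p (\<lambda>_. b)}" "sat E p (\<lambda>_. a)"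
    using assms by (auto simp: algebraic_in_def defined_set_def)
  show thesis
    by (rule that[of "\<lambda>b. sat E p (\<lambda>_. b)"]) (use p dpred_sat[of "{}" p "\<lambda>_. 0"] in auto)
qed

lemma dpred_UNIV: "dpred {} P \<Longrightarrow> dpred UNIV P"
  unfolding dpred_def tms_def by blast

lemma unary_reflection:
  assumes "ord a"
  obtains th where "ord th" "a \<epsilon> th" "\<And>x. x \<epsilon> V th \<Longrightarrow> truth th (code0 p) x \<longleftrightarrow> sat E p (\<lambda>_. x)"
    "\<And>x. x \<epsilon> V th \<Longrightarrow> satr (V th) p (\<lambda>_. x) \<longleftrightarrow> sat E p (\<lambda>_. x)"
proof -
  obtain th where "ord th" "a \<epsilon> th" "\<forall>e. (\<forall>i. e i \<epsilon> V th) \<longrightarrow> (sat E p e \<longleftrightarrow> satr (V th) p e)"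
    using reflection[OF assms] by blast
  then show thesis by (intro that[of th]) (simp_all add: truth_code0)
qed

section \<open>Indistinguishability\<close>

definition "indist x y \<longleftrightarrow> (\<forall>th c. ord th \<and> c \<epsilon> Formulas \<longrightarrow> (truth th c x \<longleftrightarrow> truth th c y))"

lemma dpred_indist [dfn]: "dterm C t \<Longrightarrow> dterm C u \<Longrightarrow> dpred C (\<lambda>s. indist (t s) (u s))"
  by (rule dpred_sub2) (unfold indist_def, intro dfn)

lemma indist_dpred:
  assumes "indist x y" "dpred {} (\<lambda>s. P (s 0))"
  shows "P x \<longleftrightarrow> P y"
proof -
  obtain p where p: "\<And>s. sat E p s \<longleftrightarrow> P (s 0)" by (rule dpred_empty_unary[OF assms(2)]) blast
  \<comment> \<open>The level must contain both elements: outside \<open>V th\<close>,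
    \<open>truth th\<close> says nothing about \<open>p\<close>.\<close>
  obtain a b where ab: "ord a" "x \<epsilon> V a" "ord b" "y \<epsilon> V b" using ex_V by meson
  obtain c where c: "ord c" "a \<epsilon> c" "b \<epsilon> c" using ord_upper ab by blast
  obtain th where th: "ord th" "c \<epsilon> th" "\<And>x. x \<epsilon> V th \<Longrightarrow> truth th (code0 p) x \<longleftrightarrow> sat E p (\<lambda>_. x)"
    using unary_reflection[OF c(1)] by metis
  have "x \<epsilon> V th" "y \<epsilon> V th" using ab c th(2) V_mem_mono by blast+
  then show ?thesis using th(3) assms(1) th(1) code0_Formulas unfolding indist_def p by blast
qed

text \<open>The selected pair need not separate \<open>z\<close> from \<open>y\<close>. It splits
  the class somewhere, so the piece containing \<open>z\<close> is smaller in either case, and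
  induction on the cardinality applies to it.\<close>

lemma finite_distinguished_definable:
  assumes "finite {z. P z}" "dpred {} (\<lambda>s. P (s 0))"
    and "\<And>z z'. P z \<Longrightarrow> P z' \<Longrightarrow> indist z z' \<Longrightarrow> z = z'" and "P z"
  shows "definable_in E z"
  using assms
proof (induction "card {z. P z}" arbitrary: P rule: less_induct)
  case less
  note fin = less.prems(1) and P = less.prems(2) and dist = less.prems(3) and z = less.prems(4)
  have DP: "dpred {} (\<lambda>s. P (t s))" if "dterm {} t" for t by (rule dpred_sub1[OF P that])
  show ?case
  proof (cases "\<forall>y. P y \<longrightarrow> y = z")
    case True
    have "dpred {} (\<lambda>s. s 0 = z)" using P by (rule dpred_cong) (use True z in blast)
    then show ?thesis unfolding definable_iff dterm_def .
  next
    case False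
    then obtain y where "P y" "y \<noteq> z" by blast
    then have "\<not> indist z y" using dist z by blast
    then obtain t0 c0 where tc: "ord t0" "c0 \<epsilon> Formulas" "\<not> (truth t0 c0 z \<longleftrightarrow> truth t0 c0 y)"
      unfolding indist_def by blast
    define sp where "sp th c \<longleftrightarrow> (\<exists>u v. P u \<and> P v \<and> truth th c u \<and> \<not> truth th c v)" for th c
    have Dsp: "dpred {} (\<lambda>s. sp (t s) (u s))" if "dterm {} t" "dterm {} u" for t u
      by (rule dpred_sub2[OF _ that]) (unfold sp_def, intro dfn DP)
    have sp0: "sp t0 c0" unfolding sp_def using tc(3) z \<open>P y\<close> by blast
    \<comment> \<open>Neither \<open>th\<close> nor \<open>c\<close> refers to \<open>z\<close> or
      \<open>y\<close>, so both are definable without parameters and so are the two pieces.\<close>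
    define th where "th = least_ord (\<lambda>th. \<exists>c. c \<epsilon> Formulas \<and> sp th c)"
    define c where "c = choose_code (sep Formulas (sp th))"
    have dth: "dterm {} (\<lambda>s. th)" unfolding th_def by (intro dfn Dsp)
    have dc: "dterm {} (\<lambda>s. c)" unfolding c_def by (intro dfn Dsp dth)
    have "\<exists>c. c \<epsilon> Formulas \<and> sp th c" unfolding th_def
      by (rule least_ord(2)[of "\<lambda>th. \<exists>c. c \<epsilon> Formulas \<and> sp th c", OF _ tc(1)]) (use tc(2) sp0 in \<open>intro dpred_UNIV dfn Dsp | blast\<close>)+
    moreover have "dpred UNIV (\<lambda>s. sp th (s 0))" by (intro dpred_UNIV Dsp dth dfn)
    ultimately have "sp th c" unfolding c_def using choose_code_mem(2)[of "sp th"] by blast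
    then obtain u v where uv: "P u" "P v" "truth th c u" "\<not> truth th c v" unfolding sp_def by blast
    have sub: "card {w. P w \<and> truth th c w} < card {w. P w}" "card {w. P w \<and> \<not> truth th c w} < card {w. P w}"
      by (rule psubset_card_mono[OF fin]; use uv in blast)+
    show ?thesis
    proof (cases "truth th c z")
      case True
      show ?thesis
      proof (rule less.hyps[OF sub(1)])
        show "finite {w. P w \<and> truth th c w}" using fin by (rule rev_finite_subset) blast
        show "dpred {} (\<lambda>s. P (s 0) \<and> truth th c (s 0))" by (intro dfn DP dth dc)
      qed (use dist z True in blast)+
    next
      case False
      show ?thesis
      proof (rule less.hyps[OF sub(2)])
        show "finite {w. P w \<and> \<not> truth th c w}" using fin by (rule rev_finite_subset) blast
        show "dpred {} (\<lambda>s. P (s 0) \<and> \<not> truth th c (s 0))" by (intro dfn DP dth dc)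
      qed (use dist z False in blast)+
    qed
  qed
qed

lemma algebraic_indist_eq:
  assumes alg: "algebraic E" and "indist x y"
  shows "x = y"
proof -
  define good where "good z \<longleftrightarrow> (\<forall>y. indist z y \<longrightarrow> z = y)" for z
  have Dgood: "dpred C (\<lambda>s. good (t s))" if "dterm C t" for C t
    by (rule dpred_sub1[OF _ that]) (unfold good_def, intro dfn)
  have def: "dterm {} (\<lambda>s. z)" if "good z" for z
  proof -
    obtain P where P: "dpred {} (\<lambda>s. P (s 0))" "finite {b. P b}" "P z"
      using alg algebraicD unfolding algebraic_def by metis
    \<comment> \<open>The finite class \<open>P\<close> may contain indistinguishable elements;
      \<open>good\<close>, itself parameter-free, discards them and keeps \<open>z\<close>.\<close>
    have "definable_in E z"
    proof (rule finite_distinguished_definable[of "\<lambda>z. P z \<and> good z"])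
      show "finite {z. P z \<and> good z}" using P(2) by (rule rev_finite_subset) blast
      show "dpred {} (\<lambda>s. P (s 0) \<and> good (s 0))" by (intro dfn P Dgood)
    qed (use P that in \<open>auto simp: good_def\<close>)
    then show ?thesis by (simp add: definable_iff)
  qed
  have "good x"
  proof (rule mem_induct[where P=good])
    show "dpred UNIV (\<lambda>s. good (s 0))" by (intro Dgood dfn)
    fix x assume IH: "\<forall>z. z \<epsilon> x \<longrightarrow> good z"
    show "good x" unfolding good_def
    proof (intro allI impI)
      fix y assume xy: "indist x y"
      \<comment> \<open>Having only good members is a parameter-free property and so passes from
        \<open>x\<close> to \<open>y\<close>.\<close>
      have "dpred {} (\<lambda>s. \<forall>z. z \<epsilon> s 0 \<longrightarrow> good z)" by (intro dfn Dgood)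
      from indist_dpred[OF xy this] IH have "\<forall>z. z \<epsilon> y \<longrightarrow> good z" by blast
      then have *: "good z" if "z \<epsilon> x \<or> z \<epsilon> y" for z using that IH by blast
      show "x = y"
      proof (rule ccontr)
        assume "x \<noteq> y"
        then obtain z where z: "(z \<epsilon> x) \<noteq> (z \<epsilon> y)" using set_ext[of x y] by blast
        then have "dterm {} (\<lambda>s. z)" using * def by blast
        then have "dpred {} (\<lambda>s. z \<epsilon> s 0)" by (intro dfn)
        from indist_dpred[OF xy this] z show False by blast
      qed
    qed
  qed
  with assms(2) show ?thesis by (simp add: good_def)
qed

lemma algebraic_definable:
  assumes "algebraic E"
  shows "definable_in E a"
proof -
  obtain P where P: "dpred {} (\<lambda>s. P (s 0))" "finite {b. P b}" "P a"
    using assms algebraicD unfolding algebraic_def by metis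
  show ?thesis
    by (rule finite_distinguished_definable[OF P(2,1) _ P(3)]) (rule algebraic_indist_eq[OF assms])
qed

section \<open>Ordinal definability and choice functions\<close>

lemma definable_reflected:
  assumes "definable_in E x"
  obtains th p where "ord th" "x \<epsilon> V th" "\<And>y. y \<epsilon> V th \<Longrightarrow> truth th (code0 p) y \<longleftrightarrow> y = x"
    "\<And>y. y \<epsilon> V th \<Longrightarrow> satr (V th) p (\<lambda>_. y) \<longleftrightarrow> y = x"
proof -
  obtain p where p: "{b. sat E p (\<lambda>_. b)} = {x}"
    using assms by (auto simp: definable_in_def defined_set_def)
  obtain a where a: "ord a" "x \<epsilon> V a" using ex_V by blast
  obtain th where th: "ord th" "a \<epsilon> th" "\<And>x. x \<epsilon> V th \<Longrightarrow> truth th (code0 p) x \<longleftrightarrow> sat E p (\<lambda>_. x)"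
    "\<And>x. x \<epsilon> V th \<Longrightarrow> satr (V th) p (\<lambda>_. x) \<longleftrightarrow> sat E p (\<lambda>_. x)"
    using unary_reflection[OF a(1), where p=p] by blast
  show thesis
  proof (rule that[OF th(1)])
    show "x \<epsilon> V th" using V_mem_mono[OF th(2) a(2)] .
  qed (use th(3,4) p in blast)+
qed

lemma definable_OD:
  assumes "definable_in E x"
  shows "is_OD E x"
proof -
  obtain th p where th: "ord th" "x \<epsilon> V th" "\<And>y. y \<epsilon> V th \<Longrightarrow> satr (V th) p (\<lambda>_. y) \<longleftrightarrow> y = x"
    using definable_reflected[OF assms] by metis
  obtain S where S: "is_satisfaction E omega Formulas (V th) S" using ex_satisfaction by blast
  \<comment> \<open>The definition uses no ordinal parameters, so the sequence is constantly
    \<open>emp\<close>; its values must lie below \<open>th\<close>, which therefore has to be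
    nonempty.\<close>
  have "ord emp" unfolding is_ordinal_def is_transitive_iff by simp
  moreover have "th \<noteq> emp" using th(2) unfolding mem_V[of x] by auto
  ultimately have emp: "emp \<epsilon> th" using ord_linear[OF _ th(1), of emp] by auto
  have "is_ordinal_params E omega th (const_asg emp)"
    unfolding is_ordinal_params_def is_app_iff is_empty_iff
    using const_asg_fun_into[OF emp] emp_omega by (intro conjI exI[of _ emp]) (simp_all add: const_asg_def)
  moreover have "opair (code0 p) t \<epsilon> S \<longleftrightarrow> y = x"
    if t: "is_fun_into E t omega (V th)" "opair emp y \<epsilon> t" for t y
  proof -
    have "y \<epsilon> V th" using t unfolding is_fun_into_iff by blast
    then show ?thesis using satisfaction_code0[OF S t] th(3) by simp
  qed
  ultimately show ?thesis unfolding is_OD_def is_app_iff is_omega_iff is_empty_iff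
    using is_formulas_Formulas th(1,2) is_V_iff[OF th(1)] S code0_Formulas by blast
qed

text \<open>Genuine definitions show that some code defines a member of \<open>u\<close> in some
  level. The code \<open>cc u\<close> actually selected may be nonstandard, but it still singles out
  one member of \<open>u\<close>, uniformly in \<open>u\<close>, so the choices form a set by
  Replacement.\<close>

lemma definable_choice:
  assumes def: "\<And>x. definable_in E x" and a: "\<And>x. x \<epsilon> a \<Longrightarrow> x \<noteq> emp"
  shows "\<exists>f. is_fun E f a \<and> (\<forall>x y. opair x y \<epsilon> f \<longrightarrow> y \<epsilon> x)"
proof -
  define dfd where "dfd th c x \<longleftrightarrow> x \<epsilon> V th \<and> (\<forall>y. y \<epsilon> V th \<longrightarrow> (truth th c y \<longleftrightarrow> y = x))" for th c x
  have Ddfd: "dpred UNIV (\<lambda>s. dfd (t s) (u s) (v s))" if "dterm UNIV t" "dterm UNIV u" "dterm UNIV v" for t u v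
    by (rule dpred_sub3[OF _ that]) (unfold dfd_def, intro dfn)
  define tt where "tt u = least_ord (\<lambda>th. \<exists>c x. c \<epsilon> Formulas \<and> x \<epsilon> u \<and> dfd th c x)" for u
  have dtt: "dterm UNIV (\<lambda>s. tt (t s))" if "dterm UNIV t" for t
    by (rule dterm_sub1[OF _ that]) (unfold tt_def, intro dfn Ddfd)
  define cc where "cc u = choose_code (sep Formulas (\<lambda>c. \<exists>x. x \<epsilon> u \<and> dfd (tt u) c x))" for u
  have dcc: "dterm UNIV (\<lambda>s. cc (t s))" if "dterm UNIV t" for t
    by (rule dterm_sub1[OF _ that]) (unfold cc_def, intro dfn Ddfd dtt)
  define xx where "xx u = the1 (dfd (tt u) (cc u))" for u
  have dxx: "dterm UNIV (\<lambda>s. xx (s 0))"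
    unfolding xx_def by (intro dfn Ddfd dtt dcc)
  have "xx u \<epsilon> u" if u: "u \<epsilon> a" for u
  proof -
    obtain x where x: "x \<epsilon> u" using a[OF u] set_ext[of u emp] by auto
    obtain th p where "ord th" "x \<epsilon> V th" "\<And>y. y \<epsilon> V th \<Longrightarrow> truth th (code0 p) y \<longleftrightarrow> y = x"
      using definable_reflected[OF def] by metis
    then have th: "ord th" "dfd th (code0 p) x" unfolding dfd_def by blast+
    have "\<exists>c x. c \<epsilon> Formulas \<and> x \<epsilon> u \<and> dfd (tt u) c x"
      unfolding tt_def
      by (rule least_ord(2)[of "\<lambda>th. \<exists>c x. c \<epsilon> Formulas \<and> x \<epsilon> u \<and> dfd th c x", OF _ th(1)])
        (use th(2) x code0_Formulas in \<open>intro dfn Ddfd | blast\<close>)+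
    then obtain c where c: "c \<epsilon> Formulas" "\<exists>x. x \<epsilon> u \<and> dfd (tt u) c x" by blast
    have "\<exists>x. x \<epsilon> u \<and> dfd (tt u) (cc u) x" unfolding cc_def
      by (rule choose_code_mem(2)[of "\<lambda>c. \<exists>x. x \<epsilon> u \<and> dfd (tt u) c x", OF _ c]) (intro dfn Ddfd)
    then obtain y where y: "y \<epsilon> u" "dfd (tt u) (cc u) y" by blast
    have "xx u = y" unfolding xx_def by (rule the1_eq[of "dfd (tt u) (cc u)", OF y(2)]) (use y(2) in \<open>unfold dfd_def, blast\<close>)
    with y show ?thesis by simp
  qed
  then show ?thesis using is_fun_graph_on[OF dxx, of a] by (intro exI[of _ "graph_on xx a"]) (simp add: opair_mem_graph_on[OF dxx])
qed

end

theorem theorem2: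
  fixes E :: "'a \<Rightarrow> 'a \<Rightarrow> bool"
  assumes "models E ZF" and "algebraic E"
  shows "pointwise_definable E \<and> models E (ZFC \<union> {V_eq_HOD})"
proof -
  interpret zf E by unfold_locales (rule assms(1))
  have def: "definable_in E a" for a by (rule algebraic_definable[OF assms(2)])
  have "is_HOD E x" for x
    unfolding is_HOD_def using definable_OD[OF def] ex_trcl by blast
  then have "sat E V_eq_HOD s" for s by (simp add: sat_axioms)
  moreover have "sat E Choice_ax s" for s
    unfolding sat_axioms is_app_iff is_empty_iff using definable_choice[OF def] by blast
  ultimately have "models E (ZFC \<union> {V_eq_HOD})"
    using assms(1) by (auto simp: models_def ZFC_def)
  with def show ?thesis by (simp add: pointwise_definable_def)
qed

end
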